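(* The sequence $(C_k)_{k\ge1}$ has the same joint distribution as the sequence $$\Big(\Big(E_1+\frac{E_2}{U_1}+\dots+\frac{E_{k+1}}{U_1\cdots U_k}\Big)\big(1-U_1\cdots U_k\big)\Big)_{k\ge1},$$ where $(E_j)_{j\ge1}$ are i.i.d. standard exponential and $(U_j)_{j\ge1}$ i.i.d. uniform $[0,1]$ random variables, all independent.
   Context: Let $\Pi$ be a homogeneous Poisson point process of unit intensity in the strip $[0,1]\times(-\infty,\infty)$, and let $R_+=[0,1]\times[0,\infty)$, $R_-=[0,1]\times(-\infty,0]$. A lower record is an atom $b\in R_+$ lower than every atom of $R_+$ to the left of $b$; an upper record is an atom $a\in R_-$ higher than every atom of $R_-$ to the left of $a$. Enumerate the (infinitely many) upper records as $a_1,a_2,\dots$ from right to left ($a_1$ is the highest atom of $R_-$). For each $j$, let $b_j$ be the adjoint lower record of $a_j$, i.e. the rightmost lower record to the left of $a_j$ (it exists almost surely). Writing $a_j=(x_{a_j},y_{a_j})$ and $b_j=(x_{b_j},y_{b_j})$, the corange at $a_j$ is $y_{b_j}-y_{a_j}$, and the corange-box area is $C_j=(1-x_{a_j})(y_{b_j}-y_{a_j})$. *)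

theory Defs
  imports "HOL-Probability.Probability"
begin

definition strip :: "(real \<times> real) set" where
  "strip = {0..1} \<times> UNIV"

definition Rplus :: "(real \<times> real) set" where
  "Rplus = {0..1} \<times> {0..}"

definition Rminus :: "(real \<times> real) set" where
  "Rminus = {0..1} \<times> {..0}"

definition lower_record :: "(real \<times> real) set \<Rightarrow> real \<times> real \<Rightarrow> bool" where
  "lower_record P b \<longleftrightarrow> b \<in> P \<inter> Rplus \<and>
     (\<forall>c \<in> P \<inter> Rplus. fst c < fst b \<longrightarrow> snd b < snd c)"

definition upper_record :: "(real \<times> real) set \<Rightarrow> real \<times> real \<Rightarrow> bool" where
  "upper_record P a \<longleftrightarrow> a \<in> P \<inter> Rminus \<and>
     (\<forall>c \<in> P \<inter> Rminus. fst c < fst a \<longrightarrow> snd c < snd a)"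

definition nth_upper_record :: "(real \<times> real) set \<Rightarrow> nat \<Rightarrow> real \<times> real \<Rightarrow> bool" where
  "nth_upper_record P j a \<longleftrightarrow> 1 \<le> j \<and> upper_record P a \<and>
     finite {a'. upper_record P a' \<and> fst a < fst a'} \<and>
     card {a'. upper_record P a' \<and> fst a < fst a'} = j - 1"

definition adjoint_lower_record :: "(real \<times> real) set \<Rightarrow> real \<times> real \<Rightarrow> real \<times> real \<Rightarrow> bool" where
  "adjoint_lower_record P a b \<longleftrightarrow> lower_record P b \<and> fst b < fst a \<and>
     (\<forall>b'. lower_record P b' \<and> fst b' < fst a \<longrightarrow> fst b' \<le> fst b)"

definition upper_rec :: "(real \<times> real) set \<Rightarrow> nat \<Rightarrow> real \<times> real" where
  "upper_rec P j = (THE a. nth_upper_record P j a)"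

definition adj_lower_rec :: "(real \<times> real) set \<Rightarrow> nat \<Rightarrow> real \<times> real" where
  "adj_lower_rec P j = (THE b. adjoint_lower_record P (upper_rec P j) b)"

definition corange_area :: "(real \<times> real) set \<Rightarrow> nat \<Rightarrow> real" where
  "corange_area P j = (1 - fst (upper_rec P j)) * (snd (adj_lower_rec P j) - snd (upper_rec P j))"

definition unit_poisson_strip :: "'w measure \<Rightarrow> ('w \<Rightarrow> (real \<times> real) set) \<Rightarrow> bool" where
  "unit_poisson_strip M Xi \<longleftrightarrow> prob_space M \<and>
     (\<forall>\<omega> \<in> space M. Xi \<omega> \<subseteq> strip \<and> (\<forall>K. bounded K \<longrightarrow> finite (Xi \<omega> \<inter> K))) \<and>
     (\<forall>A. A \<in> sets borel \<longrightarrow> bounded A \<longrightarrow> A \<subseteq> strip \<longrightarrow>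
        (\<lambda>\<omega>. card (Xi \<omega> \<inter> A)) \<in> measurable M (count_space UNIV) \<and>
        (\<forall>k::nat. measure M {\<omega> \<in> space M. card (Xi \<omega> \<inter> A) = k} =
            measure lborel A ^ k / fact k * exp (- measure lborel A))) \<and>
     (\<forall>(I::nat set) A. finite I \<longrightarrow> disjoint_family_on A I \<longrightarrow>
        (\<forall>i\<in>I. A i \<in> sets borel \<and> bounded (A i) \<and> A i \<subseteq> strip) \<longrightarrow>
        prob_space.indep_vars M (\<lambda>_. count_space UNIV) (\<lambda>i \<omega>. card (Xi \<omega> \<inter> A i)) I)"

end

(* Only void probabilities P(no atom in Z) = exp(-|Z|) and the almost sure absence of two atoms on a
   common vertical line enter. Let F(t), G(t) be the distance to the axis of the atom of R_+, R_- nearest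
   to it among those with abscissa < t. Both are functions of void events, so they are independent and
   their laws are determined by void probabilities of staircase regions.

   The records of R_- are the jumps of G. If T_k = U_1...U_k and g_k = sum_{i<=k} E_i / T_(i-1), then
   the probability that no (T_k, g_k) lies in a staircase D satisfies a one-step recursion whose
   solution is exp(-|D|); hence (T_k, g_k) has the law of the sequence of upper records.

   The corange is then g_k + F(T_k). Given the T_k, splitting columns shows that F(T_k) is a Markov chain:
   from t to t u it keeps its value with probability u and otherwise gains an exponential variable
   of rate t u. An exponential variable of rate t plus such an increment is exponential of rate t u,
   so g_k + F(T_k) has the increments of g_(k+1). *)
theory Submission
  imports Defs
begin

section \<open>Exponential variables\<close>

text \<open>Splitting columns builds F from left to right: F(t) is the minimum of F(t u) and an
  independent exponential contributed by the new column. The records run from right to left, so the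
  pair (F(t), F(t u)) must be re-read starting from its minimum.
  \<open>nn_integral_min_exponentials\<close> performs this reversal, and its weight
  \<open>b / (b + w)\<close> turns into the survival probability u.

  The start F(1) is itself standard exponential and takes the role of E_1. This is why the k-th
  corange has k+1 exponential summands although g_k has only k.

  The definite descriptions in \<open>upper_rec\<close> and \<open>adj_lower_rec\<close> are
  meaningful only for almost every configuration. Therefore the laws of whole paths are compared
  first, and fixed measurable functionals then read the records off a path. The areas agree almost
  surely with such functionals, which is why their law is formed under
  \<open>completion M\<close>.\<close>

definition std_exp :: "real measure" where
  "std_exp = density lborel (exponential_density 1)"

lemma sets_std_exp [simp, measurable_cong]: "sets std_exp = sets borel"
  and space_std_exp [simp]: "space std_exp = UNIV"
  by (simp_all add: std_exp_def)

lemma prob_space_std_exp: "prob_space std_exp"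
  unfolding std_exp_def by (rule prob_space_exponential_density) simp

interpretation std_exp: prob_space std_exp
  by (rule prob_space_std_exp)

lemma AE_std_exp_pos: "AE x in std_exp. 0 < x"
proof -
  have "AE x in lborel. x \<noteq> (0::real)"
    by (rule AE_lborel_singleton)
  then show ?thesis
    unfolding std_exp_def
    by (subst AE_density) (auto simp: exponential_density_def elim!: eventually_mono)
qed

text \<open>Rates are always realised by scaling one standard exponential, which is the form
  \<open>E / T\<close> of the summands in the target sequence. This change of variables passes to
  the density of rate \<open>t\<close> where a computation needs it.\<close>

lemma nn_integral_exponential:
  fixes t :: real
  assumes t: "0 < t" and [measurable]: "f \<in> borel_measurable borel"
  shows "(\<integral>\<^sup>+x. f (x / t) \<partial>std_exp) =
    (\<integral>\<^sup>+x. ennreal (exponential_density t x) * f x \<partial>lborel)"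
proof -
  have "(\<integral>\<^sup>+x. f (x / t) \<partial>std_exp) = (\<integral>\<^sup>+x. ennreal (exponential_density 1 x) * f (x / t) \<partial>lborel)"
    unfolding std_exp_def by (subst nn_integral_density) auto
  also have "\<dots> = ennreal \<bar>t\<bar> * (\<integral>\<^sup>+x. ennreal (exponential_density 1 (0 + t * x)) * f ((0 + t * x) / t) \<partial>lborel)"
    using t by (intro nn_integral_real_affine) auto
  also have "\<dots> = (\<integral>\<^sup>+x. ennreal t * (ennreal (exponential_density 1 (t * x)) * f x) \<partial>lborel)"
    using t by (subst nn_integral_cmult) auto
  also have "\<dots> = (\<integral>\<^sup>+x. ennreal (exponential_density t x) * f x \<partial>lborel)"
  proof (intro nn_integral_cong)
    fix x
    have "ennreal t * ennreal (exponential_density 1 (t * x)) = ennreal (exponential_density t x)"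
      using t by (subst ennreal_mult[symmetric])
        (auto simp: exponential_density_def mult_less_0_iff mult.commute)
    then show "ennreal t * (ennreal (exponential_density 1 (t * x)) * f x) =
        ennreal (exponential_density t x) * f x"
      by (simp add: mult.assoc[symmetric])
  qed
  finally show ?thesis .
qed

lemma nn_integral_exponential_tail:
  assumes w: "0 < w" and m: "0 \<le> m"
  shows "(\<integral>\<^sup>+x. ennreal (exponential_density w x) * indicator {m..} x \<partial>lborel) = ennreal (exp (- w * m))"
proof -
  have "(\<integral>\<^sup>+x. ennreal (exponential_density w x) * indicator {m..} x \<partial>lborel)
      = (\<integral>\<^sup>+x. ennreal (w * exp (- x * w)) * indicator {m..} x \<partial>lborel)"
    using m by (intro nn_integral_cong) (auto simp: exponential_density_def split: split_indicator)
  also have "\<dots> = ennreal (0 - (- exp (- m * w)))"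
  proof (rule nn_integral_FTC_atLeast)
    show "((\<lambda>x. - exp (- x * w)) \<longlongrightarrow> 0) at_top"
    proof -
      have "((\<lambda>x::real. exp (- (x * w))) \<longlongrightarrow> 0) at_top"
        by (rule filterlim_compose[OF exp_at_bot], subst filterlim_uminus_at_bot)
          (use w in \<open>auto intro: filterlim_tendsto_pos_mult_at_top filterlim_at_top_mult_tendsto_pos filterlim_ident\<close>)
      from tendsto_minus[OF this] show ?thesis by simp
    qed
  qed (use w in \<open>auto intro!: derivative_eq_intros\<close>)
  finally show ?thesis by (simp add: mult.commute)
qed

lemma nn_integral_exponential_initial:
  assumes w: "0 < w" and m: "0 \<le> m"
  shows "(\<integral>\<^sup>+x. ennreal (exponential_density w x) * indicator {..m} x \<partial>lborel) = ennreal (1 - exp (- w * m))"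
proof -
  have "(\<integral>\<^sup>+x. ennreal (exponential_density w x) * indicator {..m} x \<partial>lborel)
      = (\<integral>\<^sup>+x. ennreal (w * exp (- x * w)) * indicator {0..m} x \<partial>lborel)"
    using m by (intro nn_integral_cong) (auto simp: exponential_density_def split: split_indicator)
  also have "\<dots> = ennreal (- exp (- m * w) - (- exp (- 0 * w)))"
    using w m by (intro nn_integral_FTC_Icc) (auto intro!: derivative_eq_intros)
  finally show ?thesis by (simp add: mult.commute)
qed

text \<open>Reversal of a column split. For independent X of rate \<open>w\<close> and Y of rate
  \<open>b\<close>, the minimum has rate \<open>b + w\<close>; with probability
  \<open>b / (b + w)\<close> it equals Y, and otherwise Y exceeds it by a fresh exponential of rate
  \<open>b\<close> by lack of memory. The arbitrary \<open>\<psi>\<close> makes this a statement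
  about the joint law of the minimum and Y.\<close>

lemma nn_integral_min_exponentials:
  fixes b w :: real and \<psi> :: "real \<Rightarrow> real \<Rightarrow> ennreal"
  assumes b: "0 < b" and w: "0 < w"
    and [measurable]: "case_prod \<psi> \<in> borel_measurable (borel \<Otimes>\<^sub>M borel)"
  shows "(\<integral>\<^sup>+x. \<integral>\<^sup>+m. \<psi> (min (x / w) (m / b)) (m / b) \<partial>std_exp \<partial>std_exp) =
    (\<integral>\<^sup>+m. (ennreal (b / (b + w)) * \<psi> (m / (b + w)) (m / (b + w)) +
       ennreal (w / (b + w)) * (\<integral>\<^sup>+y. \<psi> (m / (b + w)) (m / (b + w) + y / b) \<partial>std_exp)) \<partial>std_exp)"
    (is "?L = ?R")
proof -
  let ?d = exponential_density
  note [measurable] = borel_measurable_erlang_density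
  have "?L = (\<integral>\<^sup>+x. \<integral>\<^sup>+m. ennreal (?d w x) * (ennreal (?d b m) * \<psi> (min x m) m) \<partial>lborel \<partial>lborel)"
  proof -
    have "?L = (\<integral>\<^sup>+x. \<integral>\<^sup>+m. ennreal (?d b m) * \<psi> (min (x / w) m) m \<partial>lborel \<partial>std_exp)"
      using b by (intro nn_integral_cong nn_integral_exponential) auto
    also have "\<dots> = (\<integral>\<^sup>+x. ennreal (?d w x) * (\<integral>\<^sup>+m. ennreal (?d b m) * \<psi> (min x m) m \<partial>lborel) \<partial>lborel)"
      using w by (intro nn_integral_exponential[where f="\<lambda>x. \<integral>\<^sup>+m. ennreal (?d b m) * \<psi> (min x m) m \<partial>lborel"]) auto
    also have "\<dots> = (\<integral>\<^sup>+x. \<integral>\<^sup>+m. ennreal (?d w x) * (ennreal (?d b m) * \<psi> (min x m) m) \<partial>lborel \<partial>lborel)"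
      by (intro nn_integral_cong nn_integral_cmult[symmetric]) auto
    finally show ?thesis .
  qed
  \<comment> \<open>\<open>?A\<close> is the case where the minimum is attained by \<open>m\<close>,
    so that \<open>x\<close> integrates out to a tail; \<open>?B\<close> is the case
    \<open>x < m\<close>, where lack of memory applies.\<close>
  also have "\<dots> = (\<integral>\<^sup>+x. \<integral>\<^sup>+m. ennreal (?d w x) * indicator {m..} x * (ennreal (?d b m) * \<psi> m m) \<partial>lborel \<partial>lborel)
      + (\<integral>\<^sup>+x. \<integral>\<^sup>+m. ennreal (?d w x) * (indicator {x<..} m * ennreal (?d b m) * \<psi> x m) \<partial>lborel \<partial>lborel)"
    (is "_ = ?A + ?B")
  proof -
    have "(\<integral>\<^sup>+x. \<integral>\<^sup>+m. ennreal (?d w x) * (ennreal (?d b m) * \<psi> (min x m) m) \<partial>lborel \<partial>lborel)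
      = (\<integral>\<^sup>+x. \<integral>\<^sup>+m. ennreal (?d w x) * indicator {m..} x * (ennreal (?d b m) * \<psi> m m)
       + ennreal (?d w x) * (indicator {x<..} m * ennreal (?d b m) * \<psi> x m) \<partial>lborel \<partial>lborel)"
      by (intro nn_integral_cong) (auto split: split_indicator simp: min_def)
    also have "\<dots> = (\<integral>\<^sup>+x. (\<integral>\<^sup>+m. ennreal (?d w x) * indicator {m..} x * (ennreal (?d b m) * \<psi> m m) \<partial>lborel)
       + (\<integral>\<^sup>+m. ennreal (?d w x) * (indicator {x<..} m * ennreal (?d b m) * \<psi> x m) \<partial>lborel) \<partial>lborel)"
      by (intro nn_integral_cong nn_integral_add) (auto simp: atLeast_def greaterThan_def)
    also have "\<dots> = ?A + ?B"
      by (intro nn_integral_add) (auto simp: atLeast_def greaterThan_def)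
    finally show ?thesis .
  qed
  also have "?A = (\<integral>\<^sup>+m. ennreal (?d (b + w) m) * (ennreal (b / (b + w)) * \<psi> m m) \<partial>lborel)"
  proof -
    have "?A = (\<integral>\<^sup>+m. \<integral>\<^sup>+x. ennreal (?d w x) * indicator {m..} x * (ennreal (?d b m) * \<psi> m m) \<partial>lborel \<partial>lborel)"
      by (intro lborel_pair.Fubini') (auto simp: atLeast_def)
    also have "\<dots> = (\<integral>\<^sup>+m. (\<integral>\<^sup>+x. ennreal (?d w x) * indicator {m..} x \<partial>lborel) * (ennreal (?d b m) * \<psi> m m) \<partial>lborel)"
      by (intro nn_integral_cong nn_integral_multc) auto
    also have "\<dots> = (\<integral>\<^sup>+m. ennreal (?d (b + w) m) * (ennreal (b / (b + w)) * \<psi> m m) \<partial>lborel)"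
    proof (intro nn_integral_cong)
      fix m :: real
      show "(\<integral>\<^sup>+x. ennreal (?d w x) * indicator {m..} x \<partial>lborel) * (ennreal (?d b m) * \<psi> m m) =
        ennreal (?d (b + w) m) * (ennreal (b / (b + w)) * \<psi> m m)"
      proof (cases "0 \<le> m")
        case True
        have "?d (b + w) m = (b + w) * (exp (- w * m) * exp (- b * m))"
          using True by (simp add: exponential_density_def exp_add[symmetric] algebra_simps)
        then have "?d (b + w) m * (b / (b + w)) = exp (- w * m) * ?d b m"
          using True b w by (simp add: exponential_density_def mult.commute)
        then have "ennreal (exp (- w * m)) * ennreal (?d b m) = ennreal (?d (b + w) m) * ennreal (b / (b + w))"
          using b w by (simp add: ennreal_mult[symmetric] exponential_density_nonneg)
        then show ?thesis
          using True by (simp add: nn_integral_exponential_tail[OF w] mult.assoc[symmetric])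
      qed (simp add: exponential_density_def)
    qed
    finally show ?thesis .
  qed
  also have "?B = (\<integral>\<^sup>+x. ennreal (?d (b + w) x) * (ennreal (w / (b + w)) * (\<integral>\<^sup>+y. \<psi> x (x + y / b) \<partial>std_exp)) \<partial>lborel)"
  proof (intro nn_integral_cong)
    fix x :: real
    have "(\<integral>\<^sup>+m. ennreal (?d w x) * (indicator {x<..} m * ennreal (?d b m) * \<psi> x m) \<partial>lborel)
      = ennreal (?d w x) * (\<integral>\<^sup>+m. indicator {x<..} m * ennreal (?d b m) * \<psi> x m \<partial>lborel)"
      by (intro nn_integral_cmult) auto
    also have "(\<integral>\<^sup>+m. indicator {x<..} m * ennreal (?d b m) * \<psi> x m \<partial>lborel)
      = ennreal \<bar>1\<bar> * (\<integral>\<^sup>+y. indicator {x<..} (x + 1 * y) * ennreal (?d b (x + 1 * y)) * \<psi> x (x + 1 * y) \<partial>lborel)"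
      by (intro nn_integral_real_affine) auto
    also have "ennreal (?d w x) * \<dots> = ennreal (?d w x) * (\<integral>\<^sup>+y. ennreal (exp (- b * x)) * (ennreal (?d b y) * \<psi> x (x + y)) \<partial>lborel)"
    proof (cases "0 \<le> x")
      case True
      have "(\<integral>\<^sup>+y. indicator {x<..} (x + 1 * y) * ennreal (?d b (x + 1 * y)) * \<psi> x (x + 1 * y) \<partial>lborel)
        = (\<integral>\<^sup>+y. ennreal (exp (- b * x)) * (ennreal (?d b y) * \<psi> x (x + y)) \<partial>lborel)"
      proof (intro nn_integral_cong_AE)
        \<comment> \<open>At \<open>y = 0\<close> the strict indicator vanishes while the density
          equals \<open>b\<close>, so the two sides agree only almost everywhere.\<close>
        have "AE y in lborel. y \<noteq> (0::real)"
          by (rule AE_lborel_singleton)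
        then show "AE y in lborel. indicator {x<..} (x + 1 * y) * ennreal (?d b (x + 1 * y)) * \<psi> x (x + 1 * y)
          = ennreal (exp (- b * x)) * (ennreal (?d b y) * \<psi> x (x + y))"
        proof eventually_elim
          case (elim y)
          show ?case
          proof (cases "0 < y")
            case y: True
            have "ennreal (?d b (x + y)) = ennreal (exp (- b * x)) * ennreal (?d b y)"
              using True y b by (subst ennreal_mult[symmetric])
                (auto simp: exponential_density_def exp_add[symmetric] algebra_simps)
            then show ?thesis
              using y by (simp add: mult.assoc)
          qed (use elim in \<open>auto simp: exponential_density_def\<close>)
        qed
      qed
      then show ?thesis by simp
    qed (simp add: exponential_density_def)
    also have "(\<integral>\<^sup>+y. ennreal (exp (- b * x)) * (ennreal (?d b y) * \<psi> x (x + y)) \<partial>lborel)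
       = ennreal (exp (- b * x)) * (\<integral>\<^sup>+y. ennreal (?d b y) * \<psi> x (x + y) \<partial>lborel)"
      by (intro nn_integral_cmult) auto
    also have "(\<integral>\<^sup>+y. ennreal (?d b y) * \<psi> x (x + y) \<partial>lborel) = (\<integral>\<^sup>+y. \<psi> x (x + y / b) \<partial>std_exp)"
      using b by (intro nn_integral_exponential[symmetric]) auto
    also have "ennreal (?d w x) * (ennreal (exp (- b * x)) * (\<integral>\<^sup>+y. \<psi> x (x + y / b) \<partial>std_exp))
      = ennreal (?d (b + w) x) * (ennreal (w / (b + w)) * (\<integral>\<^sup>+y. \<psi> x (x + y / b) \<partial>std_exp))"
    proof -
      have "?d (b + w) x = (if x < 0 then 0 else (b + w) * (exp (- w * x) * exp (- b * x)))"
        by (simp add: exponential_density_def exp_add[symmetric] algebra_simps)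
      then have "?d (b + w) x * (w / (b + w)) = ?d w x * exp (- b * x)"
        using b w by (simp add: exponential_density_def mult.commute)
      then have "ennreal (?d w x) * ennreal (exp (- b * x)) = ennreal (?d (b + w) x) * ennreal (w / (b + w))"
        using b w by (simp add: ennreal_mult[symmetric] exponential_density_nonneg)
      then show ?thesis by (simp add: mult.assoc[symmetric])
    qed
    finally show "(\<integral>\<^sup>+m. ennreal (?d w x) * (indicator {x<..} m * ennreal (?d b m) * \<psi> x m) \<partial>lborel) =
      ennreal (?d (b + w) x) * (ennreal (w / (b + w)) * (\<integral>\<^sup>+y. \<psi> x (x + y / b) \<partial>std_exp))" .
  qed
  also have "(\<integral>\<^sup>+m. ennreal (?d (b + w) m) * (ennreal (b / (b + w)) * \<psi> m m) \<partial>lborel) + \<dots>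
    = (\<integral>\<^sup>+m. ennreal (?d (b + w) m) * (ennreal (b / (b + w)) * \<psi> m m +
       ennreal (w / (b + w)) * (\<integral>\<^sup>+y. \<psi> m (m + y / b) \<partial>std_exp)) \<partial>lborel)"
    by (subst nn_integral_add[symmetric]) (auto simp: distrib_left)
  also have "\<dots> = ?R"
    using b w by (subst nn_integral_exponential[where t="b + w" and
      f="\<lambda>m. ennreal (b / (b + w)) * \<psi> m m + ennreal (w / (b + w)) * (\<integral>\<^sup>+y. \<psi> m (m + y / b) \<partial>std_exp)"]) auto
  finally show ?thesis .
qed

text \<open>The convolution of the densities of rates \<open>t\<close> and \<open>t * u\<close>,
  weighted by \<open>1 - u\<close>, is the density of rate \<open>t * u\<close> times
  \<open>1 - exp (- t (1 - u) z)\<close>. What is missing from the full density of rate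
  \<open>t * u\<close> is \<open>t u exp (- t z)\<close>, exactly \<open>u\<close> times the density
  of rate \<open>t\<close>.\<close>

lemma nn_integral_exponential_thinned_sum:
  fixes t u :: real and k :: "real \<Rightarrow> ennreal"
  assumes t: "0 < t" and u: "0 < u" "u < 1" and [measurable]: "k \<in> borel_measurable borel"
  shows "(\<integral>\<^sup>+x. (ennreal u * k (x / t) + ennreal (1 - u) * (\<integral>\<^sup>+w. k (x / t + w / (t * u)) \<partial>std_exp)) \<partial>std_exp)
    = (\<integral>\<^sup>+x. k (x / (t * u)) \<partial>std_exp)" (is "?L = ?R")
proof -
  let ?d = exponential_density
  note [measurable] = borel_measurable_erlang_density
  have tu: "0 < t * u" using t u by simp
  have "?L = (\<integral>\<^sup>+x. ennreal (?d t x) * (ennreal u * k x + ennreal (1 - u) * (\<integral>\<^sup>+w. k (x + w / (t * u)) \<partial>std_exp)) \<partial>lborel)"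
    by (rule nn_integral_exponential[OF t]) simp
  also have "\<dots> = (\<integral>\<^sup>+x. ennreal (?d t x) * (ennreal u * k x) +
      (\<integral>\<^sup>+z. ennreal (1 - u) * ennreal (?d t x) * indicator {x..} z * ennreal (?d (t*u) (z - x)) * k z \<partial>lborel) \<partial>lborel)"
  proof (intro nn_integral_cong)
    fix x
    have "(\<integral>\<^sup>+w. k (x + w / (t * u)) \<partial>std_exp) = (\<integral>\<^sup>+w. ennreal (?d (t * u) w) * k (x + w) \<partial>lborel)"
      using tu by (intro nn_integral_exponential) auto
    also have "\<dots> = ennreal \<bar>1\<bar> * (\<integral>\<^sup>+z. ennreal (?d (t * u) (- x + 1 * z)) * k (x + (- x + 1 * z)) \<partial>lborel)"
      by (intro nn_integral_real_affine) auto
    also have "\<dots> = (\<integral>\<^sup>+z. indicator {x..} z * ennreal (?d (t*u) (z - x)) * k z \<partial>lborel)"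
      by (auto intro!: nn_integral_cong simp: exponential_density_def split: split_indicator)
    finally have *: "(\<integral>\<^sup>+w. k (x + w / (t * u)) \<partial>std_exp) =
        (\<integral>\<^sup>+z. indicator {x..} z * ennreal (?d (t*u) (z - x)) * k z \<partial>lborel)" .
    show "ennreal (?d t x) * (ennreal u * k x + ennreal (1 - u) * (\<integral>\<^sup>+w. k (x + w / (t * u)) \<partial>std_exp)) =
      ennreal (?d t x) * (ennreal u * k x) +
      (\<integral>\<^sup>+z. ennreal (1 - u) * ennreal (?d t x) * indicator {x..} z * ennreal (?d (t*u) (z - x)) * k z \<partial>lborel)"
      unfolding * distrib_left
      by (subst nn_integral_cmult[symmetric], simp)+ (simp add: ac_simps)
  qed
  also have "\<dots> = (\<integral>\<^sup>+x. ennreal (?d t x) * (ennreal u * k x) \<partial>lborel) +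
      (\<integral>\<^sup>+x. \<integral>\<^sup>+z. ennreal (1 - u) * ennreal (?d t x) * indicator {x..} z * ennreal (?d (t*u) (z - x)) * k z \<partial>lborel \<partial>lborel)"
    by (intro nn_integral_add) (auto simp: atLeast_def)
  also have "(\<integral>\<^sup>+x. \<integral>\<^sup>+z. ennreal (1 - u) * ennreal (?d t x) * indicator {x..} z * ennreal (?d (t*u) (z - x)) * k z \<partial>lborel \<partial>lborel)
    = (\<integral>\<^sup>+z. \<integral>\<^sup>+x. ennreal (1 - u) * ennreal (?d t x) * indicator {x..} z * ennreal (?d (t*u) (z - x)) * k z \<partial>lborel \<partial>lborel)"
    by (intro lborel_pair.Fubini') (auto simp: atLeast_def)
  also have "\<dots> = (\<integral>\<^sup>+z. ennreal (?d (t*u) z) * ennreal (1 - exp (- (t * (1 - u)) * z)) * k z \<partial>lborel)"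
  proof (intro nn_integral_cong)
    fix z :: real
    have "(\<integral>\<^sup>+x. ennreal (1 - u) * ennreal (?d t x) * indicator {x..} z * ennreal (?d (t*u) (z - x)) * k z \<partial>lborel)
      = (\<integral>\<^sup>+x. ennreal (?d (t*u) z) * k z * (ennreal (?d (t * (1 - u)) x) * indicator {..z} x) \<partial>lborel)"
    proof (intro nn_integral_cong)
      fix x :: real
      show "ennreal (1 - u) * ennreal (?d t x) * indicator {x..} z * ennreal (?d (t*u) (z - x)) * k z
        = ennreal (?d (t*u) z) * k z * (ennreal (?d (t * (1 - u)) x) * indicator {..z} x)"
      proof (cases "0 \<le> x \<and> x \<le> z")
        case True
        have "ennreal (1 - u) * ennreal (?d t x) * ennreal (?d (t*u) (z - x)) = ennreal (?d (t*u) z) * ennreal (?d (t * (1 - u)) x)"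
        proof -
          \<comment> \<open>The exponents satisfy
            \<open>t x + t u (z - x) = t u z + t (1 - u) x\<close>, so for fixed \<open>z\<close>
            the dependence on \<open>x\<close> is a density of rate \<open>t (1 - u)\<close>, to be
            integrated up to \<open>z\<close>.\<close>
          have "(1 - u) * ?d t x * ?d (t*u) (z - x) = ?d (t*u) z * ?d (t * (1 - u)) x"
            using True by (simp add: exponential_density_def exp_add[symmetric] algebra_simps)
          then show ?thesis
            using t u tu True by (simp add: ennreal_mult[symmetric] exponential_density_nonneg)
        qed
        then show ?thesis
          using True by (simp add: ac_simps)
      qed (auto simp: exponential_density_def split: split_indicator)
    qed
    also have "\<dots> = ennreal (?d (t*u) z) * k z * (\<integral>\<^sup>+x. ennreal (?d (t * (1 - u)) x) * indicator {..z} x \<partial>lborel)"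
      by (intro nn_integral_cmult) auto
    also have "\<dots> = ennreal (?d (t*u) z) * ennreal (1 - exp (- (t * (1 - u)) * z)) * k z"
    proof (cases "0 \<le> z")
      case True
      then show ?thesis
        using t u by (subst nn_integral_exponential_initial) (auto simp: ac_simps)
    qed (simp add: exponential_density_def)
    finally show "(\<integral>\<^sup>+x. ennreal (1 - u) * ennreal (?d t x) * indicator {x..} z * ennreal (?d (t*u) (z - x)) * k z \<partial>lborel)
      = ennreal (?d (t*u) z) * ennreal (1 - exp (- (t * (1 - u)) * z)) * k z" .
  qed
  also have "(\<integral>\<^sup>+x. ennreal (?d t x) * (ennreal u * k x) \<partial>lborel) + \<dots> =
     (\<integral>\<^sup>+x. ennreal (?d (t * u) x) * k x \<partial>lborel)"
  proof (subst nn_integral_add[symmetric], simp, simp, intro nn_integral_cong)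
    fix x :: real
    show "ennreal (?d t x) * (ennreal u * k x) + ennreal (?d (t*u) x) * ennreal (1 - exp (- (t * (1 - u)) * x)) * k x
      = ennreal (?d (t * u) x) * k x"
    proof (cases "0 \<le> x")
      case True
      have "t * (1 - u) \<ge> 0" using t u by simp
      then have pos: "0 \<le> 1 - exp (- (t * (1 - u)) * x)"
        using True by (simp add: mult_nonneg_nonneg)
      have "?d t x * u + ?d (t*u) x * (1 - exp (- (t * (1 - u)) * x)) = ?d (t * u) x"
        using True by (simp add: exponential_density_def exp_add[symmetric] algebra_simps)
      then have "ennreal (?d t x) * ennreal u + ennreal (?d (t*u) x) * ennreal (1 - exp (- (t * (1 - u)) * x)) = ennreal (?d (t * u) x)"
        using t u tu pos by (simp add: ennreal_mult[symmetric] ennreal_plus[symmetric] exponential_density_nonneg del: ennreal_plus)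
      then show ?thesis
        by (metis (no_types, lifting) distrib_right mult.assoc)
    qed (simp add: exponential_density_def)
  qed
  also have "\<dots> = ?R"
    by (rule nn_integral_exponential[OF tu, symmetric]) simp
  finally show ?thesis .
qed

section \<open>Sequences of exponential and uniform variables\<close>

definition unif :: "real measure" where
  "unif = density lborel (indicator {0..1})"

lemma sets_unif [simp, measurable_cong]: "sets unif = sets borel"
  and space_unif [simp]: "space unif = UNIV"
  by (simp_all add: unif_def)

interpretation unif: prob_space unif
  by standard (simp add: unif_def emeasure_density)

lemma AE_unif: "AE u in unif. 0 < u \<and> u < 1"
proof -
  have "AE u in lborel. u \<noteq> (0::real)" "AE u in lborel. u \<noteq> (1::real)"
    by (rule AE_lborel_singleton)+
  then have "AE u in lborel. 0 < (indicator {0..1} u :: ennreal) \<longrightarrow> 0 < u \<and> u < (1::real)"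
    by eventually_elim (auto split: split_indicator)
  then show ?thesis
    unfolding unif_def by (subst AE_density) auto
qed

definition exp_unif :: "(real \<times> real) measure" where
  "exp_unif = std_exp \<Otimes>\<^sub>M unif"

lemma sets_exp_unif [simp, measurable_cong]: "sets exp_unif = sets (borel \<Otimes>\<^sub>M borel)"
  unfolding exp_unif_def by (intro sets_pair_measure_cong) simp_all

lemma space_exp_unif [simp]: "space exp_unif = UNIV"
  by (simp add: exp_unif_def space_pair_measure)

interpretation exp_unif_pair: pair_prob_space std_exp unif
  ..

interpretation exp_unif: prob_space exp_unif
  unfolding exp_unif_def by (rule exp_unif_pair.P.prob_space_axioms)

lemma nn_integral_exp_unif:
  assumes [measurable]: "f \<in> borel_measurable (borel \<Otimes>\<^sub>M borel)"
  shows "(\<integral>\<^sup>+z. f z \<partial>exp_unif) = (\<integral>\<^sup>+e. \<integral>\<^sup>+u. f (e, u) \<partial>unif \<partial>std_exp)"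
    and "(\<integral>\<^sup>+z. f z \<partial>exp_unif) = (\<integral>\<^sup>+u. \<integral>\<^sup>+e. f (e, u) \<partial>std_exp \<partial>unif)"
proof -
  have [measurable]: "f \<in> borel_measurable (std_exp \<Otimes>\<^sub>M unif)"
    by measurable
  show "(\<integral>\<^sup>+z. f z \<partial>exp_unif) = (\<integral>\<^sup>+e. \<integral>\<^sup>+u. f (e, u) \<partial>unif \<partial>std_exp)"
    unfolding exp_unif_def by (rule unif.nn_integral_fst[symmetric]) simp
  show "(\<integral>\<^sup>+z. f z \<partial>exp_unif) = (\<integral>\<^sup>+u. \<integral>\<^sup>+e. f (e, u) \<partial>std_exp \<partial>unif)"
    unfolding exp_unif_def by (rule exp_unif_pair.nn_integral_snd[symmetric]) simp
qed

lemma AE_exp_unif: "AE z in exp_unif. 0 < fst z \<and> 0 < snd z \<and> snd z < 1"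
proof -
  have "AE z in std_exp \<Otimes>\<^sub>M unif. 0 < fst z"
  proof (rule exp_unif_pair.AE_pair_measure)
    show "{z \<in> space (std_exp \<Otimes>\<^sub>M unif). 0 < fst z} \<in> sets (std_exp \<Otimes>\<^sub>M unif)"
      by measurable
  qed (use AE_std_exp_pos in auto)
  moreover have "AE z in std_exp \<Otimes>\<^sub>M unif. 0 < snd z \<and> snd z < 1"
  proof (rule exp_unif_pair.AE_pair_measure)
    show "{z \<in> space (std_exp \<Otimes>\<^sub>M unif). 0 < snd z \<and> snd z < 1} \<in> sets (std_exp \<Otimes>\<^sub>M unif)"
      by measurable
  qed (use AE_unif in auto)
  ultimately show ?thesis
    unfolding exp_unif_def by eventually_elim auto
qed

abbreviation exp_unif_seq :: "(nat \<Rightarrow> real \<times> real) measure" where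
  "exp_unif_seq \<equiv> PiM UNIV (\<lambda>_. exp_unif)"

interpretation exp_unif_seq: sequence_space exp_unif
  ..

lemma space_exp_unif_seq [simp]: "space exp_unif_seq = UNIV"
  by (simp add: space_PiM)

lemma measurable_seq_shift [measurable]: "(\<lambda>\<sigma> n. \<sigma> (Suc n)) \<in> exp_unif_seq \<rightarrow>\<^sub>M exp_unif_seq"
  by (rule measurable_PiM_single') auto

text \<open>Splitting off the first pair leaves a sequence with the same law; every recursion along
  the records rests on this.\<close>

lemma nn_integral_exp_unif_seq:
  assumes [measurable]: "f \<in> borel_measurable exp_unif_seq"
  shows "(\<integral>\<^sup>+\<sigma>. f \<sigma> \<partial>exp_unif_seq) = (\<integral>\<^sup>+z. \<integral>\<^sup>+\<sigma>. f (case_nat z \<sigma>) \<partial>exp_unif_seq \<partial>exp_unif)"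
proof -
  have "(\<integral>\<^sup>+\<sigma>. f \<sigma> \<partial>exp_unif_seq) =
      (\<integral>\<^sup>+\<sigma>. f \<sigma> \<partial>distr (exp_unif \<Otimes>\<^sub>M exp_unif_seq) exp_unif_seq (\<lambda>(z, \<sigma>). case_nat z \<sigma>))"
    by (simp only: exp_unif_seq.PiM_iter)
  also have "\<dots> = (\<integral>\<^sup>+p. f (case p of (z, \<sigma>) \<Rightarrow> case_nat z \<sigma>) \<partial>(exp_unif \<Otimes>\<^sub>M exp_unif_seq))"
    by (intro nn_integral_distr) simp_all
  also have "\<dots> = (\<integral>\<^sup>+z. \<integral>\<^sup>+\<sigma>. f (case_nat z \<sigma>) \<partial>exp_unif_seq \<partial>exp_unif)"
    by (subst exp_unif_seq.nn_integral_fst[symmetric]) simp_all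
  finally show ?thesis .
qed

lemma AE_exp_unif_seq: "AE \<sigma> in exp_unif_seq. \<forall>i. 0 < fst (\<sigma> i) \<and> 0 < snd (\<sigma> i) \<and> snd (\<sigma> i) < 1"
  unfolding AE_all_countable
proof
  fix i :: nat
  show "AE \<sigma> in exp_unif_seq. 0 < fst (\<sigma> i) \<and> 0 < snd (\<sigma> i) \<and> snd (\<sigma> i) < 1"
    using exp_unif_seq.AE_component[of i "\<lambda>z. 0 < fst z \<and> 0 < snd z \<and> snd z < 1"] AE_exp_unif by simp
qed

text \<open>Given the records \<open>\<sigma>\<close>, the height \<open>m\<close> of the nearest upper atom is a Markov chain in the record
  abscissa: it survives the step from \<open>t\<close> to \<open>t u\<close> with probability \<open>u\<close>, and otherwise gains an
  exponential of rate \<open>t u\<close>.\<close>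

primrec chain_value :: "(real \<Rightarrow> real \<Rightarrow> ennreal) list \<Rightarrow> real \<Rightarrow> real \<Rightarrow> real \<Rightarrow> (nat \<Rightarrow> real \<times> real) \<Rightarrow> ennreal" where
  "chain_value [] t g m \<sigma> = 1"
| "chain_value (f # fs) t g m \<sigma> =
    ennreal (snd (\<sigma> 0)) * (f (t * snd (\<sigma> 0)) (g + fst (\<sigma> 0) / t + m) *
        chain_value fs (t * snd (\<sigma> 0)) (g + fst (\<sigma> 0) / t) m (\<lambda>n. \<sigma> (Suc n))) +
    ennreal (1 - snd (\<sigma> 0)) * (\<integral>\<^sup>+w. f (t * snd (\<sigma> 0)) (g + fst (\<sigma> 0) / t + (m + w / (t * snd (\<sigma> 0)))) *
        chain_value fs (t * snd (\<sigma> 0)) (g + fst (\<sigma> 0) / t) (m + w / (t * snd (\<sigma> 0))) (\<lambda>n. \<sigma> (Suc n)) \<partial>std_exp)"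

text \<open>Expected product of test functions at the points (t T_i, s + g_(i+1) / t): each takes
  the abscissa before a step and the height after it. This lag is the one between T_k and g_(k+1) in
  the target sequence.\<close>

primrec path_value :: "(real \<Rightarrow> real \<Rightarrow> ennreal) list \<Rightarrow> real \<Rightarrow> real \<Rightarrow> ennreal" where
  "path_value [] t s = 1"
| "path_value (f # fs) t s = (\<integral>\<^sup>+z. f t (s + fst z / t) * path_value fs (t * snd z) (s + fst z / t) \<partial>exp_unif)"

text \<open>The recursion feeds functions of \<open>\<sigma>\<close> and of the integration variable
  into \<open>t\<close>, \<open>g\<close> and \<open>m\<close>, so the induction needs measurability
  in all arguments jointly.\<close>

lemma borel_measurable_chain_value_aux:
  assumes "\<forall>f\<in>set fs. case_prod f \<in> borel_measurable (borel \<Otimes>\<^sub>M borel)"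
  shows "(\<lambda>(t, g, m, \<sigma>). chain_value fs t g m \<sigma>) \<in> borel_measurable (borel \<Otimes>\<^sub>M borel \<Otimes>\<^sub>M borel \<Otimes>\<^sub>M exp_unif_seq)"
  using assms
proof (induction fs)
  case (Cons f fs)
  then have [measurable]: "case_prod f \<in> borel_measurable (borel \<Otimes>\<^sub>M borel)"
    "(\<lambda>(t, g, m, \<sigma>). chain_value fs t g m \<sigma>) \<in> borel_measurable (borel \<Otimes>\<^sub>M borel \<Otimes>\<^sub>M borel \<Otimes>\<^sub>M exp_unif_seq)"
    by auto
  have [measurable]: "(\<lambda>x. chain_value fs (t x) (g x) (m x) (\<sigma> x)) \<in> borel_measurable M"
    if [measurable]: "t \<in> borel_measurable M" "g \<in> borel_measurable M" "m \<in> borel_measurable M"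
      "\<sigma> \<in> M \<rightarrow>\<^sub>M exp_unif_seq" for t g m \<sigma> and M :: "'z measure"
  proof -
    have "(\<lambda>x. case (t x, g x, m x, \<sigma> x) of (t, g, m, \<sigma>) \<Rightarrow> chain_value fs t g m \<sigma>) \<in> borel_measurable M"
      by measurable
    then show ?thesis by simp
  qed
  show ?case
    by simp
qed (simp add: split_beta')

lemma borel_measurable_chain_value:
  assumes "\<forall>f\<in>set fs. case_prod f \<in> borel_measurable (borel \<Otimes>\<^sub>M borel)"
    and "t \<in> borel_measurable M" "g \<in> borel_measurable M" "m \<in> borel_measurable M" "\<sigma> \<in> M \<rightarrow>\<^sub>M exp_unif_seq"
  shows "(\<lambda>x. chain_value fs (t x) (g x) (m x) (\<sigma> x)) \<in> borel_measurable M"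
  using measurable_compose[OF measurable_Pair[OF assms(2) measurable_Pair[OF assms(3) measurable_Pair[OF assms(4,5)]]]
    borel_measurable_chain_value_aux[OF assms(1)]] by simp

lemma borel_measurable_path_value_aux:
  assumes "\<forall>f\<in>set fs. case_prod f \<in> borel_measurable (borel \<Otimes>\<^sub>M borel)"
  shows "case_prod (path_value fs) \<in> borel_measurable (borel \<Otimes>\<^sub>M borel)"
  using assms
proof (induction fs)
  case (Cons f fs)
  then have [measurable]: "case_prod f \<in> borel_measurable (borel \<Otimes>\<^sub>M borel)"
    "case_prod (path_value fs) \<in> borel_measurable (borel \<Otimes>\<^sub>M borel)"
    by auto
  show ?case
    by simp
qed (simp add: split_beta')

lemma borel_measurable_path_value:
  assumes "\<forall>f\<in>set fs. case_prod f \<in> borel_measurable (borel \<Otimes>\<^sub>M borel)"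
    and "t \<in> borel_measurable M" "s \<in> borel_measurable M"
  shows "(\<lambda>x. path_value fs (t x) (s x)) \<in> borel_measurable M"
  using measurable_compose[OF measurable_Pair[OF assms(2,3)] borel_measurable_path_value_aux[OF assms(1)]] by simp

text \<open>Averaged over the records, only the total \<open>g + m\<close> matters. In one step it
  gains an exponential of rate \<open>t\<close> from the records and, with probability
  \<open>1 - u\<close>, one of rate \<open>t u\<close> from the chain; together these are a single
  exponential of rate \<open>t u\<close>. The new abscissa is thus drawn before the height, whence
  the leading uniform factor on the right.\<close>

lemma nn_integral_chain_value:
  assumes "\<forall>f\<in>set fs. case_prod f \<in> borel_measurable (borel \<Otimes>\<^sub>M borel)" and "0 < t"
  shows "(\<integral>\<^sup>+\<sigma>. chain_value fs t g m \<sigma> \<partial>exp_unif_seq) = (\<integral>\<^sup>+u. path_value fs (t * u) (g + m) \<partial>unif)"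
  using assms
proof (induction fs arbitrary: t g m)
  case Nil
  then show ?case
    by (simp add: exp_unif_seq.emeasure_space_1[simplified] unif.emeasure_space_1[simplified])
next
  case (Cons f fs)
  from Cons.prems have fs: "\<forall>f\<in>set fs. case_prod f \<in> borel_measurable (borel \<Otimes>\<^sub>M borel)" by simp
  from Cons.prems have [measurable]: "case_prod f \<in> borel_measurable (borel \<Otimes>\<^sub>M borel)" by simp
  note [measurable (raw)] = borel_measurable_chain_value[OF fs] borel_measurable_path_value[OF fs]
  note mRW = borel_measurable_chain_value[OF Cons.prems(1)]
  \<comment> \<open>Value of the chain after one step to abscissa \<open>t * u\<close> with total
    gain \<open>x\<close> in height, the later steps being already averaged as in the induction
    hypothesis.\<close>
  define k where "k u x = f (t * u) (g + m + x) * (\<integral>\<^sup>+u'. path_value fs (t * u * u') (g + m + x) \<partial>unif)" for u x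
  have [measurable]: "case_prod k \<in> borel_measurable (borel \<Otimes>\<^sub>M borel)"
    unfolding k_def by measurable
  have "(\<integral>\<^sup>+\<sigma>. chain_value (f # fs) t g m \<sigma> \<partial>exp_unif_seq) =
    (\<integral>\<^sup>+z. \<integral>\<^sup>+\<sigma>. chain_value (f # fs) t g m (case_nat z \<sigma>) \<partial>exp_unif_seq \<partial>exp_unif)"
    by (rule nn_integral_exp_unif_seq, rule mRW) auto
  also have "\<dots> = (\<integral>\<^sup>+z. ennreal (snd z) * k (snd z) (fst z / t) +
      ennreal (1 - snd z) * (\<integral>\<^sup>+w. k (snd z) (fst z / t + w / (t * snd z)) \<partial>std_exp) \<partial>exp_unif)"
  proof (rule nn_integral_cong_AE, use AE_exp_unif in eventually_elim)
    fix z :: "real \<times> real"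
    assume z: "0 < fst z \<and> 0 < snd z \<and> snd z < 1"
    define t' g' where "t' = t * snd z" and "g' = g + fst z / t"
    have t': "0 < t'" using z Cons.prems by (simp add: t'_def)
    have IH: "(\<integral>\<^sup>+\<sigma>. f t' (g' + m') * chain_value fs t' g' m' \<sigma> \<partial>exp_unif_seq) = f t' (g' + m') * (\<integral>\<^sup>+u'. path_value fs (t' * u') (g' + m') \<partial>unif)" for m'
      by (subst nn_integral_cmult) (simp_all add: Cons.IH[OF fs t'])
    have "(\<integral>\<^sup>+\<sigma>. chain_value (f # fs) t g m (case_nat z \<sigma>) \<partial>exp_unif_seq) =
      (\<integral>\<^sup>+\<sigma>. (ennreal (snd z) * (f t' (g' + m) * chain_value fs t' g' m \<sigma>) +
        ennreal (1 - snd z) * (\<integral>\<^sup>+w. f t' (g' + (m + w / t')) * chain_value fs t' g' (m + w / t') \<sigma> \<partial>std_exp)) \<partial>exp_unif_seq)"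
      by (simp add: t'_def g'_def)
    also have "\<dots> = ennreal (snd z) * (\<integral>\<^sup>+\<sigma>. f t' (g' + m) * chain_value fs t' g' m \<sigma> \<partial>exp_unif_seq) +
      ennreal (1 - snd z) * (\<integral>\<^sup>+\<sigma>. \<integral>\<^sup>+w. f t' (g' + (m + w / t')) * chain_value fs t' g' (m + w / t') \<sigma> \<partial>std_exp \<partial>exp_unif_seq)"
      by (subst nn_integral_add, simp, simp) (subst nn_integral_cmult, simp, subst nn_integral_cmult, simp_all)
    also have "(\<integral>\<^sup>+\<sigma>. \<integral>\<^sup>+w. f t' (g' + (m + w / t')) * chain_value fs t' g' (m + w / t') \<sigma> \<partial>std_exp \<partial>exp_unif_seq) =
       (\<integral>\<^sup>+w. \<integral>\<^sup>+\<sigma>. f t' (g' + (m + w / t')) * chain_value fs t' g' (m + w / t') \<sigma> \<partial>exp_unif_seq \<partial>std_exp)"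
    proof -
      interpret pair_sigma_finite std_exp exp_unif_seq ..
      show ?thesis by (rule Fubini') measurable
    qed
    finally show "(\<integral>\<^sup>+\<sigma>. chain_value (f # fs) t g m (case_nat z \<sigma>) \<partial>exp_unif_seq) =
       ennreal (snd z) * k (snd z) (fst z / t) +
      ennreal (1 - snd z) * (\<integral>\<^sup>+w. k (snd z) (fst z / t + w / (t * snd z)) \<partial>std_exp)"
      unfolding IH k_def by (simp add: t'_def g'_def add_ac)
  qed
  also have "\<dots> = (\<integral>\<^sup>+u. \<integral>\<^sup>+e. ennreal u * k u (e / t) +
      ennreal (1 - u) * (\<integral>\<^sup>+w. k u (e / t + w / (t * u)) \<partial>std_exp) \<partial>std_exp \<partial>unif)"
    by (subst nn_integral_exp_unif(2)) simp_all
  \<comment> \<open>For fixed \<open>u\<close> the record increment of rate \<open>t\<close> and the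
    thinned gain of the chain merge into one exponential of rate \<open>t * u\<close>.\<close>
  also have "\<dots> = (\<integral>\<^sup>+u. \<integral>\<^sup>+e. k u (e / (t * u)) \<partial>std_exp \<partial>unif)"
    by (rule nn_integral_cong_AE, use AE_unif in eventually_elim)
      (auto intro!: nn_integral_exponential_thinned_sum Cons.prems)
  also have "\<dots> = (\<integral>\<^sup>+u. path_value (f # fs) (t * u) (g + m) \<partial>unif)"
    unfolding k_def path_value.simps
    by (subst nn_integral_exp_unif(1), simp, subst nn_integral_cmult[symmetric]) (simp_all add: mult.assoc)
  finally show ?case .
qed

section \<open>Probability of avoiding a staircase\<close>

text \<open>T_k, as \<open>rec_height\<close> is g_k. The sequence \<open>\<sigma>\<close> counts
  from 0: \<open>\<sigma> i\<close> is the pair (E_(i+1), U_(i+1)).\<close>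

definition rec_x :: "(nat \<Rightarrow> real \<times> real) \<Rightarrow> nat \<Rightarrow> real" where
  "rec_x \<sigma> k = (\<Prod>i<k. snd (\<sigma> i))"

definition rec_height :: "(nat \<Rightarrow> real \<times> real) \<Rightarrow> nat \<Rightarrow> real" where
  "rec_height \<sigma> k = (\<Sum>i<k. fst (\<sigma> i) / rec_x \<sigma> i)"

lemma rec_x_0 [simp]: "rec_x \<sigma> 0 = 1" and rec_height_0 [simp]: "rec_height \<sigma> 0 = 0"
  by (simp_all add: rec_x_def rec_height_def)

lemma rec_x_shift: "rec_x \<sigma> (Suc k) = snd (\<sigma> 0) * rec_x (\<lambda>n. \<sigma> (Suc n)) k"
  unfolding rec_x_def by (rule prod.lessThan_Suc_shift)

lemma rec_height_shift: "rec_height \<sigma> (Suc k) = fst (\<sigma> 0) + rec_height (\<lambda>n. \<sigma> (Suc n)) k / snd (\<sigma> 0)"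
  unfolding rec_height_def by (simp add: sum.lessThan_Suc_shift rec_x_shift sum_divide_distrib mult.commute del: sum.lessThan_Suc)

lemma borel_measurable_rec_x [measurable]: "(\<lambda>\<sigma>. rec_x \<sigma> k) \<in> borel_measurable exp_unif_seq"
  unfolding rec_x_def by measurable

lemma borel_measurable_rec_height [measurable]: "(\<lambda>\<sigma>. rec_height \<sigma> k) \<in> borel_measurable exp_unif_seq"
  unfolding rec_height_def by measurable

text \<open>A staircase is encoded by its width \<open>l y\<close> at distance \<open>y\<close> from
  the axis; a record at abscissa \<open>x\<close> lies outside it iff \<open>l y \<le> x\<close>.
  The pair \<open>t\<close>, \<open>g\<close> is the record from which the next \<open>n\<close> are
  counted.\<close>

primrec avoids :: "(real \<Rightarrow> real) \<Rightarrow> nat \<Rightarrow> real \<Rightarrow> real \<Rightarrow> (nat \<Rightarrow> real \<times> real) \<Rightarrow> bool" where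
  "avoids l 0 t g \<sigma> \<longleftrightarrow> True"
| "avoids l (Suc n) t g \<sigma> \<longleftrightarrow> l (g + fst (\<sigma> 0) / t) \<le> t * snd (\<sigma> 0) \<and>
     avoids l n (t * snd (\<sigma> 0)) (g + fst (\<sigma> 0) / t) (\<lambda>n. \<sigma> (Suc n))"

lemma avoids_iff:
  "avoids l n t g \<sigma> \<longleftrightarrow> (\<forall>k<n. l (g + rec_height \<sigma> (Suc k) / t) \<le> t * rec_x \<sigma> (Suc k))"
proof (induction n arbitrary: t g \<sigma>)
  case (Suc n)
  have "(\<forall>k<Suc n. l (g + rec_height \<sigma> (Suc k) / t) \<le> t * rec_x \<sigma> (Suc k)) \<longleftrightarrow>
     l (g + rec_height \<sigma> (Suc 0) / t) \<le> t * rec_x \<sigma> (Suc 0) \<and> (\<forall>k<n. l (g + rec_height \<sigma> (Suc (Suc k)) / t) \<le> t * rec_x \<sigma> (Suc (Suc k)))"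
    by (simp add: All_less_Suc2)
  then show ?case
    unfolding rec_height_shift[of \<sigma>] rec_x_shift[of \<sigma>]
    by (simp add: Suc.IH add_divide_distrib add_ac mult_ac)
qed simp

text \<open>\<open>B\<close> bounds the height and so makes the area finite, the gap
  \<open>\<epsilon>\<close> between 0 and the positive widths controls the error of the recursion,
  and finiteness of the set \<open>D\<close> of possible discontinuities admits the fundamental
  theorem of calculus.\<close>

locale staircase =
  fixes l :: "real \<Rightarrow> real" and B \<epsilon> :: real and D :: "real set"
  assumes antimono: "\<And>x y. x \<le> y \<Longrightarrow> l y \<le> l x"
    and nonneg: "\<And>x. 0 \<le> l x" and le_1: "\<And>x. l x \<le> 1"
    and B: "0 \<le> B" "\<And>x. B \<le> x \<Longrightarrow> l x = 0"
    and \<epsilon>: "0 < \<epsilon>" "\<And>x. l x \<noteq> 0 \<Longrightarrow> \<epsilon> \<le> l x"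
    and D: "finite D" "\<And>x. x \<notin> D \<Longrightarrow> isCont l x"
begin

lemma borel_measurable_l [measurable]: "l \<in> borel_measurable borel"
proof -
  have "(\<lambda>x. - l x) \<in> borel_measurable borel"
    by (rule borel_measurable_mono) (auto simp: mono_def antimono)
  then show ?thesis by simp
qed

lemma integrable_l: "(\<lambda>s. min t (l s)) integrable_on {a..b}"
proof -
  have "(\<lambda>s. - min t (l s)) integrable_on {a..b}"
    by (intro integrable_on_mono_on mono_onI) (use antimono in \<open>force simp: min_def\<close>)
  from integrable_neg[OF this] show ?thesis by simp
qed

text \<open>Area of the part of the staircase beyond height \<open>y\<close> and to the left of
  \<open>t\<close>, the part that the coming records still have to avoid.\<close>

definition area :: "real \<Rightarrow> real \<Rightarrow> real" where
  "area t y = integral {y..B} (\<lambda>s. min t (l s))"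

lemma area_nonneg: "0 \<le> t \<Longrightarrow> 0 \<le> area t y"
  unfolding area_def by (intro integral_nonneg integrable_l) (simp add: nonneg)

lemma area_diff:
  assumes t: "0 \<le> t" and "y0 \<le> y"
  shows "area t y = area t y0 - integral {y0..y} (\<lambda>s. min t (l s))"
proof -
  have zero: "integral {a..b} (\<lambda>s. min t (l s)) = 0" if "B \<le> a" for a b
    using that t by (subst integral_cong[where g="\<lambda>_. 0"]) (auto simp: B)
  consider "y \<le> B" | "y0 \<le> B" "B \<le> y" | "B \<le> y0" by linarith
  then show ?thesis
  proof cases
    case 1
    then show ?thesis
      using Henstock_Kurzweil_Integration.integral_combine[OF \<open>y0 \<le> y\<close> 1 integrable_l, of t] by (simp add: area_def)
  next
    case 2
    then show ?thesis
      using Henstock_Kurzweil_Integration.integral_combine[OF 2 integrable_l, of t] by (simp add: area_def zero)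
  next
    case 3
    then show ?thesis using \<open>y0 \<le> y\<close> by (simp add: area_def zero)
  qed
qed

text \<open>A record that avoids the staircase stands to the right of all that remains of it, so
  moving the right edge from \<open>t\<close> to \<open>s\<close> cuts nothing off.\<close>

lemma area_cong:
  assumes "l y \<le> s" "s \<le> t"
  shows "area s y = area t y"
  unfolding area_def
proof (rule integral_cong)
  fix x assume "x \<in> {y..B}"
  then have "l x \<le> l y" by (simp add: antimono)
  then show "min s (l x) = min t (l x)" using assms by simp
qed

lemma area_eq_0: "l y = 0 \<Longrightarrow> 0 \<le> t \<Longrightarrow> area t y = 0"
  unfolding area_def
proof (subst integral_cong[where g="\<lambda>_. 0"])
  fix x assume "l y = 0" "0 \<le> t" "x \<in> {y..B}"
  then have "l x \<le> 0" using antimono[of y x] by simp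
  then show "min t (l x) = 0" using nonneg[of x] \<open>0 \<le> t\<close> by simp
qed simp

text \<open>The next record is \<open>e / t\<close> higher, and its abscissa \<open>t U\<close>
  clears the staircase with probability \<open>1 - min t l / t\<close>. As the derivative of
  \<open>area t (g + e / t)\<close> in \<open>e\<close> is \<open>- min t l / t\<close>, the
  integrand is the derivative of \<open>- exp (- e - area t (g + e / t))\<close>.\<close>

lemma has_integral_survival:
  assumes t: "0 < t" and n: "0 \<le> n"
  shows "((\<lambda>e. (1 - min t (l (g + e / t)) / t) * exp (- e - area t (g + e / t))) has_integral
    (exp (- area t g) - exp (- n - area t (g + n / t)))) {0..n}"
proof -
  define f where "f s = min t (l s)" for s
  define I where "I e = integral {g..g + e / t} f" for e
  have area: "area t (g + e / t) = area t g - I e" if "0 \<le> e" for e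
    using area_diff[of t g "g + e / t"] that t unfolding I_def f_def by simp
  have int: "f integrable_on {g..b}" for b
    unfolding f_def by (rule integrable_l)
  have contI: "continuous_on {0..n} I"
  proof -
    have "continuous_on {g..g + n / t} (\<lambda>x. integral {g..x} f)"
      by (rule indefinite_integral_continuous_1[OF int])
    then show ?thesis
      unfolding I_def by (rule continuous_on_compose2) (use t in \<open>auto intro!: continuous_intros divide_right_mono\<close>)
  qed
  have derI: "(I has_real_derivative f (g + e / t) * (1 / t)) (at e)" if e: "0 < e" "e < n" "g + e / t \<notin> D" for e
  proof -
    have "isCont f (g + e / t)"
      unfolding f_def using D(2)[OF e(3)] by (intro continuous_intros)
    then have "((\<lambda>u. integral {g..u} f) has_vector_derivative f (g + e / t)) (at (g + e / t) within ({g..g + n / t} - {}))"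
      using e t by (intro integral_has_vector_derivative_continuous_at int)
        (auto intro!: divide_right_mono continuous_at_imp_continuous_within)
    then have "((\<lambda>u. integral {g..u} f) has_real_derivative f (g + e / t)) (at (g + e / t) within {g..g + n / t})"
      by (simp add: has_real_derivative_iff_has_vector_derivative)
    moreover have "at (g + e / t) within {g..g + n / t} = at (g + e / t)"
      using e t by (intro at_within_interior) (auto simp: divide_strict_right_mono)
    ultimately have "((\<lambda>u. integral {g..u} f) has_real_derivative f (g + e / t)) (at (g + e / t))"
      by simp
    moreover have "((\<lambda>e. g + e / t) has_real_derivative 1 / t) (at e)"
      using t by (auto intro!: derivative_eq_intros)
    ultimately show ?thesis
      unfolding I_def by (rule DERIV_chain2)
  qed
  let ?F = "\<lambda>e. - exp (- e - area t g + I e)"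
  have "((\<lambda>e. (1 - f (g + e / t) / t) * exp (- e - area t g + I e)) has_integral (?F n - ?F 0)) {0..n}"
  \<comment> \<open>The exceptional set consists of the \<open>e\<close> for which
    \<open>g + e / t\<close> lies in \<open>D\<close>, where the integrand may jump.\<close>
  proof (rule fundamental_theorem_of_calculus_interior_strong[where S="(\<lambda>y. t * (y - g)) ` D"])
    fix e assume e: "e \<in> {0<..<n} - (\<lambda>y. t * (y - g)) ` D"
    have "g + e / t \<notin> D"
    proof
      assume "g + e / t \<in> D"
      then have "t * ((g + e / t) - g) \<in> (\<lambda>y. t * (y - g)) ` D" by blast
      with e t show False by simp
    qed
    with e have [derivative_intros]: "(I has_real_derivative f (g + e / t) * (1 / t)) (at e)"
      by (intro derI) auto
    show "(?F has_vector_derivative (1 - f (g + e / t) / t) * exp (- e - area t g + I e)) (at e)"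
      unfolding has_real_derivative_iff_has_vector_derivative[symmetric]
      by (auto intro!: derivative_eq_intros simp: algebra_simps)
  next
    show "continuous_on {0..n} ?F"
      by (intro continuous_intros contI)
  qed (use n D(1) in auto)
  also have "?F n - ?F 0 = exp (- area t g) - exp (- n - area t (g + n / t))"
    using n by (simp add: area I_def)
  finally show ?thesis
    by (rule has_integral_eq[rotated]) (simp add: area f_def)
qed

lemma borel_measurable_area [measurable]: "t > 0 \<Longrightarrow> area t \<in> borel_measurable borel"
proof -
  assume t: "t > 0"
  have "(\<lambda>x. - area t x) \<in> borel_measurable borel"
  proof (rule borel_measurable_mono, rule monoI)
    fix x y :: real assume "x \<le> y"
    moreover have "0 \<le> integral {x..y} (\<lambda>s. min t (l s))"
      using t by (intro integral_nonneg integrable_l) (simp add: nonneg)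
    ultimately show "- area t x \<le> - area t y"
      using t area_diff[of t x y] by simp
  qed
  then show ?thesis by simp
qed

text \<open>The finite-range formula as the range grows: since areas are nonnegative, the boundary
  term is at most \<open>exp (- n)\<close> and vanishes.\<close>

lemma nn_integral_survival:
  assumes t: "0 < t"
  shows "(\<integral>\<^sup>+e. ennreal ((1 - min t (l (g + e / t)) / t) * exp (- area t (g + e / t))) \<partial>std_exp) = ennreal (exp (- area t g))"
proof -
  define h where "h e = (1 - min t (l (g + e / t)) / t) * exp (- e - area t (g + e / t))" for e
  have h_nonneg: "0 \<le> h e" for e
    unfolding h_def using t by (intro mult_nonneg_nonneg) auto
  have [measurable]: "h \<in> borel_measurable borel"
    unfolding h_def using t by measurable
  have 1: "(\<integral>\<^sup>+e. ennreal (h e) * indicator {0..real n} e \<partial>lborel) = ennreal (exp (- area t g) - exp (- real n - area t (g + real n / t)))" for n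
    using nn_integral_has_integral_lebesgue[OF _ has_integral_survival[OF t, of "real n" g]] h_nonneg
    by (simp add: h_def mult.commute ennreal_mult'' ennreal_indicator[symmetric] del: ennreal_indicator)
  have "(\<lambda>n. \<integral>\<^sup>+e. ennreal (h e) * indicator {0..real n} e \<partial>lborel) \<longlonglongrightarrow> (\<integral>\<^sup>+e. ennreal (h e) * indicator {0..} e \<partial>lborel)"
  proof (rule nn_integral_LIMSEQ)
    show "incseq (\<lambda>n e. ennreal (h e) * indicator {0..real n} e)"
      by (auto simp: incseq_def le_fun_def split: split_indicator)
    fix e :: real
    obtain N :: nat where N: "e \<le> real N" using real_arch_simple by blast
    have "eventually (\<lambda>n. ennreal (h e) * indicator {0..real n} e = ennreal (h e) * indicator {0..} e) sequentially"
      using eventually_ge_at_top[of N] by eventually_elim (use N in \<open>auto split: split_indicator\<close>)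
    then show "(\<lambda>n. ennreal (h e) * indicator {0..real n} e) \<longlonglongrightarrow> ennreal (h e) * indicator {0..} e"
      by (rule tendsto_eventually)
  qed simp_all
  moreover have "(\<lambda>n. ennreal (exp (- area t g) - exp (- real n - area t (g + real n / t)))) \<longlonglongrightarrow> ennreal (exp (- area t g) - 0)"
  proof (intro tendsto_ennrealI tendsto_diff tendsto_const)
    show "(\<lambda>n. exp (- real n - area t (g + real n / t))) \<longlonglongrightarrow> 0"
    proof (rule tendsto_sandwich[OF _ _ tendsto_const])
      show "(\<lambda>n. exp (- real n)) \<longlonglongrightarrow> 0"
        by (rule filterlim_compose[OF exp_at_bot]) (simp add: filterlim_uminus_at_bot filterlim_real_sequentially)
    qed (use t in \<open>auto simp: area_nonneg\<close>)
  qed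
  ultimately have "(\<integral>\<^sup>+e. ennreal (h e) * indicator {0..} e \<partial>lborel) = ennreal (exp (- area t g))"
    unfolding 1 using LIMSEQ_unique by fastforce
  moreover have "(\<integral>\<^sup>+e. ennreal ((1 - min t (l (g + e / t)) / t) * exp (- area t (g + e / t))) \<partial>std_exp) =
     (\<integral>\<^sup>+e. ennreal (h e) * indicator {0..} e \<partial>lborel)"
    unfolding std_exp_def using t
    by (subst nn_integral_density)
      (auto intro!: nn_integral_cong simp: h_def exponential_density_def ennreal_mult'[symmetric] exp_diff exp_minus field_simps split: split_indicator)
  ultimately show ?thesis by simp
qed

definition avoid_prob :: "nat \<Rightarrow> real \<Rightarrow> real \<Rightarrow> ennreal" where
  "avoid_prob n t g = (\<integral>\<^sup>+\<sigma>. of_bool (avoids l n t g \<sigma>) \<partial>exp_unif_seq)"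

lemma measurable_avoids_aux:
  "Measurable.pred (borel \<Otimes>\<^sub>M borel \<Otimes>\<^sub>M exp_unif_seq) (\<lambda>(t, g, \<sigma>). avoids l n t g \<sigma>)"
proof (induction n)
  case (Suc n)
  note [measurable] = Suc
  have comp: "Measurable.pred M (\<lambda>x. avoids l n (t x) (g x) (\<sigma> x))"
    if [measurable]: "t \<in> borel_measurable M" "g \<in> borel_measurable M" "\<sigma> \<in> M \<rightarrow>\<^sub>M exp_unif_seq" for t g \<sigma> and M :: "'z measure"
  proof -
    have "Measurable.pred M (\<lambda>x. case (t x, g x, \<sigma> x) of (t, g, \<sigma>) \<Rightarrow> avoids l n t g \<sigma>)"
      by measurable
    then show ?thesis by simp
  qed
  have [measurable]: "(\<lambda>x. snd (snd x) 0) \<in> borel \<Otimes>\<^sub>M borel \<Otimes>\<^sub>M exp_unif_seq \<rightarrow>\<^sub>M borel \<Otimes>\<^sub>M borel"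
    by (rule measurable_compose[OF measurable_compose[OF measurable_snd measurable_snd]])
      (use measurable_component_singleton[of 0 UNIV "\<lambda>_. exp_unif"] in simp)
  have [measurable]: "(\<lambda>x n. snd (snd x) (Suc n)) \<in> borel \<Otimes>\<^sub>M borel \<Otimes>\<^sub>M exp_unif_seq \<rightarrow>\<^sub>M exp_unif_seq"
    by (rule measurable_compose[OF measurable_compose[OF measurable_snd measurable_snd] measurable_seq_shift])
  show ?case
    unfolding split_beta' avoids.simps by (intro pred_intros_logic comp) measurable
qed (simp add: split_beta')

lemma measurable_avoids [measurable (raw)]:
  assumes "t \<in> borel_measurable M" "g \<in> borel_measurable M" "\<sigma> \<in> M \<rightarrow>\<^sub>M exp_unif_seq"
  shows "Measurable.pred M (\<lambda>x. avoids l n (t x) (g x) (\<sigma> x))"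
  using measurable_compose[OF measurable_Pair[OF assms(1) measurable_Pair[OF assms(2,3)]] measurable_avoids_aux[of n]]
  by simp

lemma borel_measurable_avoid_prob [measurable (raw)]:
  assumes [measurable]: "t \<in> borel_measurable M" "g \<in> borel_measurable M"
  shows "(\<lambda>x. avoid_prob n (t x) (g x)) \<in> borel_measurable M"
  unfolding avoid_prob_def by measurable

lemma avoid_prob_Suc:
  "avoid_prob (Suc n) t g = (\<integral>\<^sup>+e. \<integral>\<^sup>+u. of_bool (l (g + e / t) \<le> t * u) * avoid_prob n (t * u) (g + e / t) \<partial>unif \<partial>std_exp)"
proof -
  have "avoid_prob (Suc n) t g = (\<integral>\<^sup>+z. of_bool (l (g + fst z / t) \<le> t * snd z) * avoid_prob n (t * snd z) (g + fst z / t) \<partial>exp_unif)"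
    unfolding avoid_prob_def
    by (subst nn_integral_exp_unif_seq, simp)
      (subst nn_integral_cmult[symmetric], auto simp: of_bool_conj)
  also have "\<dots> = (\<integral>\<^sup>+e. \<integral>\<^sup>+u. of_bool (l (g + e / t) \<le> t * u) * avoid_prob n (t * u) (g + e / t) \<partial>unif \<partial>std_exp)"
    by (subst nn_integral_exp_unif(1)) simp_all
  finally show ?thesis .
qed

lemma emeasure_unif_atLeast:
  assumes "0 \<le> c"
  shows "emeasure unif {c..} = ennreal (1 - min 1 c)"
proof -
  have "emeasure unif {c..} = emeasure lborel ({0..1} \<inter> {c..})"
    unfolding unif_def by (subst emeasure_density) (auto simp: indicator_inter_arith[symmetric])
  also have "{0..1} \<inter> {c..} = {c..1}" using assms by auto
  finally show ?thesis by (cases "c \<le> 1") auto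
qed

text \<open>With the bounds below, this fixed point of the recursion \<open>avoid_prob_Suc\<close> is the limit of
  \<open>avoid_prob\<close>: a surviving discrepancy needs \<open>t U\<^sub>1 \<dots> U\<^sub>n \<ge> \<epsilon>\<close>.\<close>

lemma survival_fixed_point:
  assumes t: "0 < t"
  shows "(\<integral>\<^sup>+e. \<integral>\<^sup>+u. of_bool (l (g + e / t) \<le> t * u) * ennreal (exp (- area t (g + e / t))) \<partial>unif \<partial>std_exp) = ennreal (exp (- area t g))"
proof -
  have "(\<integral>\<^sup>+u. of_bool (l y \<le> t * u) * ennreal (exp (- area t y)) \<partial>unif) =
      ennreal ((1 - min t (l y) / t) * exp (- area t y))" for y
  proof -
    have "(\<integral>\<^sup>+u. of_bool (l y \<le> t * u) * ennreal (exp (- area t y)) \<partial>unif) =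
      (\<integral>\<^sup>+u. ennreal (exp (- area t y)) * indicator {l y / t..} u \<partial>unif)"
    proof (rule nn_integral_cong_AE, use AE_unif in eventually_elim)
      fix u :: real assume u: "0 < u \<and> u < 1"
      have "l y \<le> t * u \<longleftrightarrow> l y / t \<le> u" using t by (simp add: field_simps)
      then show "of_bool (l y \<le> t * u) * ennreal (exp (- area t y)) = ennreal (exp (- area t y)) * indicator {l y / t..} u"
        by (auto split: split_indicator)
    qed
    also have "\<dots> = ennreal (exp (- area t y)) * ennreal (1 - min 1 (l y / t))"
      using t nonneg by (subst nn_integral_cmult_indicator) (auto simp: emeasure_unif_atLeast)
    also have "\<dots> = ennreal ((1 - min t (l y) / t) * exp (- area t y))"
      using t by (subst ennreal_mult'[symmetric]) (auto simp: min_def field_simps)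
    finally show ?thesis .
  qed
  then show ?thesis
    using nn_integral_survival[OF t, of g] by simp
qed

text \<open>The error at stage 0 is covered by \<open>t / \<epsilon>\<close>: if
  \<open>l g = 0\<close> no area is left and there is no error, and otherwise
  \<open>\<epsilon> \<le> l g \<le> t\<close>, so that the bound is at least 1. Each step multiplies
  \<open>t\<close> by a uniform variable, whose mean 1/2 halves the error.\<close>

lemma avoid_prob_bounds:
  assumes "0 < t" "t \<le> 1" "l g \<le> t"
  shows "ennreal (exp (- area t g)) \<le> avoid_prob n t g \<and> avoid_prob n t g \<le> ennreal (exp (- area t g)) + ennreal (t / \<epsilon> / 2 ^ n)"
  using assms
proof (induction n arbitrary: t g)
  case 0
  have avoid_prob: "avoid_prob 0 t g = 1"
    by (simp add: avoid_prob_def exp_unif_seq.emeasure_space_1[simplified])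
  have "1 \<le> ennreal (exp (- area t g)) + ennreal (t / \<epsilon>)"
  proof (cases "l g = 0")
    case True
    then show ?thesis using 0 by (simp add: area_eq_0)
  next
    case False
    then have "1 \<le> t / \<epsilon>" using \<epsilon> 0 by (fastforce simp: field_simps)
    then have "1 \<le> ennreal (t / \<epsilon>)" by simp
    then show ?thesis by (rule order_trans) simp
  qed
  with avoid_prob show ?case using 0 by (simp add: area_nonneg)
next
  case (Suc n)
  let ?p = "\<lambda>t g. ennreal (exp (- area t g))"
  have IH: "AE u in unif. of_bool (l y \<le> t * u) * ?p t y \<le> of_bool (l y \<le> t * u) * avoid_prob n (t * u) y \<and>
    of_bool (l y \<le> t * u) * avoid_prob n (t * u) y \<le> of_bool (l y \<le> t * u) * ?p t y + ennreal (t / \<epsilon> / 2 ^ n * u)" for y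
    using AE_unif
  proof eventually_elim
    case (elim u)
    have "t * u \<le> 1" using Suc.prems elim by (simp add: mult_le_one)
    moreover have "area (t * u) y = area t y" if "l y \<le> t * u"
      using that Suc.prems elim by (intro area_cong) auto
    ultimately show ?case
      using Suc.IH[of "t * u" y] Suc.prems elim by (cases "l y \<le> t * u") (simp_all add: mult_ac)
  qed
  note [measurable] = borel_measurable_area[OF Suc.prems(1)]
  have "?p t g \<le> avoid_prob (Suc n) t g"
    unfolding avoid_prob_Suc by (subst survival_fixed_point[OF Suc.prems(1), symmetric], intro nn_integral_mono nn_integral_mono_AE) (use IH in auto)
  moreover have "avoid_prob (Suc n) t g \<le> ?p t g + ennreal (t / \<epsilon> / 2 ^ Suc n)"
  proof -
    have "avoid_prob (Suc n) t g \<le> (\<integral>\<^sup>+e. \<integral>\<^sup>+u. of_bool (l (g + e / t) \<le> t * u) * ?p t (g + e / t) + ennreal (t / \<epsilon> / 2 ^ n * u) \<partial>unif \<partial>std_exp)"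
      unfolding avoid_prob_Suc by (intro nn_integral_mono nn_integral_mono_AE) (use IH in auto)
    also have "\<dots> = ?p t g + (\<integral>\<^sup>+e. \<integral>\<^sup>+u. ennreal (t / \<epsilon> / 2 ^ n * u) \<partial>unif \<partial>std_exp)"
    proof -
      have "(\<integral>\<^sup>+e. \<integral>\<^sup>+u. of_bool (l (g + e / t) \<le> t * u) * ?p t (g + e / t) + ennreal (t / \<epsilon> / 2 ^ n * u) \<partial>unif \<partial>std_exp)
        = (\<integral>\<^sup>+e. (\<integral>\<^sup>+u. of_bool (l (g + e / t) \<le> t * u) * ?p t (g + e / t) \<partial>unif) + (\<integral>\<^sup>+u. ennreal (t / \<epsilon> / 2 ^ n * u) \<partial>unif) \<partial>std_exp)"
        by (intro nn_integral_cong nn_integral_add) measurable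
      also have "\<dots> = ?p t g + (\<integral>\<^sup>+e. \<integral>\<^sup>+u. ennreal (t / \<epsilon> / 2 ^ n * u) \<partial>unif \<partial>std_exp)"
        by (subst nn_integral_add) (simp_all add: survival_fixed_point[OF Suc.prems(1)])
      finally show ?thesis .
    qed
    also have "(\<integral>\<^sup>+u. ennreal (t / \<epsilon> / 2 ^ n * u) \<partial>unif) = ennreal (t / \<epsilon> / 2 ^ Suc n)"
    proof -
      have "(\<integral>\<^sup>+u. ennreal (t / \<epsilon> / 2 ^ n * u) \<partial>unif) = (\<integral>\<^sup>+u. ennreal (t / \<epsilon> / 2 ^ n * u) * indicator {0..1} u \<partial>lborel)"
        unfolding unif_def by (subst nn_integral_density) (auto simp: mult.commute)
      also have "\<dots> = ennreal (t / \<epsilon> / 2 ^ n * (1\<^sup>2 / 2) - t / \<epsilon> / 2 ^ n * (0\<^sup>2 / 2))"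
        using Suc.prems \<epsilon> by (intro nn_integral_FTC_Icc) (auto intro!: derivative_eq_intros)
      finally show ?thesis by (simp add: mult_ac)
    qed
    finally show ?thesis by (simp add: std_exp.emeasure_space_1[simplified] mult_ac)
  qed
  ultimately show ?case ..
qed

text \<open>Avoidance by all records is the decreasing limit of avoidance by the first
  \<open>n\<close>. The start \<open>t = 1\<close>, \<open>g = 0\<close> is the right end of the
  axis, before any record.\<close>

lemma emeasure_avoids:
  "emeasure exp_unif_seq {\<sigma>. \<forall>k. l (rec_height \<sigma> (Suc k)) \<le> rec_x \<sigma> (Suc k)} = ennreal (exp (- area 1 0))"
proof -
  have sets: "{\<sigma>. avoids l n 1 0 \<sigma>} \<in> sets exp_unif_seq" for n
  proof -
    have "{\<sigma> \<in> space exp_unif_seq. avoids l n 1 0 \<sigma>} \<in> sets exp_unif_seq" by measurable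
    then show ?thesis by simp
  qed
  have avoid_prob: "avoid_prob n 1 0 = emeasure exp_unif_seq {\<sigma>. avoids l n 1 0 \<sigma>}" for n
  proof -
    have "avoid_prob n 1 0 = (\<integral>\<^sup>+\<sigma>. indicator {\<sigma>. avoids l n 1 0 \<sigma>} \<sigma> \<partial>exp_unif_seq)"
      unfolding avoid_prob_def by (intro nn_integral_cong) (auto split: split_indicator)
    also have "\<dots> = emeasure exp_unif_seq {\<sigma>. avoids l n 1 0 \<sigma>}"
      by (rule nn_integral_indicator[OF sets])
    finally show ?thesis .
  qed
  have "(\<lambda>n. avoid_prob n 1 0) \<longlonglongrightarrow> emeasure exp_unif_seq (\<Inter>n. {\<sigma>. avoids l n 1 0 \<sigma>})"
    unfolding avoid_prob
  proof (rule Lim_emeasure_decseq)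
    show "range (\<lambda>n. {\<sigma>. avoids l n 1 0 \<sigma>}) \<subseteq> sets exp_unif_seq"
      using sets by blast
  qed (auto simp: decseq_def avoids_iff)
  moreover have "(\<lambda>n. avoid_prob n 1 0) \<longlonglongrightarrow> ennreal (exp (- area 1 0))"
  proof (rule tendsto_sandwich[where f="\<lambda>_. ennreal (exp (- area 1 0))"
      and h="\<lambda>n. ennreal (exp (- area 1 0)) + ennreal (1 / \<epsilon> / 2 ^ n)"])
    have "(\<lambda>n. ennreal (exp (- area 1 0)) + ennreal (1 / \<epsilon> / 2 ^ n)) \<longlonglongrightarrow> ennreal (exp (- area 1 0)) + ennreal 0"
    proof (intro tendsto_add tendsto_const tendsto_ennrealI)
      have "(\<lambda>n. 1 / \<epsilon> * (1 / 2) ^ n) \<longlonglongrightarrow> 1 / \<epsilon> * 0"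
        by (intro tendsto_mult tendsto_const LIMSEQ_power_zero) simp
      then show "(\<lambda>n. 1 / \<epsilon> / 2 ^ n) \<longlonglongrightarrow> 0"
        by (simp add: power_divide)
    qed
    then show "(\<lambda>n. ennreal (exp (- area 1 0)) + ennreal (1 / \<epsilon> / 2 ^ n)) \<longlonglongrightarrow> ennreal (exp (- area 1 0))"
      by simp
  qed (use avoid_prob_bounds[of 1 0] le_1 in auto)
  moreover have "(\<Inter>n. {\<sigma>. avoids l n 1 0 \<sigma>}) = {\<sigma>. \<forall>k. l (rec_height \<sigma> (Suc k)) \<le> rec_x \<sigma> (Suc k)}"
    by (auto simp: avoids_iff)
  ultimately show ?thesis
    using LIMSEQ_unique by fastforce
qed

end

section \<open>Measures determined by upper tails\<close>

text \<open>Heights live in \<open>ennreal\<close> because a region without atoms has height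
  \<open>\<top>\<close>. Finite thresholds suffice, as \<open>{\<top>}\<close> is a countable
  intersection of their tails; these are the tails that correspond to void events of bounded
  regions.\<close>

lemma borel_ennreal_eq_tails: "sets (borel :: ennreal measure) = sigma_sets UNIV {{ennreal r..} | r. 0 \<le> r}"
proof -
  let ?E = "{{ennreal r..} | r. 0 \<le> r}"
  have tails: "{y..} \<in> sigma_sets UNIV ?E" for y :: ennreal
  proof (cases y)
    case (real r)
    then show ?thesis by (auto intro: sigma_sets.Basic)
  next
    case top
    have "{\<top>..} = (\<Inter>n. {ennreal (real n)..})"
    proof (intro equalityI subsetI)
      fix x assume "x \<in> (\<Inter>n. {ennreal (real n)..})"
      then have "of_nat n \<le> x" for n by (simp add: ennreal_of_nat_eq_real_of_nat)
      then have "\<not> x < \<top>" using ennreal_Ex_less_of_nat[of x] by (auto simp: not_less[symmetric])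
      then have "x = \<top>" using top.not_eq_extremum[of x] by blast
      then show "x \<in> {\<top>..}" by simp
    qed (auto intro: order_trans[OF top_greatest])
    moreover have "(\<Inter>n. {ennreal (real n)..}) \<in> sigma_sets UNIV ?E"
    proof (rule sigma_sets_Inter)
      show "{ennreal (real n)..} \<in> sigma_sets UNIV ?E" for n
        by (intro sigma_sets.Basic CollectI exI[of _ "real n"]) simp
    qed simp
    ultimately show ?thesis using top by simp
  qed
  have "(\<lambda>x. x) \<in> borel_measurable (sigma UNIV ?E :: ennreal measure)"
  proof (rule borel_measurableI_ge)
    fix y :: ennreal
    show "{x \<in> space (sigma UNIV ?E). y \<le> x} \<in> sets (sigma UNIV ?E)"
      using tails[of y] by (simp add: atLeast_def)
  qed
  then have "sets borel \<subseteq> sets (sigma UNIV ?E :: ennreal measure)"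
    by (auto simp: measurable_def)
  moreover have "sigma_sets UNIV ?E \<subseteq> sets (borel :: ennreal measure)"
    by (intro sets.sigma_sets_subset[of _ borel, simplified]) auto
  ultimately show ?thesis by auto
qed

lemma borel_measurable_ennreal_tails:
  fixes f :: "'a \<Rightarrow> ennreal"
  assumes "\<And>r. 0 \<le> r \<Longrightarrow> {x \<in> space M. ennreal r \<le> f x} \<in> sets M"
  shows "f \<in> borel_measurable M"
proof -
  have "f \<in> measurable M (sigma UNIV {{ennreal r..} | r. 0 \<le> r})"
  proof (rule measurable_measure_of)
    fix A :: "ennreal set" assume "A \<in> {{ennreal r..} | r. 0 \<le> r}"
    then obtain r where "0 \<le> r" "A = {ennreal r..}" by auto
    moreover have "f -` {ennreal r..} \<inter> space M = {x \<in> space M. ennreal r \<le> f x}" by auto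
    ultimately show "f -` A \<inter> space M \<in> sets M" using assms by simp
  qed auto
  then show ?thesis
    by (subst measurable_cong_sets[OF refl, of _ "sigma UNIV {{ennreal r..} | r. 0 \<le> r}"])
      (simp_all add: borel_ennreal_eq_tails)
qed

lemma ennreal_max_le_iff: "ennreal (max a b) \<le> x \<longleftrightarrow> ennreal a \<le> x \<and> ennreal b \<le> x"
proof (cases "a \<le> b")
  case True
  then show ?thesis using order_trans[OF ennreal_leI[OF True], of x] by (auto simp: max_absorb2)
next
  case False
  then have "b \<le> a" by simp
  then show ?thesis using order_trans[OF ennreal_leI[OF \<open>b \<le> a\<close>], of x] by (auto simp: max_absorb1)
qed

lemma measure_eqI_ennreal_tails:
  fixes P Q :: "ennreal measure"
  assumes "sets P = sets borel" "sets Q = sets borel" "finite_measure P"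
    and eq: "\<And>r. 0 \<le> r \<Longrightarrow> emeasure P {ennreal r..} = emeasure Q {ennreal r..}"
  shows "P = Q"
proof (rule measure_eqI_generator_eq[where \<Omega>=UNIV and E="{{ennreal r..} | r. 0 \<le> r}" and A="\<lambda>_. UNIV"])
  show "Int_stable {{ennreal r..} | r. 0 \<le> r}"
  proof (rule Int_stableI)
    fix a b assume "a \<in> {{ennreal r..} | r. 0 \<le> r}" "b \<in> {{ennreal r..} | r. 0 \<le> r}"
    then obtain r s where rs: "a = {ennreal r..}" "b = {ennreal s..}" "0 \<le> r" "0 \<le> s" by auto
    then have "a \<inter> b = {ennreal (max r s)..}" by (auto simp: ennreal_max_le_iff)
    then show "a \<inter> b \<in> {{ennreal r..} | r. 0 \<le> r}" using rs by auto
  qed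
  have "UNIV = {ennreal 0..}" by auto
  then show "range (\<lambda>_. UNIV) \<subseteq> {{ennreal r..} | r. 0 \<le> r}" by blast
qed (use assms in \<open>auto simp: borel_ennreal_eq_tails finite_measure.emeasure_finite\<close>)

text \<open>Upper tails in finitely many coordinates form a pi-system: an intersection merges the
  index sets and keeps the larger threshold. For a path of nearest heights such a tail says that a
  staircase is empty, so void probabilities determine its law.\<close>

lemma measure_eqI_PiM_ennreal_tails:
  fixes P Q :: "('i \<Rightarrow> ennreal) measure" and I :: "'i set"
  defines "\<Omega> \<equiv> space (PiM I (\<lambda>_. borel :: ennreal measure))"
  assumes P: "sets P = sets (PiM I (\<lambda>_. borel))" and Q: "sets Q = sets (PiM I (\<lambda>_. borel))" and "finite_measure P"
    and eq: "\<And>J h. finite J \<Longrightarrow> J \<subseteq> I \<Longrightarrow> (\<And>i. 0 \<le> h i) \<Longrightarrow>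
      emeasure P {x \<in> \<Omega>. \<forall>i\<in>J. ennreal (h i) \<le> x i} = emeasure Q {x \<in> \<Omega>. \<forall>i\<in>J. ennreal (h i) \<le> x i}"
  shows "P = Q"
proof -
  define E where "E = {{x \<in> \<Omega>. \<forall>i\<in>J. ennreal (h i) \<le> x i} | J h. finite J \<and> J \<subseteq> I \<and> (\<forall>i. 0 \<le> h i)}"
  have E_sub: "E \<subseteq> Pow \<Omega>" by (auto simp: E_def)
  have gen: "sets (PiM I (\<lambda>_. borel)) = sigma_sets \<Omega> E"
  proof (intro equalityI)
    have "(\<lambda>x. x) \<in> sigma \<Omega> E \<rightarrow>\<^sub>M PiM I (\<lambda>_. borel :: ennreal measure)"
    proof (rule measurable_PiM_single')
      fix i assume i: "i \<in> I"
      show "(\<lambda>x. x i) \<in> borel_measurable (sigma \<Omega> E)"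
      proof (rule borel_measurable_ennreal_tails)
        fix r :: real assume "0 \<le> r"
        then have "{x \<in> \<Omega>. \<forall>j\<in>{i}. ennreal r \<le> x j} \<in> E"
          unfolding E_def mem_Collect_eq using i by (intro exI[of _ "{i}"] exI[of _ "\<lambda>_. r"]) simp
        then show "{x \<in> space (sigma \<Omega> E). ennreal r \<le> x i} \<in> sets (sigma \<Omega> E)"
          using E_sub by (simp add: sigma_sets.Basic)
      qed
    qed (use E_sub in \<open>simp add: \<Omega>_def space_PiM Pi_def\<close>)
    then have *: "(\<lambda>x. x) -` A \<inter> \<Omega> \<in> sigma_sets \<Omega> E" if "A \<in> sets (PiM I (\<lambda>_. borel :: ennreal measure))" for A
      using measurable_sets[OF _ that, of "\<lambda>x. x" "sigma \<Omega> E"] E_sub by simp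
    show "sets (PiM I (\<lambda>_. borel :: ennreal measure)) \<subseteq> sigma_sets \<Omega> E"
    proof
      fix A assume A: "A \<in> sets (PiM I (\<lambda>_. borel :: ennreal measure))"
      then have "(\<lambda>x. x) -` A \<inter> \<Omega> = A"
        using sets.sets_into_space[OF A] by (auto simp: \<Omega>_def)
      with *[OF A] show "A \<in> sigma_sets \<Omega> E" by simp
    qed
    show "sigma_sets \<Omega> E \<subseteq> sets (PiM I (\<lambda>_. borel :: ennreal measure))"
      unfolding \<Omega>_def
    proof (rule sets.sigma_sets_subset, safe)
      fix x assume "x \<in> E"
      then obtain J h where x: "x = {x \<in> space (PiM I (\<lambda>_. borel :: ennreal measure)). \<forall>i\<in>J. ennreal (h i) \<le> x i}" "finite J" "J \<subseteq> I"
        by (auto simp: E_def \<Omega>_def)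
      show "x \<in> sets (PiM I (\<lambda>_. borel :: ennreal measure))"
        unfolding x(1)
      proof (rule sets.sets_Collect_finite_All[OF _ x(2)])
        fix i assume "i \<in> J"
        then have [measurable]: "(\<lambda>x. x i) \<in> borel_measurable (PiM I (\<lambda>_. borel :: ennreal measure))"
          using x(3) by (intro measurable_component_singleton) auto
        show "{x \<in> space (PiM I (\<lambda>_. borel :: ennreal measure)). ennreal (h i) \<le> x i} \<in> sets (PiM I (\<lambda>_. borel))"
          by measurable
      qed
    qed
  qed
  show ?thesis
  proof (rule measure_eqI_generator_eq[where \<Omega>=\<Omega> and E=E and A="\<lambda>_. \<Omega>"])
    show "Int_stable E"
    proof (rule Int_stableI)
      fix a b assume "a \<in> E" and "b \<in> E"
      from \<open>a \<in> E\<close> obtain J h where 1: "a = {x \<in> \<Omega>. \<forall>i\<in>J. ennreal (h i) \<le> x i}" "finite J" "J \<subseteq> I" "\<forall>i. 0 \<le> h i"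
        by (auto simp: E_def)
      from \<open>b \<in> E\<close> obtain J' h' where 2: "b = {x \<in> \<Omega>. \<forall>i\<in>J'. ennreal (h' i) \<le> x i}" "finite J'" "J' \<subseteq> I" "\<forall>i. 0 \<le> h' i"
        by (auto simp: E_def)
      note * = 1 2
      \<comment> \<open>The default threshold 0 imposes no condition on an \<open>ennreal\<close>,
        so a coordinate in only one index set keeps its own threshold.\<close>
      define k where "k i = max (if i \<in> J then h i else 0) (if i \<in> J' then h' i else 0)" for i
      have "a \<inter> b = {x \<in> \<Omega>. \<forall>i\<in>J \<union> J'. ennreal (k i) \<le> x i}"
      proof -
        have "ennreal (k i) \<le> y \<longleftrightarrow> (i \<in> J \<longrightarrow> ennreal (h i) \<le> y) \<and> (i \<in> J' \<longrightarrow> ennreal (h' i) \<le> y)" for i y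
          by (simp add: k_def ennreal_max_le_iff)
        then show ?thesis unfolding *(1,5) by blast
      qed
      moreover have "\<forall>i. 0 \<le> k i" using * by (auto simp: k_def max_def)
      ultimately show "a \<inter> b \<in> E"
        unfolding E_def mem_Collect_eq using *(2,3,6,7)
        by (intro exI[of _ "J \<union> J'"] exI[of _ k]) simp
    qed
    have "\<Omega> = {x \<in> \<Omega>. \<forall>i\<in>{}. ennreal 0 \<le> x i}" by simp
    then show "range (\<lambda>_. \<Omega>) \<subseteq> E" unfolding E_def by blast
  next
    fix X assume "X \<in> E"
    then obtain J h where X: "X = {x \<in> \<Omega>. \<forall>i\<in>J. ennreal (h i) \<le> x i}" and "finite J" "J \<subseteq> I" "\<forall>i. 0 \<le> h i"
      unfolding E_def by auto
    then show "emeasure P X = emeasure Q X" unfolding X by (intro eq) auto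
  next
    show "sets P = sigma_sets \<Omega> E" "sets Q = sigma_sets \<Omega> E"
      using P Q gen by simp_all
    show "emeasure P \<Omega> \<noteq> \<infinity>"
      using finite_measure.emeasure_finite[OF \<open>finite_measure P\<close>] by (simp add: top.not_eq_extremum)
  qed (use E_sub in auto)
qed

section \<open>Recovering the records from the path\<close>

definition unit_rats :: "real set" where
  "unit_rats = \<rat> \<inter> {0<..<1}"

lemma countable_unit_rats [simp]: "countable unit_rats"
  unfolding unit_rats_def by (intro countable_Int1 countable_rat)

text \<open>Paths are sampled at rational times only, so that their law lives on a countable product; the value
  of a decreasing left-continuous path at a real time is its infimum over earlier rational times.\<close>

definition value_left_of :: "(real \<Rightarrow> ennreal) \<Rightarrow> real \<Rightarrow> ennreal" where
  "value_left_of y t = (INF s\<in>unit_rats. if s < t then y s else \<top>)"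

text \<open>Jumps of a decreasing path read from right to left, starting at the right edge 1: the
  next jump is the supremum of the times at which the path lies above its current level. The
  supremum is taken in \<open>ennreal\<close>, where it always exists, and the times that do not
  qualify contribute 0.\<close>

primrec jump_time :: "(real \<Rightarrow> ennreal) \<Rightarrow> nat \<Rightarrow> real" where
  "jump_time y 0 = 1"
| "jump_time y (Suc k) = enn2real (SUP s\<in>unit_rats. if value_left_of y (jump_time y k) < y s then ennreal s else 0)"

lemma value_left_of_cong: "(\<And>s. s \<in> unit_rats \<Longrightarrow> y s = y' s) \<Longrightarrow> value_left_of y t = value_left_of y' t"
  unfolding value_left_of_def by (intro INF_cong) auto

lemma jump_time_cong: "(\<And>s. s \<in> unit_rats \<Longrightarrow> y s = y' s) \<Longrightarrow> jump_time y k = jump_time y' k"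
proof (induction k)
  case (Suc k)
  have "value_left_of y (jump_time y k) = value_left_of y' (jump_time y' k)"
    using value_left_of_cong[of y y'] Suc by simp
  then show ?case
    using Suc.prems by (auto intro!: arg_cong[where f=enn2real] SUP_cong)
qed simp

lemma borel_measurable_value_left_of [measurable (raw)]:
  assumes [measurable]: "y \<in> M \<rightarrow>\<^sub>M PiM unit_rats (\<lambda>_. borel)" "t \<in> borel_measurable M"
  shows "(\<lambda>x. value_left_of (y x) (t x)) \<in> borel_measurable M"
  unfolding value_left_of_def
proof (rule borel_measurable_INF)
  fix s assume "s \<in> unit_rats"
  then have [measurable]: "(\<lambda>x. y x s) \<in> borel_measurable M"
    using measurable_compose[OF assms(1) measurable_component_singleton] by simp
  show "(\<lambda>x. if s < t x then y x s else \<top>) \<in> borel_measurable M"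
    by measurable
qed simp

lemma borel_measurable_jump_time [measurable (raw)]:
  assumes [measurable]: "y \<in> M \<rightarrow>\<^sub>M PiM unit_rats (\<lambda>_. borel)"
  shows "(\<lambda>x. jump_time (y x) k) \<in> borel_measurable M"
proof (induction k)
  case (Suc k)
  note [measurable] = Suc
  have "(\<lambda>x. SUP s\<in>unit_rats. if value_left_of (y x) (jump_time (y x) k) < y x s then ennreal s else 0) \<in> borel_measurable M"
  proof (rule borel_measurable_SUP)
    fix s assume "s \<in> unit_rats"
    then have [measurable]: "(\<lambda>x. y x s) \<in> borel_measurable M"
      using measurable_compose[OF assms(1) measurable_component_singleton] by simp
    show "(\<lambda>x. if value_left_of (y x) (jump_time (y x) k) < y x s then ennreal s else 0) \<in> borel_measurable M"
      by measurable
  qed simp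
  then show ?case by simp
qed simp

text \<open>The hypotheses put the path at level \<open>\<gamma> k\<close> on the rational times in
  \<open>(T (Suc k), T k]\<close>, with a strict rise at each \<open>T (Suc k)\<close>. Both the
  model path and the path of a good configuration qualify, so the same functionals recover the
  records from either.\<close>

lemma step_path_reconstruction:
  fixes T :: "nat \<Rightarrow> real" and y \<gamma> :: "_ \<Rightarrow> ennreal"
  assumes T0: "T 0 = 1" and T: "\<And>k. 0 < T (Suc k) \<and> T (Suc k) < T k"
    and right: "\<And>k s. s \<in> unit_rats \<Longrightarrow> T (Suc k) < s \<Longrightarrow> y s \<le> \<gamma> k"
    and left: "\<And>k s. s \<in> unit_rats \<Longrightarrow> s \<le> T (Suc k) \<Longrightarrow> \<gamma> k < y s"
    and below: "\<And>k s. s \<in> unit_rats \<Longrightarrow> s \<le> T k \<Longrightarrow> \<gamma> k \<le> y s"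
  shows "jump_time y k = T k" "value_left_of y (T k) = \<gamma> k"
proof -
  have T_le: "T k \<le> 1" for k
    by (induction k) (use T0 T less_imp_le in \<open>auto intro: order_trans\<close>)
  have value_left_of: "value_left_of y (T k) = \<gamma> k" for k
  proof (rule antisym)
    obtain q where "q \<in> \<rat>" and q: "T (Suc k) < q" "q < T k"
      using Rats_dense_in_real T by blast
    then have q': "q \<in> unit_rats"
      using T[of k] T_le[of k] by (auto simp: unit_rats_def)
    have "value_left_of y (T k) \<le> (if q < T k then y (q) else \<top>)"
      unfolding value_left_of_def using q' by (rule INF_lower)
    also have "\<dots> \<le> \<gamma> k" using q q' right by simp
    finally show "value_left_of y (T k) \<le> \<gamma> k" .
    show "\<gamma> k \<le> value_left_of y (T k)"
      unfolding value_left_of_def by (rule INF_greatest) (auto simp: below)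
  qed
  then show "value_left_of y (T k) = \<gamma> k" .
  show "jump_time y k = T k"
  proof (induction k)
    case (Suc k)
    have "(SUP s\<in>unit_rats. if \<gamma> k < y s then ennreal s else 0) = ennreal (T (Suc k))"
    proof (rule antisym)
      show "(SUP s\<in>unit_rats. if \<gamma> k < y s then ennreal s else 0) \<le> ennreal (T (Suc k))"
      proof (rule SUP_least)
        fix s assume s: "s \<in> unit_rats"
        show "(if \<gamma> k < y s then ennreal s else 0) \<le> ennreal (T (Suc k))"
        proof (cases "\<gamma> k < y s")
          case True
          then have "\<not> T (Suc k) < s" using right[OF s, of k] by auto
          then show ?thesis by (auto intro!: ennreal_leI)
        qed simp
      qed
      show "ennreal (T (Suc k)) \<le> (SUP s\<in>unit_rats. if \<gamma> k < y s then ennreal s else 0)"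
      proof (rule dense_le)
        fix z assume z: "z < ennreal (T (Suc k))"
        then obtain r where r: "z = ennreal r" "0 \<le> r" by (cases z) auto
        with z T[of k] have "r < T (Suc k)" by (simp add: ennreal_less_iff)
        then obtain q where "q \<in> \<rat>" and q: "r < q" "q < T (Suc k)"
          using Rats_dense_in_real by blast
        then have q': "q \<in> unit_rats"
          using r T_le[of "Suc k"] by (auto simp: unit_rats_def)
        have "z \<le> (if \<gamma> k < y (q) then ennreal (q) else 0)"
          using left[OF q', of k] q r by (auto intro!: ennreal_leI)
        also have "\<dots> \<le> (SUP s\<in>unit_rats. if \<gamma> k < y s then ennreal s else 0)"
          using q' by (rule SUP_upper)
        finally show "z \<le> (SUP s\<in>unit_rats. if \<gamma> k < y s then ennreal s else 0)" .
      qed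
    qed
    then show ?case using T[of k] Suc by (simp add: value_left_of)
  qed (simp add: T0)
qed

text \<open>As a countable infimum the path is defined and measurable for every
  \<open>\<sigma>\<close>, monotone or not. The strict comparison matches the half-open columns used
  for configurations.\<close>

definition record_path :: "(nat \<Rightarrow> real \<times> real) \<Rightarrow> real \<Rightarrow> ennreal" where
  "record_path \<sigma> s = (INF k. if rec_x \<sigma> (Suc k) < s then ennreal (rec_height \<sigma> (Suc k)) else \<top>)"

lemma borel_measurable_record_path [measurable]: "(\<lambda>\<sigma>. record_path \<sigma> s) \<in> borel_measurable exp_unif_seq"
  unfolding record_path_def by measurable

lemma rec_x_Suc: "rec_x \<sigma> (Suc k) = rec_x \<sigma> k * snd (\<sigma> k)"
  by (simp add: rec_x_def)

lemma rec_height_Suc: "rec_height \<sigma> (Suc k) = rec_height \<sigma> k + fst (\<sigma> k) / rec_x \<sigma> k"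
  by (simp add: rec_height_def)

text \<open>Among the records left of T_k the one nearest to the axis is the next, of height
  g_(k+1); hence the shift between abscissa and height.\<close>

lemma record_path_reconstruction:
  assumes \<sigma>: "\<forall>i. 0 < fst (\<sigma> i) \<and> 0 < snd (\<sigma> i) \<and> snd (\<sigma> i) < 1"
  shows "jump_time (record_path \<sigma>) k = rec_x \<sigma> k" "value_left_of (record_path \<sigma>) (rec_x \<sigma> k) = ennreal (rec_height \<sigma> (Suc k))"
proof -
  have T_pos: "0 < rec_x \<sigma> k" for k
    unfolding rec_x_def using \<sigma> by (intro prod_pos) auto
  have T: "rec_x \<sigma> (Suc k) < rec_x \<sigma> k" for k
    using \<sigma> T_pos[of k] by (simp add: rec_x_Suc)
  have g: "rec_height \<sigma> k < rec_height \<sigma> (Suc k)" for k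
    using \<sigma> T_pos[of k] by (simp add: rec_height_Suc)
  have T_anti: "rec_x \<sigma> j \<le> rec_x \<sigma> i" if "i \<le> j" for i j
    using that by (rule lift_Suc_antimono_le[rotated]) (use T less_imp_le in blast)
  have g_mono: "rec_height \<sigma> i \<le> rec_height \<sigma> j" if "i \<le> j" for i j
    using that by (rule lift_Suc_mono_le[rotated]) (use g less_imp_le in blast)
  have g_pos: "0 < rec_height \<sigma> (Suc k)" for k
    using g[of 0] g_mono[of 1 "Suc k"] by simp
  have below: "ennreal (rec_height \<sigma> (Suc k)) \<le> record_path \<sigma> s" if "s \<le> rec_x \<sigma> k" for k s
    unfolding record_path_def
  proof (rule INF_greatest)
    fix j
    show "ennreal (rec_height \<sigma> (Suc k)) \<le> (if rec_x \<sigma> (Suc j) < s then ennreal (rec_height \<sigma> (Suc j)) else \<top>)"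
    proof (cases "rec_x \<sigma> (Suc j) < s")
      case True
      with that have "\<not> Suc j \<le> k" using T_anti[of "Suc j" k] by auto
      then show ?thesis using True by (auto intro!: ennreal_leI g_mono)
    qed simp
  qed
  have right: "record_path \<sigma> s \<le> ennreal (rec_height \<sigma> (Suc k))" if "rec_x \<sigma> (Suc k) < s" for k s
    unfolding record_path_def using that by (intro INF_lower2[of k]) auto
  have left: "ennreal (rec_height \<sigma> (Suc k)) < record_path \<sigma> s" if "s \<le> rec_x \<sigma> (Suc k)" for k s
  proof -
    have "ennreal (rec_height \<sigma> (Suc k)) < ennreal (rec_height \<sigma> (Suc (Suc k)))"
      using g[of "Suc k"] g_pos[of k] by (simp add: ennreal_less_iff)
    also have "\<dots> \<le> record_path \<sigma> s"
      using that by (rule below)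
    finally show ?thesis .
  qed
  note rec = step_path_reconstruction[where T="rec_x \<sigma>" and y="record_path \<sigma>" and \<gamma>="\<lambda>k. ennreal (rec_height \<sigma> (Suc k))"]
  show "jump_time (record_path \<sigma>) k = rec_x \<sigma> k"
    by (rule rec) (use T T_pos right left below in auto)
  show "value_left_of (record_path \<sigma>) (rec_x \<sigma> k) = ennreal (rec_height \<sigma> (Suc k))"
    by (rule rec) (use T T_pos right left below in auto)
qed

section \<open>Staircases spanned by finitely many corners\<close>

locale corner_heights =
  fixes J :: "real set" and h :: "real \<Rightarrow> real"
  assumes finite_J: "finite J" and J_unit: "J \<subseteq> {0<..<1}" and h_nonneg: "\<And>s. 0 \<le> h s"
begin

text \<open>Width at height \<open>y\<close> of the union of the rectangles
  \<open>[0, s) \<times> [0, h s)\<close> over \<open>s \<in> J\<close>. The inserted 0 covers the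
  heights that no rectangle reaches.\<close>

definition width :: "real \<Rightarrow> real" where
  "width y = Max (insert 0 {s\<in>J. y < h s})"

lemma finite_corners [simp]: "finite {s\<in>J. y < h s}"
  using finite_J by simp

lemma width_le_iff: "width y \<le> x \<longleftrightarrow> 0 \<le> x \<and> (\<forall>s\<in>J. y < h s \<longrightarrow> s \<le> x)"
  unfolding width_def by (subst Max_le_iff) auto

lemma width_cases: "width y = 0 \<or> width y \<in> J"
  using Max_in[of "insert 0 {s\<in>J. y < h s}"] unfolding width_def by auto

text \<open>Widths are 0 or members of \<open>J\<close>, so the least member of \<open>J\<close>
  serves as the gap, and they can change only at the heights \<open>h s\<close>. The inserted 0 and
  1 are there for empty \<open>J\<close>.\<close>

sublocale staircase width "Max (insert 0 (h ` J))" "Min (insert 1 J)" "h ` J"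
proof
  show "width y \<le> width x" if "x \<le> y" for x y
    using that unfolding width_def by (intro Max_mono) auto
  show "0 \<le> width x" for x
    unfolding width_def by (intro Max_ge) auto
  show "width x \<le> 1" for x
    unfolding width_le_iff using J_unit by force
  show "0 \<le> Max (insert 0 (h ` J))"
    using finite_J by (intro Max_ge) auto
  show "width x = 0" if "Max (insert 0 (h ` J)) \<le> x" for x
  proof -
    have "{s\<in>J. x < h s} = {}"
      using that finite_J by (auto simp: not_less)
    then show ?thesis unfolding width_def by (simp only: Max_singleton)
  qed
  show "0 < Min (insert 1 J)"
    using finite_J J_unit by (subst Min_gr_iff) auto
  show "Min (insert 1 J) \<le> width x" if "width x \<noteq> 0" for x
    using width_cases[of x] that finite_J by (intro Min_le) auto
  show "finite (h ` J)" using finite_J by simp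
  show "isCont width x" if "x \<notin> h ` J" for x
  proof -
    \<comment> \<open>Away from the heights each comparison with \<open>h s\<close> is locally
      constant; finitely many of them determine the set whose maximum is the width.\<close>
    have "\<forall>s\<in>J. eventually (\<lambda>y. y < h s \<longleftrightarrow> x < h s) (nhds x)"
    proof
      fix s assume "s \<in> J"
      then have "h s \<noteq> x" using that by auto
      then consider "x < h s" | "h s < x" by linarith
      then show "eventually (\<lambda>y. y < h s \<longleftrightarrow> x < h s) (nhds x)"
      proof cases
        case 1
        then have "eventually (\<lambda>y. y < h s) (nhds x)"
          by (intro eventually_nhds_in_open[of "{..<h s}", simplified]) auto
        then show ?thesis by eventually_elim (use 1 in auto)
      next
        case 2
        then have "eventually (\<lambda>y. h s < y) (nhds x)"
          by (intro eventually_nhds_in_open[of "{h s<..}", simplified]) auto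
        then show ?thesis by eventually_elim (use 2 in auto)
      qed
    qed
    then have "eventually (\<lambda>y. \<forall>s\<in>J. y < h s \<longleftrightarrow> x < h s) (nhds x)"
      using finite_J by (simp add: eventually_ball_finite)
    then have "eventually (\<lambda>y. width y = width x) (nhds x)"
    proof eventually_elim
      case (elim y)
      then have "{s\<in>J. y < h s} = {s\<in>J. x < h s}" by auto
      then show ?case by (simp add: width_def)
    qed
    then show ?thesis
      by (subst isCont_cong[where g="\<lambda>_. width x"]) auto
  qed
qed

text \<open>The path is at or above the thresholds at all times of \<open>J\<close> exactly when no
  record falls into the union of the rectangles, which is the avoidance event of the
  staircase.\<close>

lemma emeasure_record_path_tails:
  "emeasure exp_unif_seq {\<sigma>. \<forall>s\<in>J. ennreal (h s) \<le> record_path \<sigma> s} = ennreal (exp (- area 1 0))"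
proof -
  have "emeasure exp_unif_seq {\<sigma>. \<forall>s\<in>J. ennreal (h s) \<le> record_path \<sigma> s} =
    emeasure exp_unif_seq {\<sigma>. \<forall>k. width (rec_height \<sigma> (Suc k)) \<le> rec_x \<sigma> (Suc k)}"
  proof (rule emeasure_eq_AE)
    show "AE \<sigma> in exp_unif_seq. \<sigma> \<in> {\<sigma>. \<forall>s\<in>J. ennreal (h s) \<le> record_path \<sigma> s} \<longleftrightarrow>
      \<sigma> \<in> {\<sigma>. \<forall>k. width (rec_height \<sigma> (Suc k)) \<le> rec_x \<sigma> (Suc k)}"
      using AE_exp_unif_seq
    proof eventually_elim
      case (elim \<sigma>)
      have T_pos: "0 < rec_x \<sigma> k" for k
        unfolding rec_x_def using elim by (intro prod_pos) auto
      have g_nonneg: "0 \<le> rec_height \<sigma> k" for k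
        unfolding rec_height_def using elim T_pos by (intro sum_nonneg divide_nonneg_nonneg less_imp_le) auto
      have "(\<forall>s\<in>J. ennreal (h s) \<le> record_path \<sigma> s) \<longleftrightarrow> (\<forall>s\<in>J. \<forall>k. rec_x \<sigma> (Suc k) < s \<longrightarrow> h s \<le> rec_height \<sigma> (Suc k))"
        unfolding record_path_def le_INF_iff using g_nonneg by (auto split: if_splits)
      also have "\<dots> \<longleftrightarrow> (\<forall>k. width (rec_height \<sigma> (Suc k)) \<le> rec_x \<sigma> (Suc k))"
        unfolding width_le_iff using less_imp_le[OF T_pos] by (meson not_less)
      finally show ?case by simp
    qed
    have "{\<sigma> \<in> space exp_unif_seq. \<forall>s\<in>J. ennreal (h s) \<le> record_path \<sigma> s} \<in> sets exp_unif_seq"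
    proof (rule sets.sets_Collect_finite_All[OF _ finite_J])
      fix s show "{\<sigma> \<in> space exp_unif_seq. ennreal (h s) \<le> record_path \<sigma> s} \<in> sets exp_unif_seq"
        by measurable
    qed
    then show "{\<sigma>. \<forall>s\<in>J. ennreal (h s) \<le> record_path \<sigma> s} \<in> sets exp_unif_seq" by simp
    have "{\<sigma> \<in> space exp_unif_seq. \<forall>k. width (rec_height \<sigma> (Suc k)) \<le> rec_x \<sigma> (Suc k)} \<in> sets exp_unif_seq"
      by (intro sets.sets_Collect_countable_All borel_measurable_le borel_measurable_rec_x
          measurable_compose[OF borel_measurable_rec_height borel_measurable_l])
    then show "{\<sigma>. \<forall>k. width (rec_height \<sigma> (Suc k)) \<le> rec_x \<sigma> (Suc k)} \<in> sets exp_unif_seq" by simp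
  qed
  also have "\<dots> = ennreal (exp (- area 1 0))"
    by (rule emeasure_avoids)
  finally show ?thesis .
qed

text \<open>Fubini along horizontal sections: at ordinate \<open>y \<le> 0\<close> the section is
  \<open>[0, width (- y))\<close>. Reflecting in the axis gives \<open>area 1 0\<close>, where the
  truncation at 1 has no effect because widths are at most 1.\<close>

lemma emeasure_lborel_corners:
  "emeasure lborel (\<Union>s\<in>J. {0..<s} \<times> {- h s<..0}) = ennreal (area 1 0)"
proof -
  let ?Z = "\<Union>s\<in>J. {0..<s} \<times> {- h s<..0}"
  have Z: "?Z \<in> sets (lborel \<Otimes>\<^sub>M lborel)"
    using finite_J by (intro sets.finite_UN) auto
  have sec: "(\<lambda>x. (x, y)) -` ?Z = (if y \<le> 0 then {0..<width (- y)} else {})" for y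
  proof -
    have "x < width (- y) \<longleftrightarrow> (\<exists>s\<in>J. - h s < y \<and> x < s)" if "0 \<le> x" for x
    proof -
      have "x < width (- y) \<longleftrightarrow> (\<exists>s\<in>J. - y < h s \<and> x < s)"
        using that width_le_iff[of "- y" x] by (meson not_less)
      then show ?thesis by (simp add: minus_less_iff)
    qed
    then have "x \<in> (\<lambda>x. (x, y)) -` ?Z \<longleftrightarrow> x \<in> (if y \<le> 0 then {0..<width (- y)} else {})" for x
      by (cases "0 \<le> x"; cases "y \<le> 0"; simp; blast)
    then show ?thesis by blast
  qed
  have "emeasure lborel ?Z = emeasure (lborel \<Otimes>\<^sub>M lborel) ?Z"
    by (simp add: lborel_prod)
  also have "\<dots> = (\<integral>\<^sup>+y. emeasure lborel ((\<lambda>x. (x, y)) -` ?Z) \<partial>lborel)"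
    using Z by (rule lborel_pair.emeasure_pair_measure_alt2)
  also have "\<dots> = (\<integral>\<^sup>+y. ennreal (width (- y)) * indicator {..0} y \<partial>lborel)"
    unfolding sec by (intro nn_integral_cong) (auto simp: nonneg)
  also have "\<dots> = ennreal \<bar>-1\<bar> * (\<integral>\<^sup>+y. ennreal (width (- (0 + (-1) * y))) * indicator {..0} (0 + (-1) * y) \<partial>lborel)"
    by (intro nn_integral_real_affine) auto
  also have "\<dots> = (\<integral>\<^sup>+y. ennreal (indicator {0..Max (insert 0 (h ` J))} y * min 1 (width y)) \<partial>lborel)"
    using B(2) le_1 by (auto intro!: nn_integral_cong split: split_indicator simp: min_absorb2)
  also have "\<dots> = ennreal (area 1 0)"
    unfolding area_def by (intro nn_integral_has_integral_lebesgue integrable_integral integrable_l) (simp add: nonneg)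
  finally show ?thesis .
qed

end

section \<open>Records of a configuration\<close>

text \<open>The absolute value lets one theory of records serve both halves, the lower one being
  read as its reflection. The value is \<open>\<top>\<close> when \<open>A\<close> contains no
  atom.\<close>

definition low :: "(real \<times> real) set \<Rightarrow> (real \<times> real) set \<Rightarrow> ennreal" where
  "low P A = (INF p\<in>P \<inter> A. ennreal \<bar>snd p\<bar>)"

text \<open>Half-open in the abscissa, as records compare with atoms strictly to the left; this also
  makes adjacent columns disjoint.\<close>

definition up_left :: "real \<Rightarrow> (real \<times> real) set" where
  "up_left t = {0..<t} \<times> {0..}"

definition down_left :: "real \<Rightarrow> (real \<times> real) set" where
  "down_left t = {0..<t} \<times> {..0}"

text \<open>The bridge between paths and the process: an upper tail of a nearest height is a void
  event of a region of bounded height.\<close>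

lemma le_low_iff: "ennreal r \<le> low P A \<longleftrightarrow> P \<inter> (A \<inter> {p. \<bar>snd p\<bar> < r}) = {}"
proof -
  have "ennreal r \<le> low P A \<longleftrightarrow> (\<forall>p\<in>P \<inter> A. r \<le> \<bar>snd p\<bar>)"
    unfolding low_def le_INF_iff by simp
  also have "\<dots> \<longleftrightarrow> P \<inter> (A \<inter> {p. \<bar>snd p\<bar> < r}) = {}"
    by (simp only: disjoint_iff Int_iff mem_Collect_eq Ball_def) (meson not_less)
  finally show ?thesis .
qed

lemma low_Un: "low P (A \<union> B) = min (low P A) (low P B)"
  unfolding low_def Int_Un_distrib by (subst INF_union) (simp add: inf_min)

text \<open>Every atom strictly left of \<open>t\<close> is strictly left of some rational
  \<open>s < t\<close>, so rational times lose nothing; \<open>t \<le> 1\<close> keeps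
  \<open>s\<close> inside the unit interval.\<close>

lemma value_left_of_low:
  assumes "t \<le> 1"
  shows "value_left_of (\<lambda>s. low P ({0..<s} \<times> R)) t = low P ({0..<t} \<times> R)"
proof (rule antisym)
  show "low P ({0..<t} \<times> R) \<le> value_left_of (\<lambda>s. low P ({0..<s} \<times> R)) t"
    unfolding value_left_of_def
  proof (rule INF_greatest)
    fix s
    show "low P ({0..<t} \<times> R) \<le> (if s < t then low P ({0..<s} \<times> R) else \<top>)"
      unfolding low_def by (auto intro!: INF_superset_mono)
  qed
  show "value_left_of (\<lambda>s. low P ({0..<s} \<times> R)) t \<le> low P ({0..<t} \<times> R)"
    unfolding low_def[of P "{0..<t} \<times> R"]
  proof (rule INF_greatest)
    fix p assume p: "p \<in> P \<inter> {0..<t} \<times> R"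
    then obtain s where s: "s \<in> \<rat>" "fst p < s" "s < t"
      using Rats_dense_in_real[of "fst p" t] by auto
    with p assms have "s \<in> unit_rats" by (auto simp: unit_rats_def)
    then have "value_left_of (\<lambda>s. low P ({0..<s} \<times> R)) t \<le> (if s < t then low P ({0..<s} \<times> R) else \<top>)"
      unfolding value_left_of_def by (rule INF_lower)
    also have "\<dots> \<le> ennreal \<bar>snd p\<bar>"
      using s p unfolding low_def by (auto intro!: INF_lower)
    finally show "value_left_of (\<lambda>s. low P ({0..<s} \<times> R)) t \<le> ennreal \<bar>snd p\<bar>" .
  qed
qed

text \<open>The deterministic properties that make the records of one half an infinite sequence:
  nearest atoms exist, abscissas are distinct, and atoms come arbitrarily close to the left edge, so
  that a further record always follows.\<close>

locale record_config =
  fixes Q :: "(real \<times> real) set"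
  assumes fin: "\<And>r. finite {p\<in>Q. \<bar>snd p\<bar> \<le> r}"
    and inj: "inj_on fst Q"
    and unit: "\<And>p. p \<in> Q \<Longrightarrow> 0 < fst p \<and> fst p < 1"
    and ex_left: "\<And>t. 0 < t \<Longrightarrow> \<exists>p\<in>Q. fst p < t"
begin

definition rec :: "real \<times> real \<Rightarrow> bool" where
  "rec a \<longleftrightarrow> a \<in> Q \<and> (\<forall>c\<in>Q. fst c < fst a \<longrightarrow> \<bar>snd a\<bar> < \<bar>snd c\<bar>)"

lemma ex_next:
  assumes "0 < t"
  shows "\<exists>a. rec a \<and> fst a < t \<and> (\<forall>c\<in>Q. fst c < t \<longrightarrow> \<bar>snd a\<bar> \<le> \<bar>snd c\<bar>)"
proof -
  obtain p where p: "p \<in> Q" "fst p < t" using ex_left[OF assms] by auto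
  define K where "K = {c\<in>Q. fst c < t \<and> \<bar>snd c\<bar> \<le> \<bar>snd p\<bar>}"
  have K: "finite K" "p \<in> K"
    using fin[of "\<bar>snd p\<bar>"] p by (auto simp: K_def elim: finite_subset[rotated])
  then obtain b where b: "b \<in> K" "\<And>c. c \<in> K \<Longrightarrow> \<bar>snd b\<bar> \<le> \<bar>snd c\<bar>"
    using arg_min_if_finite[of K "\<lambda>c. \<bar>snd c\<bar>"] by (metis empty_iff not_less)
  \<comment> \<open>Distinct atoms may have the same height; the leftmost of the lowest ones
    satisfies the strict inequality in \<open>rec\<close>.\<close>
  define K' where "K' = {c\<in>K. \<bar>snd c\<bar> = \<bar>snd b\<bar>}"
  have K': "finite K'" "b \<in> K'" using K b by (auto simp: K'_def)
  then obtain a where a: "a \<in> K'" "\<And>c. c \<in> K' \<Longrightarrow> fst a \<le> fst c"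
    using arg_min_if_finite[of K' fst] by (metis empty_iff not_less)
  have min: "\<bar>snd a\<bar> \<le> \<bar>snd c\<bar>" if "c \<in> Q" "fst c < t" for c
  proof (cases "c \<in> K")
    case True
    then show ?thesis using b a by (auto simp: K'_def)
  next
    case False
    then show ?thesis using that a by (auto simp: K_def K'_def)
  qed
  have "\<bar>snd a\<bar> < \<bar>snd c\<bar>" if c: "c \<in> Q" "fst c < fst a" for c
  proof -
    have "fst a < t" using a by (auto simp: K_def K'_def)
    then have le: "\<bar>snd a\<bar> \<le> \<bar>snd c\<bar>" using min[of c] c by auto
    have "\<bar>snd a\<bar> \<noteq> \<bar>snd c\<bar>"
    proof
      assume "\<bar>snd a\<bar> = \<bar>snd c\<bar>"
      then have "c \<in> K'" using a c \<open>fst a < t\<close> by (auto simp: K_def K'_def)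
      from a(2)[OF this] c show False by simp
    qed
    with le show ?thesis by simp
  qed
  then have "rec a" using a by (auto simp: rec_def K_def K'_def)
  moreover have "fst a < t" using a by (auto simp: K_def K'_def)
  ultimately show ?thesis using min by blast
qed

definition next_rec :: "real \<Rightarrow> real \<times> real" where
  "next_rec t = (SOME a. rec a \<and> fst a < t \<and> (\<forall>c\<in>Q. fst c < t \<longrightarrow> \<bar>snd a\<bar> \<le> \<bar>snd c\<bar>))"

lemma next_rec:
  assumes "0 < t"
  shows "rec (next_rec t)" "fst (next_rec t) < t" "\<And>c. c \<in> Q \<Longrightarrow> fst c < t \<Longrightarrow> \<bar>snd (next_rec t)\<bar> \<le> \<bar>snd c\<bar>"
  using someI_ex[OF ex_next[OF assms]] unfolding next_rec_def[symmetric] by auto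

lemma rec_le_next_rec:
  assumes "0 < t" "rec c" "fst c < t"
  shows "fst c \<le> fst (next_rec t)"
proof (rule ccontr)
  assume "\<not> fst c \<le> fst (next_rec t)"
  then have "\<bar>snd c\<bar> < \<bar>snd (next_rec t)\<bar>" using assms next_rec[of t] by (auto simp: rec_def)
  with next_rec(3)[of t c] assms show False by (auto simp: rec_def)
qed

lemma rec_eqI: "rec a \<Longrightarrow> rec b \<Longrightarrow> fst a = fst b \<Longrightarrow> a = b"
  using inj by (auto simp: rec_def inj_on_def)

lemma rec_pos: "rec a \<Longrightarrow> 0 < fst a" "rec a \<Longrightarrow> fst a < 1"
  using unit by (auto simp: rec_def)

text \<open>Records approach the axis from left to right, so the rightmost record before
  \<open>t\<close> is a nearest atom before \<open>t\<close>. This turns the adjoint lower record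
  into a value of the path.\<close>

lemma rightmost_rec_iff:
  assumes "0 < t"
  shows "rec b \<and> fst b < t \<and> (\<forall>b'. rec b' \<and> fst b' < t \<longrightarrow> fst b' \<le> fst b) \<longleftrightarrow> b = next_rec t"
  using next_rec[OF assms] rec_le_next_rec[OF assms] rec_eqI by (metis order_antisym)

primrec nth_x :: "nat \<Rightarrow> real" where
  "nth_x 0 = 1"
| "nth_x (Suc k) = fst (next_rec (nth_x k))"

lemma nth_x_pos: "0 < nth_x k"
  by (induction k) (auto intro: rec_pos next_rec)

lemma nth_x_less: "nth_x (Suc k) < nth_x k"
  using next_rec(2)[OF nth_x_pos] by simp

lemma nth_x_anti: "i < j \<Longrightarrow> nth_x j < nth_x i"
  by (rule lift_Suc_mono_less[of "\<lambda>k. - nth_x k", simplified]) (use nth_x_less in auto)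

text \<open>Counted from 0, as \<open>nth_x 0 = 1\<close> is the right edge and not a record:
  \<open>nth_rec k\<close> is the record a_(k+1), at abscissa \<open>nth_x (Suc k)\<close>.\<close>

definition nth_rec :: "nat \<Rightarrow> real \<times> real" where
  "nth_rec k = next_rec (nth_x k)"

lemma rec_nth_rec: "rec (nth_rec k)" and fst_nth_rec: "fst (nth_rec k) = nth_x (Suc k)"
  using next_rec(1)[OF nth_x_pos] by (auto simp: nth_rec_def)

lemma records_right_of: "{a. rec a \<and> nth_x (Suc k) < fst a} = nth_rec ` {..<k}"
proof (induction k)
  case 0
  show ?case using rec_le_next_rec[of 1] rec_pos(2) by (auto simp: not_less)
next
  case (Suc k)
  have "{a. rec a \<and> nth_x (Suc (Suc k)) < fst a} = {a. rec a \<and> nth_x (Suc k) < fst a} \<union> {nth_rec k}"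
  proof (intro equalityI subsetI)
    fix a assume "a \<in> {a. rec a \<and> nth_x (Suc (Suc k)) < fst a}"
    then have a: "rec a" "nth_x (Suc (Suc k)) < fst a" by auto
    have "\<not> fst a < nth_x (Suc k)"
      using rec_le_next_rec[OF nth_x_pos, of a "Suc k"] a by auto
    then consider "nth_x (Suc k) < fst a" | "fst a = fst (nth_rec k)" unfolding fst_nth_rec by linarith
    then show "a \<in> {a. rec a \<and> nth_x (Suc k) < fst a} \<union> {nth_rec k}"
      using a rec_nth_rec rec_eqI by cases auto
  next
    fix a assume "a \<in> {a. rec a \<and> nth_x (Suc k) < fst a} \<union> {nth_rec k}"
    then show "a \<in> {a. rec a \<and> nth_x (Suc (Suc k)) < fst a}"
      using nth_x_less[of "Suc k"] rec_nth_rec[of k] fst_nth_rec[of k] by auto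
  qed
  then show ?case using Suc by (auto simp: lessThan_Suc)
qed

lemma card_records_right_of: "card {a. rec a \<and> nth_x (Suc k) < fst a} = k" "finite {a. rec a \<and> nth_x (Suc k) < fst a}"
proof -
  have "inj_on nth_rec {..<k}"
  proof (rule inj_onI)
    fix i j assume "nth_rec i = nth_rec j"
    then have "nth_x (Suc i) = nth_x (Suc j)" using fst_nth_rec by metis
    then show "i = j" using nth_x_anti[of "Suc i" "Suc j"] nth_x_anti[of "Suc j" "Suc i"]
      by (cases i j rule: linorder_cases) auto
  qed
  then show "card {a. rec a \<and> nth_x (Suc k) < fst a} = k"
    unfolding records_right_of by (simp add: card_image)
  show "finite {a. rec a \<and> nth_x (Suc k) < fst a}"
    unfolding records_right_of by simp
qed

text \<open>The number of records to the right strictly decreases from left to right, so the rank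
  identifies a record; this makes the description in \<open>upper_rec\<close> definite.\<close>

lemma nth_record_iff:
  "rec a \<and> finite {a'. rec a' \<and> fst a < fst a'} \<and> card {a'. rec a' \<and> fst a < fst a'} = k \<longleftrightarrow> a = nth_rec k"
proof (intro iffI)
  assume a: "rec a \<and> finite {a'. rec a' \<and> fst a < fst a'} \<and> card {a'. rec a' \<and> fst a < fst a'} = k"
  have "fst a = fst (nth_rec k)"
  proof (cases "fst a" "fst (nth_rec k)" rule: linorder_cases)
    case less
    then have "{a'. rec a' \<and> fst (nth_rec k) < fst a'} \<subset> {a'. rec a' \<and> fst a < fst a'}"
      using rec_nth_rec[of k] by auto
    then have "card {a'. rec a' \<and> fst (nth_rec k) < fst a'} < card {a'. rec a' \<and> fst a < fst a'}"
      using a by (intro psubset_card_mono) auto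
    then show ?thesis using a card_records_right_of[of k] by (simp add: fst_nth_rec)
  next
    case greater
    then have "{a'. rec a' \<and> fst a < fst a'} \<subset> {a'. rec a' \<and> fst (nth_rec k) < fst a'}"
      using a by auto
    then have "card {a'. rec a' \<and> fst a < fst a'} < card {a'. rec a' \<and> fst (nth_rec k) < fst a'}"
      using card_records_right_of(2)[of k] by (intro psubset_card_mono) (auto simp: fst_nth_rec)
    then show ?thesis using a card_records_right_of[of k] by (simp add: fst_nth_rec)
  qed
  then show "a = nth_rec k" using a rec_nth_rec rec_eqI by blast
qed (use rec_nth_rec card_records_right_of fst_nth_rec in auto)

lemma low_eq_next_rec:
  assumes "0 < t" "Q = P \<inter> R" "A \<inter> P = {p\<in>Q. fst p < t}"
  shows "low P A = ennreal \<bar>snd (next_rec t)\<bar>"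
proof (rule antisym)
  show "low P A \<le> ennreal \<bar>snd (next_rec t)\<bar>"
    unfolding low_def using next_rec(1,2)[OF assms(1)] assms(3) by (intro INF_lower) (auto simp: rec_def)
  show "ennreal \<bar>snd (next_rec t)\<bar> \<le> low P A"
    unfolding low_def
  proof (rule INF_greatest)
    fix p assume "p \<in> P \<inter> A"
    then have "p \<in> Q" "fst p < t" using assms(3) by auto
    then show "ennreal \<bar>snd (next_rec t)\<bar> \<le> ennreal \<bar>snd p\<bar>"
      using next_rec(3)[OF assms(1)] by (intro ennreal_leI) auto
  qed
qed

lemma record_reconstruction:
  assumes y: "\<And>s. 0 < s \<Longrightarrow> y s = ennreal \<bar>snd (next_rec s)\<bar>"
  shows "jump_time y k = nth_x k" "value_left_of y (nth_x k) = ennreal \<bar>snd (nth_rec k)\<bar>"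
proof -
  have pos: "0 < s" if "s \<in> unit_rats" for s using that by (auto simp: unit_rats_def)
  have right: "y s \<le> ennreal \<bar>snd (nth_rec k)\<bar>" if "s \<in> unit_rats" "nth_x (Suc k) < s" for k s
    using next_rec(3)[OF pos[OF that(1)], of "nth_rec k"] that rec_nth_rec[of k] fst_nth_rec[of k]
    by (simp add: y pos rec_def ennreal_leI)
  have below: "ennreal \<bar>snd (nth_rec k)\<bar> \<le> y s" if "s \<in> unit_rats" "s \<le> nth_x k" for k s
    using next_rec(3)[OF nth_x_pos, of "next_rec s" k] next_rec(1,2)[OF pos[OF that(1)]] that
    by (simp add: y pos rec_def ennreal_leI nth_rec_def)
  have left: "ennreal \<bar>snd (nth_rec k)\<bar> < y s" if "s \<in> unit_rats" "s \<le> nth_x (Suc k)" for k s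
  proof -
    have "\<bar>snd (nth_rec k)\<bar> < \<bar>snd (nth_rec (Suc k))\<bar>"
      using rec_nth_rec[of k] rec_nth_rec[of "Suc k"] fst_nth_rec nth_x_less[of "Suc k"] by (auto simp: rec_def)
    then have "ennreal \<bar>snd (nth_rec k)\<bar> < ennreal \<bar>snd (nth_rec (Suc k))\<bar>"
      by (simp add: ennreal_less_iff)
    also have "\<dots> \<le> y s" using that by (rule below)
    finally show ?thesis .
  qed
  note reconstruction = step_path_reconstruction[where T=nth_x and y=y and \<gamma>="\<lambda>k. ennreal \<bar>snd (nth_rec k)\<bar>"]
  show "jump_time y k = nth_x k"
    by (rule reconstruction) (use nth_x_pos nth_x_less right left below in \<open>auto simp del: nth_x.simps(2)\<close>)
  show "value_left_of y (nth_x k) = ennreal \<bar>snd (nth_rec k)\<bar>"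
    by (rule reconstruction) (use nth_x_pos nth_x_less right left below in \<open>auto simp del: nth_x.simps(2)\<close>)
qed

end

text \<open>Here \<open>x\<close> is the path of the upper half and \<open>y\<close> that of the
  lower. The record a_k sits at the k-th jump of \<open>y\<close>, but its height is the level just
  left of the jump before, hence \<open>k - 1\<close>. Both levels are distances to the axis, so
  they add up to the corange.\<close>

definition corange_of_paths :: "(real \<Rightarrow> ennreal) \<Rightarrow> (real \<Rightarrow> ennreal) \<Rightarrow> nat \<Rightarrow> real" where
  "corange_of_paths x y k = (1 - jump_time y k) * (enn2real (value_left_of x (jump_time y k)) + enn2real (value_left_of y (jump_time y (k - 1))))"

lemma abs_snd_Rplus: "p \<in> Rplus \<Longrightarrow> \<bar>snd p\<bar> = snd p"
  and abs_snd_Rminus: "p \<in> Rminus \<Longrightarrow> \<bar>snd p\<bar> = - snd p"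
  by (auto simp: Rplus_def Rminus_def)

locale good_config =
  fixes P :: "(real \<times> real) set"
  assumes locally_finite: "\<And>K. bounded K \<Longrightarrow> finite (P \<inter> K)"
    and inj_fst: "inj_on fst P"
    and unit: "\<And>p. p \<in> P \<Longrightarrow> 0 < fst p \<and> fst p < 1"
    and ex_up: "\<And>t. 0 < t \<Longrightarrow> P \<inter> up_left t \<noteq> {}"
    and ex_down: "\<And>t. 0 < t \<Longrightarrow> P \<inter> down_left t \<noteq> {}"
begin

lemma finite_low: "finite {p\<in>P \<inter> R. \<bar>snd p\<bar> \<le> r}"
proof (rule finite_subset)
  show "{p\<in>P \<inter> R. \<bar>snd p\<bar> \<le> r} \<subseteq> P \<inter> ({0..1} \<times> {-r..r})"
    using unit by (fastforce simp: less_imp_le)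
  show "finite (P \<inter> ({0..1} \<times> {-r..r}))"
    by (intro locally_finite bounded_Times) auto
qed

sublocale up: record_config "P \<inter> Rplus"
proof
  fix t :: real assume "0 < t"
  then obtain p where "p \<in> P" "p \<in> up_left t" using ex_up by blast
  then show "\<exists>p\<in>P \<inter> Rplus. fst p < t"
    using unit[of p] by (intro bexI[of _ p]) (auto simp: up_left_def Rplus_def)
qed (use finite_low inj_fst unit in \<open>auto intro: inj_on_subset\<close>)

sublocale down: record_config "P \<inter> Rminus"
proof
  fix t :: real assume "0 < t"
  then obtain p where "p \<in> P" "p \<in> down_left t" using ex_down by blast
  then show "\<exists>p\<in>P \<inter> Rminus. fst p < t"
    using unit[of p] by (intro bexI[of _ p]) (auto simp: down_left_def Rminus_def)
qed (use finite_low inj_fst unit in \<open>auto intro: inj_on_subset\<close>)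

lemma lower_record_eq: "lower_record P b \<longleftrightarrow> up.rec b"
  unfolding lower_record_def up.rec_def
  by (intro conj_cong ball_cong refl imp_cong) (simp_all add: abs_snd_Rplus)

lemma upper_record_eq: "upper_record P a \<longleftrightarrow> down.rec a"
  unfolding upper_record_def down.rec_def
  by (intro conj_cong ball_cong refl imp_cong) (simp_all add: abs_snd_Rminus)

lemma upper_rec_eq: "upper_rec P (Suc k) = down.nth_rec k"
proof -
  have "nth_upper_record P (Suc k) a \<longleftrightarrow> a = down.nth_rec k" for a
    using down.nth_record_iff[of a k] by (simp add: nth_upper_record_def upper_record_eq)
  then show ?thesis by (simp add: upper_rec_def)
qed

lemma adj_lower_rec_eq: "adj_lower_rec P (Suc k) = up.next_rec (down.nth_x (Suc k))"
proof -
  have "adjoint_lower_record P (upper_rec P (Suc k)) b \<longleftrightarrow> b = up.next_rec (down.nth_x (Suc k))" for b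
    using up.rightmost_rec_iff[OF down.nth_x_pos, of b "Suc k"]
    by (simp only: adjoint_lower_record_def upper_rec_eq down.fst_nth_rec lower_record_eq)
  then show ?thesis by (simp add: adj_lower_rec_def)
qed

lemma low_up: "0 < t \<Longrightarrow> low P (up_left t) = ennreal \<bar>snd (up.next_rec t)\<bar>"
  by (rule up.low_eq_next_rec[OF _ refl])
    (auto simp: up_left_def Rplus_def dest: unit)

lemma low_down: "0 < t \<Longrightarrow> low P (down_left t) = ennreal \<bar>snd (down.next_rec t)\<bar>"
  by (rule down.low_eq_next_rec[OF _ refl])
    (auto simp: down_left_def Rminus_def dest: unit)

lemma corange_area_eq_corange_of_paths:
  assumes "1 \<le> k"
  shows "corange_area P k = corange_of_paths (\<lambda>s. low P (up_left s)) (\<lambda>s. low P (down_left s)) k"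
proof -
  obtain n where k: "k = Suc n" using assms by (cases k) auto
  have nth_x_le: "down.nth_x j \<le> 1" for j
    using down.nth_x_anti[of 0 j] by (cases j) auto
  have jump_time: "jump_time (\<lambda>s. low P (down_left s)) j = down.nth_x j"
    "value_left_of (\<lambda>s. low P (down_left s)) (down.nth_x j) = ennreal \<bar>snd (down.nth_rec j)\<bar>" for j
    by (rule down.record_reconstruction, simp add: low_down)+
  have "value_left_of (\<lambda>s. low P (up_left s)) (down.nth_x k) = ennreal \<bar>snd (up.next_rec (down.nth_x k))\<bar>"
    using value_left_of_low[OF nth_x_le, of P "{0..}" k] low_up[OF down.nth_x_pos, of k] by (simp add: up_left_def)
  moreover have "\<bar>snd (up.next_rec (down.nth_x k))\<bar> = snd (up.next_rec (down.nth_x k))"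
    using up.next_rec(1)[OF down.nth_x_pos, of k] by (intro abs_snd_Rplus) (simp add: up.rec_def)
  moreover have "\<bar>snd (down.nth_rec n)\<bar> = - snd (down.nth_rec n)"
    using down.rec_nth_rec[of n] by (intro abs_snd_Rminus) (simp add: down.rec_def)
  ultimately show ?thesis
    unfolding corange_area_def corange_of_paths_def k by (simp add: upper_rec_eq adj_lower_rec_eq jump_time down.fst_nth_rec del: down.nth_x.simps)
qed

end

section \<open>Void probabilities of the Poisson process\<close>

text \<open>A hybrid object: the records of the lower half come from the model sequence
  \<open>\<sigma>\<close>, while the upper half is still that of the configuration
  \<open>P\<close>.\<close>

primrec corange_prod :: "(real \<Rightarrow> real \<Rightarrow> ennreal) list \<Rightarrow> real \<Rightarrow> real \<Rightarrow> (nat \<Rightarrow> real \<times> real) \<Rightarrow> (real \<times> real) set \<Rightarrow> ennreal" where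
  "corange_prod [] t g \<sigma> P = 1"
| "corange_prod (f # fs) t g \<sigma> P =
    f (t * snd (\<sigma> 0)) (g + fst (\<sigma> 0) / t + enn2real (low P (up_left (t * snd (\<sigma> 0))))) *
    corange_prod fs (t * snd (\<sigma> 0)) (g + fst (\<sigma> 0) / t) (\<lambda>n. \<sigma> (Suc n)) P"

lemma emeasure_lborel_Times:
  fixes A B :: "real set"
  assumes "A \<in> sets borel" "B \<in> sets borel"
  shows "emeasure lborel (A \<times> B) = emeasure lborel A * emeasure lborel B"
  using lborel.emeasure_pair_measure_Times[of A lborel B] assms by (simp add: lborel_prod)

locale poisson_strip = prob_space M for M :: "'w measure" +
  fixes Xi :: "'w \<Rightarrow> (real \<times> real) set"
  assumes poisson: "unit_poisson_strip M Xi"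
begin

lemma Xi_strip: "\<omega> \<in> space M \<Longrightarrow> Xi \<omega> \<subseteq> strip"
  and finite_Xi: "\<omega> \<in> space M \<Longrightarrow> bounded K \<Longrightarrow> finite (Xi \<omega> \<inter> K)"
  using conjunct1[OF conjunct2[OF poisson[unfolded unit_poisson_strip_def]]] by simp_all

definition region :: "(real \<times> real) set \<Rightarrow> bool" where
  "region Z \<longleftrightarrow> Z \<in> sets borel \<and> bounded Z \<and> Z \<subseteq> strip"

lemma region_Un: "region Z \<Longrightarrow> region Z' \<Longrightarrow> region (Z \<union> Z')"
  by (auto simp: region_def)

lemma count_measurable: "region Z \<Longrightarrow> (\<lambda>\<omega>. card (Xi \<omega> \<inter> Z)) \<in> M \<rightarrow>\<^sub>M count_space UNIV"
  and prob_count: "region Z \<Longrightarrow> prob {\<omega> \<in> space M. card (Xi \<omega> \<inter> Z) = k} =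
    measure lborel Z ^ k / fact k * exp (- measure lborel Z)"
  using conjunct1[OF conjunct2[OF conjunct2[OF poisson[unfolded unit_poisson_strip_def]]]]
  by (simp_all add: region_def)

definition void :: "(real \<times> real) set \<Rightarrow> 'w set" where
  "void Z = {\<omega> \<in> space M. Xi \<omega> \<inter> Z = {}}"

lemma void_eq: "region Z \<Longrightarrow> void Z = {\<omega> \<in> space M. card (Xi \<omega> \<inter> Z) = 0}"
  using finite_Xi by (auto simp: void_def region_def)

lemma void_events: "region Z \<Longrightarrow> void Z \<in> events"
  unfolding void_eq using count_measurable[of Z] by measurable

lemma prob_void: "region Z \<Longrightarrow> prob (void Z) = exp (- measure lborel Z)"
  unfolding void_eq using prob_count[of Z 0] by simp

lemma void_Un: "void Z \<inter> void Z' = void (Z \<union> Z')"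
  by (auto simp: void_def)

section \<open>Independence derived from void probabilities\<close>

definition voids :: "(real \<times> real) set \<Rightarrow> 'w set set" where
  "voids A = {void Z | Z. region Z \<and> Z \<subseteq> A}"

abbreviation void_sigma :: "(real \<times> real) set \<Rightarrow> 'w measure" where
  "void_sigma A \<equiv> sigma (space M) (voids A)"

lemma voids_space: "voids A \<subseteq> Pow (space M)"
  by (auto simp: voids_def void_def)

lemma sets_void_sigma: "sets (void_sigma A) = sigma_sets (space M) (voids A)"
  using voids_space by (rule sets_measure_of)

lemma sets_void_sigma_subset: "sets (void_sigma A) \<subseteq> events"
  unfolding sets_void_sigma by (intro sets.sigma_sets_subset) (auto simp: voids_def intro: void_events)

lemma space_void_sigma [simp]: "space (void_sigma A) = space M"
  using voids_space by (rule space_measure_of)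

lemma measurable_void_sigma: "f \<in> void_sigma A \<rightarrow>\<^sub>M N \<Longrightarrow> f \<in> M \<rightarrow>\<^sub>M N"
  using sets_void_sigma_subset by (auto simp: measurable_def)

lemma measurable_void_sigma_mono:
  assumes "A \<subseteq> B" "f \<in> void_sigma A \<rightarrow>\<^sub>M N"
  shows "f \<in> void_sigma B \<rightarrow>\<^sub>M N"
proof -
  have "sets (void_sigma A) \<subseteq> sets (void_sigma B)"
    unfolding sets_void_sigma by (rule sigma_sets_mono') (use assms(1) in \<open>auto simp: voids_def\<close>)
  then show ?thesis using assms(2) by (auto simp: measurable_def)
qed

lemma indep_set_void_sigma:
  assumes null: "A \<inter> B \<in> null_sets lborel"
  shows "indep_set (sets (void_sigma A)) (sets (void_sigma B))"
proof -
  have stable: "Int_stable (voids C)" for C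
  proof (rule Int_stableI)
    fix a b assume "a \<in> voids C" "b \<in> voids C"
    then obtain Z Z' where "a = void Z" "b = void Z'" "region Z" "region Z'" "Z \<subseteq> C" "Z' \<subseteq> C"
      by (auto simp: voids_def)
    then show "a \<inter> b \<in> voids C"
      unfolding voids_def using region_Un[of Z Z'] by (auto simp: void_Un intro!: exI[of _ "Z \<union> Z'"])
  qed
  have "indep_set (voids A) (voids B)"
  proof (rule indep_setI)
    fix a b assume "a \<in> voids A" "b \<in> voids B"
    then obtain Z Z' where Z: "a = void Z" "b = void Z'" "region Z" "region Z'" "Z \<subseteq> A" "Z' \<subseteq> B"
      by (auto simp: voids_def)
    have "Z \<inter> Z' \<in> null_sets lborel"
      using Z by (intro null_sets_subset[OF null]) (auto simp: region_def)
    then have "measure lborel (Z \<inter> Z') = 0"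
      by (simp add: measure_def null_setsD1)
    moreover have "measure lborel (Z \<union> Z') = measure lborel Z + measure lborel Z' - measure lborel (Z \<inter> Z')"
      using Z(3,4) by (intro measure_Un3) (auto simp: region_def fmeasurable_def dest: emeasure_bounded_finite)
    ultimately have "prob (void (Z \<union> Z')) = prob (void Z) * prob (void Z')"
      using Z region_Un[of Z Z'] by (simp add: prob_void exp_add[symmetric])
    then show "prob (a \<inter> b) = prob a * prob b"
      using Z by (simp add: void_Un)
  qed (auto simp: voids_def intro: void_events)
  from indep_set_sigma_sets[OF this stable stable] show ?thesis
    unfolding sets_void_sigma .
qed

lemma distr_Pair_void_sigma:
  assumes null: "A \<inter> B \<in> null_sets lborel"
    and X: "X \<in> void_sigma A \<rightarrow>\<^sub>M N1" and Y: "Y \<in> void_sigma B \<rightarrow>\<^sub>M N2"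
  shows "distr M N1 X \<Otimes>\<^sub>M distr M N2 Y = distr M (N1 \<Otimes>\<^sub>M N2) (\<lambda>\<omega>. (X \<omega>, Y \<omega>))"
proof -
  have [measurable]: "X \<in> M \<rightarrow>\<^sub>M N1" "Y \<in> M \<rightarrow>\<^sub>M N2"
    using X Y by (auto intro: measurable_void_sigma)
  interpret X: prob_space "distr M N1 X" by (rule prob_space_distr) simp
  interpret Y: prob_space "distr M N2 Y" by (rule prob_space_distr) simp
  show ?thesis
  proof (rule pair_measure_eqI)
    show "sigma_finite_measure (distr M N1 X)" "sigma_finite_measure (distr M N2 Y)" ..
    fix C D assume "C \<in> sets (distr M N1 X)" "D \<in> sets (distr M N2 Y)"
    then have C [measurable]: "C \<in> sets N1" and D [measurable]: "D \<in> sets N2" by auto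
    have "prob (X -` C \<inter> space M \<inter> (Y -` D \<inter> space M)) = prob (X -` C \<inter> space M) * prob (Y -` D \<inter> space M)"
      using measurable_sets[OF X C] measurable_sets[OF Y D]
      by (intro indep_setD[OF indep_set_void_sigma[OF null]]) (simp_all only: space_void_sigma)
    moreover have "(\<lambda>\<omega>. (X \<omega>, Y \<omega>)) -` (C \<times> D) \<inter> space M = X -` C \<inter> space M \<inter> (Y -` D \<inter> space M)"
      by auto
    ultimately show "emeasure (distr M N1 X) C * emeasure (distr M N2 Y) D =
        emeasure (distr M (N1 \<Otimes>\<^sub>M N2) (\<lambda>\<omega>. (X \<omega>, Y \<omega>))) (C \<times> D)"
      by (simp add: emeasure_distr emeasure_eq_measure ennreal_mult')
  qed simp
qed

text \<open>Only \<open>X\<close> is replaced by its law. \<open>Y\<close> stays on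
  \<open>M\<close>, so that an inner integral can be treated further without knowing the law of
  \<open>Y\<close>.\<close>

lemma nn_integral_indep:
  assumes "A \<inter> B \<in> null_sets lborel" and X: "X \<in> void_sigma A \<rightarrow>\<^sub>M N1" and Y: "Y \<in> void_sigma B \<rightarrow>\<^sub>M N2"
    and f [measurable]: "f \<in> borel_measurable (N1 \<Otimes>\<^sub>M N2)"
  shows "(\<integral>\<^sup>+\<omega>. f (X \<omega>, Y \<omega>) \<partial>M) = (\<integral>\<^sup>+x. \<integral>\<^sup>+\<omega>. f (x, Y \<omega>) \<partial>M \<partial>distr M N1 X)"
proof -
  have [measurable]: "X \<in> M \<rightarrow>\<^sub>M N1" "Y \<in> M \<rightarrow>\<^sub>M N2"
    using X Y by (auto intro: measurable_void_sigma)
  interpret Y: prob_space "distr M N2 Y" by (rule prob_space_distr) simp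
  have "(\<integral>\<^sup>+\<omega>. f (X \<omega>, Y \<omega>) \<partial>M) = (\<integral>\<^sup>+p. f p \<partial>distr M (N1 \<Otimes>\<^sub>M N2) (\<lambda>\<omega>. (X \<omega>, Y \<omega>)))"
    by (subst nn_integral_distr) simp_all
  also have "\<dots> = (\<integral>\<^sup>+p. f p \<partial>(distr M N1 X \<Otimes>\<^sub>M distr M N2 Y))"
    by (simp only: distr_Pair_void_sigma[OF assms(1-3)])
  also have "\<dots> = (\<integral>\<^sup>+x. \<integral>\<^sup>+y. f (x, y) \<partial>distr M N2 Y \<partial>distr M N1 X)"
    by (subst Y.nn_integral_fst[symmetric]) simp_all
  also have "\<dots> = (\<integral>\<^sup>+x. \<integral>\<^sup>+\<omega>. f (x, Y \<omega>) \<partial>M \<partial>distr M N1 X)"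
    by (intro nn_integral_cong nn_integral_distr) simp_all
  finally show ?thesis .
qed

lemma region_truncate:
  assumes "A \<in> sets borel" "A \<subseteq> strip"
  shows "region (A \<inter> {p. \<bar>snd p\<bar> < r})"
  unfolding region_def
proof (intro conjI)
  show "A \<inter> {p. \<bar>snd p\<bar> < r} \<in> sets borel"
  proof -
    have "{p::real \<times> real. \<bar>snd p\<bar> < r} \<in> sets borel"
      by (intro borel_open open_Collect_less continuous_intros)
    then show ?thesis using assms(1) by simp
  qed
  show "bounded (A \<inter> {p. \<bar>snd p\<bar> < r})"
  proof (rule bounded_subset)
    show "bounded ({0..1::real} \<times> {-r..r})" by (intro bounded_Times) auto
    show "A \<inter> {p. \<bar>snd p\<bar> < r} \<subseteq> {0..1} \<times> {-r..r}"
      using assms(2) by (auto simp: strip_def)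
  qed
qed (use assms in auto)

lemma le_low_eq_void: "{\<omega> \<in> space M. ennreal r \<le> low (Xi \<omega>) A} = void (A \<inter> {p. \<bar>snd p\<bar> < r})"
  by (auto simp: le_low_iff void_def)

lemma measurable_low:
  assumes "A \<in> sets borel" "A \<subseteq> strip"
  shows "(\<lambda>\<omega>. low (Xi \<omega>) A) \<in> borel_measurable (void_sigma A)"
proof (rule borel_measurable_ennreal_tails)
  fix r :: real
  have "void (A \<inter> {p. \<bar>snd p\<bar> < r}) \<in> voids A"
    unfolding voids_def using region_truncate[OF assms] by blast
  then show "{\<omega> \<in> space (void_sigma A). ennreal r \<le> low (Xi \<omega>) A} \<in> sets (void_sigma A)"
    unfolding space_void_sigma le_low_eq_void sets_void_sigma by (rule sigma_sets.Basic)
qed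

text \<open>The tail at \<open>r\<close> is the void event of a region of area \<open>w * r\<close>,
  which has the exponential probability \<open>exp (- w * r)\<close>.\<close>

lemma distr_low:
  assumes A: "A \<in> sets borel" "A \<subseteq> strip" and w: "0 < w"
    and area: "\<And>r. 0 \<le> r \<Longrightarrow> measure lborel (A \<inter> {p. \<bar>snd p\<bar> < r}) = w * r"
  shows "distr M borel (\<lambda>\<omega>. low (Xi \<omega>) A) = distr std_exp borel (\<lambda>e. ennreal (e / w))"
proof (rule measure_eqI_ennreal_tails)
  have [measurable]: "(\<lambda>\<omega>. low (Xi \<omega>) A) \<in> borel_measurable M"
    by (rule measurable_void_sigma[OF measurable_low[OF A]])
  show "finite_measure (distr M borel (\<lambda>\<omega>. low (Xi \<omega>) A))"
    by (intro finite_measure_distr) simp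
  fix r :: real assume r: "0 \<le> r"
  have "emeasure (distr M borel (\<lambda>\<omega>. low (Xi \<omega>) A)) {ennreal r..} = emeasure M {\<omega> \<in> space M. ennreal r \<le> low (Xi \<omega>) A}"
    by (subst emeasure_distr) (auto intro!: arg_cong[where f="emeasure M"])
  also have "\<dots> = ennreal (exp (- w * r))"
    unfolding le_low_eq_void emeasure_eq_measure prob_void[OF region_truncate[OF A]] area[OF r] by simp
  also have "\<dots> = (\<integral>\<^sup>+x. ennreal (exponential_density 1 x) * indicator {w * r..} x \<partial>lborel)"
    using w r by (subst nn_integral_exponential_tail) auto
  also have "\<dots> = emeasure std_exp {w * r..}"
    unfolding std_exp_def by (subst emeasure_density) auto
  also have "\<dots> = emeasure std_exp ((\<lambda>e. ennreal (e / w)) -` {ennreal r..} \<inter> space std_exp)"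
  proof (rule emeasure_eq_AE)
    \<comment> \<open>For negative \<open>e\<close> the value \<open>ennreal (e / w)\<close> is
      truncated to 0 and would wrongly belong to the tail at \<open>r = 0\<close>.\<close>
    show "AE e in std_exp. e \<in> {w * r..} \<longleftrightarrow> e \<in> (\<lambda>e. ennreal (e / w)) -` {ennreal r..} \<inter> space std_exp"
      using AE_std_exp_pos by eventually_elim (use w in \<open>auto simp: field_simps\<close>)
    show "(\<lambda>e. ennreal (e / w)) -` {ennreal r..} \<inter> space std_exp \<in> sets std_exp"
      by (rule measurable_sets[of _ _ borel]) simp_all
  qed simp
  also have "\<dots> = emeasure (distr std_exp borel (\<lambda>e. ennreal (e / w))) {ennreal r..}"
    by (subst emeasure_distr) simp_all
  finally show "emeasure (distr M borel (\<lambda>\<omega>. low (Xi \<omega>) A)) {ennreal r..} =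
    emeasure (distr std_exp borel (\<lambda>e. ennreal (e / w))) {ennreal r..}" .
qed simp_all

lemma AE_low_finite:
  assumes "A \<in> sets borel" "A \<subseteq> strip" "0 < w"
    "\<And>r. 0 \<le> r \<Longrightarrow> measure lborel (A \<inter> {p. \<bar>snd p\<bar> < r}) = w * r"
  shows "AE \<omega> in M. low (Xi \<omega>) A \<noteq> \<top>"
proof -
  have "AE x in distr std_exp borel (\<lambda>e. ennreal (e / w)). x \<noteq> \<top>"
    by (subst AE_distr_iff) simp_all
  then have "AE x in distr M borel (\<lambda>\<omega>. low (Xi \<omega>) A). x \<noteq> \<top>"
    by (subst distr_low[OF assms])
  then show ?thesis
    by (rule AE_distrD[rotated]) (rule measurable_void_sigma[OF measurable_low[OF assms(1,2)]])
qed

section \<open>Nearest heights over columns and their chain along given abscissas\<close>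

lemma up_column:
  assumes "0 \<le> a" "a < b" "b \<le> 1"
  shows "{a..<b} \<times> {0::real..} \<in> sets borel" "{a..<b} \<times> {0..} \<subseteq> strip"
    "0 \<le> r \<Longrightarrow> measure lborel ({a..<b} \<times> {0..} \<inter> {p. \<bar>snd p\<bar> < r}) = (b - a) * r"
proof -
  show "{a..<b} \<times> {0::real..} \<in> sets borel" by (simp add: borel_prod[symmetric])
  show "{a..<b} \<times> {0..} \<subseteq> strip" using assms by (auto simp: strip_def)
  show "measure lborel ({a..<b} \<times> {0..} \<inter> {p. \<bar>snd p\<bar> < r}) = (b - a) * r" if r: "0 \<le> r"
  proof -
    have "{a..<b} \<times> {0..} \<inter> {p. \<bar>snd p\<bar> < r} = {a..<b} \<times> {0..<r}" by auto
    moreover have "emeasure lborel ({a..<b} \<times> {0..<r}) = ennreal ((b - a) * r)"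
      using assms r by (subst emeasure_lborel_Times) (auto simp: ennreal_mult)
    ultimately show ?thesis
      using assms r by (simp add: measure_def)
  qed
qed

lemma down_column:
  assumes "0 \<le> a" "a < b" "b \<le> 1"
  shows "{a..<b} \<times> {..0::real} \<in> sets borel" "{a..<b} \<times> {..0} \<subseteq> strip"
    "0 \<le> r \<Longrightarrow> measure lborel ({a..<b} \<times> {..0} \<inter> {p. \<bar>snd p\<bar> < r}) = (b - a) * r"
proof -
  show "{a..<b} \<times> {..0::real} \<in> sets borel" by (simp add: borel_prod[symmetric])
  show "{a..<b} \<times> {..0} \<subseteq> strip" using assms by (auto simp: strip_def)
  show "measure lborel ({a..<b} \<times> {..0} \<inter> {p. \<bar>snd p\<bar> < r}) = (b - a) * r" if r: "0 \<le> r"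
  proof -
    have "{a..<b} \<times> {..0} \<inter> {p. \<bar>snd p\<bar> < r} = {a..<b} \<times> {-r<..0}" by auto
    moreover have "emeasure lborel ({a..<b} \<times> {-r<..0}) = ennreal ((b - a) * r)"
      using assms r by (subst emeasure_lborel_Times) (auto simp: ennreal_mult)
    ultimately show ?thesis
      using assms r by (simp add: measure_def)
  qed
qed

lemma measurable_low_up: "t \<le> 1 \<Longrightarrow> (\<lambda>\<omega>. low (Xi \<omega>) (up_left t)) \<in> borel_measurable (void_sigma (up_left t))"
  unfolding up_left_def by (rule measurable_low) (auto simp: borel_prod[symmetric] strip_def)

lemma measurable_low_down: "t \<le> 1 \<Longrightarrow> (\<lambda>\<omega>. low (Xi \<omega>) (down_left t)) \<in> borel_measurable (void_sigma (down_left t))"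
  unfolding down_left_def by (rule measurable_low) (auto simp: borel_prod[symmetric] strip_def)

lemma nn_integral_low_up:
  assumes "0 < t" "t \<le> 1" and [measurable]: "\<phi> \<in> borel_measurable borel"
  shows "(\<integral>\<^sup>+\<omega>. \<phi> (enn2real (low (Xi \<omega>) (up_left t))) \<partial>M) = (\<integral>\<^sup>+e. \<phi> (e / t) \<partial>std_exp)"
proof -
  have [measurable]: "(\<lambda>\<omega>. low (Xi \<omega>) (up_left t)) \<in> borel_measurable M"
    using assms by (intro measurable_void_sigma[OF measurable_low_up])
  have "(\<integral>\<^sup>+\<omega>. \<phi> (enn2real (low (Xi \<omega>) (up_left t))) \<partial>M) =
      (\<integral>\<^sup>+x. \<phi> (enn2real x) \<partial>distr M borel (\<lambda>\<omega>. low (Xi \<omega>) (up_left t)))"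
    by (subst nn_integral_distr) simp_all
  also have "\<dots> = (\<integral>\<^sup>+x. \<phi> (enn2real x) \<partial>distr std_exp borel (\<lambda>e. ennreal (e / t)))"
    unfolding up_left_def by (subst distr_low[of _ t]) (use up_column[of 0 t] assms in auto)
  also have "\<dots> = (\<integral>\<^sup>+e. \<phi> (enn2real (ennreal (e / t))) \<partial>std_exp)"
    by (subst nn_integral_distr) simp_all
  also have "\<dots> = (\<integral>\<^sup>+e. \<phi> (e / t) \<partial>std_exp)"
    by (rule nn_integral_cong_AE, use AE_std_exp_pos in eventually_elim) (use assms in simp)
  finally show ?thesis .
qed

lemma measurable_corange_prod:
  assumes "\<forall>f\<in>set fs. case_prod f \<in> borel_measurable (borel \<Otimes>\<^sub>M borel)"
    and "\<forall>i. 0 < snd (\<sigma> i) \<and> snd (\<sigma> i) < 1" and "0 < t" "t \<le> 1"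
  shows "(\<lambda>\<omega>. corange_prod fs t g \<sigma> (Xi \<omega>)) \<in> borel_measurable (void_sigma (up_left t))"
  using assms
proof (induction fs arbitrary: t g \<sigma>)
  case (Cons f fs)
  define t' where "t' = t * snd (\<sigma> 0)"
  have t': "0 < t'" "t' < t" using Cons.prems by (auto simp: t'_def)
  have sub: "up_left t' \<subseteq> up_left t" using t' by (auto simp: up_left_def)
  from Cons.prems have [measurable]: "case_prod f \<in> borel_measurable (borel \<Otimes>\<^sub>M borel)" by simp
  have [measurable]: "(\<lambda>\<omega>. low (Xi \<omega>) (up_left t')) \<in> borel_measurable (void_sigma (up_left t))"
    using t' Cons.prems by (intro measurable_void_sigma_mono[OF sub] measurable_low_up) auto
  have [measurable]: "(\<lambda>\<omega>. corange_prod fs t' (g + fst (\<sigma> 0) / t) (\<lambda>n. \<sigma> (Suc n)) (Xi \<omega>)) \<in> borel_measurable (void_sigma (up_left t))"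
    using t' Cons.prems by (intro measurable_void_sigma_mono[OF sub] Cons.IH) auto
  show ?case
    unfolding corange_prod.simps t'_def[symmetric] by measurable
qed simp

text \<open>The test function \<open>\<phi>\<close> of F(t) carries the induction. F(t) is the
  minimum of F(t') and the height of the column \<open>[t', t)\<close>; with the column height
  fixed, \<open>\<phi>\<close> of this minimum times the first factor is again a test function of
  F(t'), to which the induction hypothesis applies.\<close>

lemma nn_integral_corange_prod:
  assumes "\<forall>f\<in>set fs. case_prod f \<in> borel_measurable (borel \<Otimes>\<^sub>M borel)"
    and "\<forall>i. 0 < snd (\<sigma> i) \<and> snd (\<sigma> i) < 1" and "0 < t" "t \<le> 1"
    and "\<phi> \<in> borel_measurable borel"
  shows "(\<integral>\<^sup>+\<omega>. \<phi> (enn2real (low (Xi \<omega>) (up_left t))) * corange_prod fs t g \<sigma> (Xi \<omega>) \<partial>M) =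
    (\<integral>\<^sup>+m. \<phi> (m / t) * chain_value fs t g (m / t) \<sigma> \<partial>std_exp)"
  using assms
proof (induction fs arbitrary: t g \<sigma> \<phi>)
  case Nil
  then show ?case by (simp add: nn_integral_low_up)
next
  case (Cons f fs)
  define t' g' \<sigma>' where "t' = t * snd (\<sigma> 0)" and "g' = g + fst (\<sigma> 0) / t" and "\<sigma>' = (\<lambda>n. \<sigma> (Suc n))"
  have t': "0 < t'" "t' < t" using Cons.prems by (auto simp: t'_def)
  then have "t' \<le> 1" using Cons.prems by simp
  note t' = t' this
  from Cons.prems have fs: "\<forall>f\<in>set fs. case_prod f \<in> borel_measurable (borel \<Otimes>\<^sub>M borel)" by simp
  from Cons.prems have [measurable]: "case_prod f \<in> borel_measurable (borel \<Otimes>\<^sub>M borel)" "\<phi> \<in> borel_measurable borel" by auto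
  have [measurable]: "\<sigma>' \<in> space exp_unif_seq" by simp
  have [measurable]: "(\<lambda>m. chain_value fs t' g' m \<sigma>') \<in> borel_measurable borel"
    by (rule borel_measurable_chain_value[OF fs]) simp_all
  let ?col = "{t'..<t} \<times> {0..} :: (real \<times> real) set"
  define X where "X \<omega> = low (Xi \<omega>) ?col" for \<omega>
  define Y where "Y \<omega> = (low (Xi \<omega>) (up_left t'), corange_prod fs t' g' \<sigma>' (Xi \<omega>))" for \<omega>
  have X: "X \<in> borel_measurable (void_sigma ?col)"
    unfolding X_def using t' Cons.prems by (intro measurable_low up_column) auto
  have Y: "Y \<in> void_sigma (up_left t') \<rightarrow>\<^sub>M borel \<Otimes>\<^sub>M borel"
    unfolding Y_def using t' Cons.prems fs
    by (intro measurable_Pair measurable_low_up measurable_corange_prod) (auto simp: \<sigma>'_def)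
  have disj: "?col \<inter> up_left t' \<in> null_sets lborel"
  proof -
    have "?col \<inter> up_left t' = {}" by (auto simp: up_left_def)
    then show ?thesis by simp
  qed
  have split: "up_left t = ?col \<union> up_left t'"
    using t' by (auto simp: up_left_def)
  define k where "k m = f t' (g' + m) * chain_value fs t' g' m \<sigma>'" for m
  have [measurable]: "k \<in> borel_measurable borel" unfolding k_def by measurable
  \<comment> \<open>\<open>enn2real\<close> sends \<open>\<top>\<close> to 0 and therefore commutes
    with the minimum only for finite heights.\<close>
  have fin: "AE \<omega> in M. X \<omega> \<noteq> \<top>" "AE \<omega> in M. low (Xi \<omega>) (up_left t') \<noteq> \<top>"
    unfolding X_def up_left_def
    by (rule AE_low_finite[of _ "t - t'"], use up_column[of t' t] t' Cons.prems in auto)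
      (rule AE_low_finite[of _ "t' - 0"], use up_column[of 0 t'] t' Cons.prems in auto)
  have "(\<integral>\<^sup>+\<omega>. \<phi> (enn2real (low (Xi \<omega>) (up_left t))) * corange_prod (f # fs) t g \<sigma> (Xi \<omega>) \<partial>M) =
    (\<integral>\<^sup>+\<omega>. (case (X \<omega>, Y \<omega>) of (x, m, p) \<Rightarrow> \<phi> (min (enn2real x) (enn2real m)) * (f t' (g' + enn2real m) * p)) \<partial>M)"
  proof (rule nn_integral_cong_AE, use fin in eventually_elim)
    fix \<omega> assume fin: "X \<omega> \<noteq> \<top>" "low (Xi \<omega>) (up_left t') \<noteq> \<top>"
    have "enn2real (low (Xi \<omega>) (up_left t)) = min (enn2real (X \<omega>)) (enn2real (low (Xi \<omega>) (up_left t')))"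
      unfolding split low_Un X_def[symmetric] using fin
      by (cases "X \<omega>"; cases "low (Xi \<omega>) (up_left t')") (auto simp: min_def)
    then show "\<phi> (enn2real (low (Xi \<omega>) (up_left t))) * corange_prod (f # fs) t g \<sigma> (Xi \<omega>) =
      (case (X \<omega>, Y \<omega>) of (x, m, p) \<Rightarrow> \<phi> (min (enn2real x) (enn2real m)) * (f t' (g' + enn2real m) * p))"
      by (simp add: Y_def t'_def g'_def \<sigma>'_def)
  qed
  also have "\<dots> = (\<integral>\<^sup>+x. \<integral>\<^sup>+\<omega>. (case (x, Y \<omega>) of (x, m, p) \<Rightarrow> \<phi> (min (enn2real x) (enn2real m)) * (f t' (g' + enn2real m) * p)) \<partial>M \<partial>distr M borel X)"
    by (rule nn_integral_indep[OF disj X Y]) measurable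
  also have "distr M borel X = distr std_exp borel (\<lambda>e. ennreal (e / (t - t')))"
    unfolding X_def using up_column[of t' t] t' Cons.prems by (intro distr_low) auto
  also have "(\<integral>\<^sup>+x. \<integral>\<^sup>+\<omega>. (case (x, Y \<omega>) of (x, m, p) \<Rightarrow> \<phi> (min (enn2real x) (enn2real m)) * (f t' (g' + enn2real m) * p)) \<partial>M \<partial>distr std_exp borel (\<lambda>e. ennreal (e / (t - t'))))
    = (\<integral>\<^sup>+e. \<integral>\<^sup>+\<omega>. (case (ennreal (e / (t - t')), Y \<omega>) of (x, m, p) \<Rightarrow> \<phi> (min (enn2real x) (enn2real m)) * (f t' (g' + enn2real m) * p)) \<partial>M \<partial>std_exp)"
  proof -
    have [measurable]: "Y \<in> M \<rightarrow>\<^sub>M borel \<Otimes>\<^sub>M borel" using Y by (rule measurable_void_sigma)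
    show ?thesis by (rule nn_integral_distr) measurable
  qed
  also have "\<dots> = (\<integral>\<^sup>+e. \<integral>\<^sup>+m. \<phi> (min (e / (t - t')) (m / t')) * k (m / t') \<partial>std_exp \<partial>std_exp)"
  proof (rule nn_integral_cong_AE, use AE_std_exp_pos in eventually_elim)
    fix e :: real assume e: "0 < e"
    have "(\<integral>\<^sup>+\<omega>. (case (ennreal (e / (t - t')), Y \<omega>) of (x, m, p) \<Rightarrow> \<phi> (min (enn2real x) (enn2real m)) * (f t' (g' + enn2real m) * p)) \<partial>M) =
      (\<integral>\<^sup>+\<omega>. (\<lambda>m. \<phi> (min (e / (t - t')) m) * f t' (g' + m)) (enn2real (low (Xi \<omega>) (up_left t'))) * corange_prod fs t' g' \<sigma>' (Xi \<omega>) \<partial>M)"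
      using e t' by (simp add: Y_def mult.assoc)
    also have "\<dots> = (\<integral>\<^sup>+m. (\<lambda>m. \<phi> (min (e / (t - t')) m) * f t' (g' + m)) (m / t') * chain_value fs t' g' (m / t') \<sigma>' \<partial>std_exp)"
      by (rule Cons.IH[OF fs]) (use Cons.prems t' in \<open>auto simp: \<sigma>'_def\<close>)
    finally show "(\<integral>\<^sup>+\<omega>. (case (ennreal (e / (t - t')), Y \<omega>) of (x, m, p) \<Rightarrow> \<phi> (min (enn2real x) (enn2real m)) * (f t' (g' + enn2real m) * p)) \<partial>M) =
      (\<integral>\<^sup>+m. \<phi> (min (e / (t - t')) (m / t')) * k (m / t') \<partial>std_exp)"
      by (simp add: k_def mult.assoc)
  qed
  \<comment> \<open>Reversal with \<open>b = t'\<close> and \<open>w = t - t'\<close>: the outer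
    variable becomes F(t), and \<open>b / (b + w) = t' / t\<close> is the uniform factor of the
    step.\<close>
  also have "\<dots> = (\<integral>\<^sup>+m. (ennreal (t' / (t' + (t - t'))) * (\<phi> (m / (t' + (t - t'))) * k (m / (t' + (t - t')))) +
       ennreal ((t - t') / (t' + (t - t'))) * (\<integral>\<^sup>+y. \<phi> (m / (t' + (t - t'))) * k (m / (t' + (t - t')) + y / t') \<partial>std_exp)) \<partial>std_exp)"
    using t' by (intro nn_integral_min_exponentials[where \<psi>="\<lambda>p q. \<phi> p * k q"]) auto
  also have "\<dots> = (\<integral>\<^sup>+m. \<phi> (m / t) * chain_value (f # fs) t g (m / t) \<sigma> \<partial>std_exp)"
  proof (intro nn_integral_cong)
    fix m :: real
    have u: "t' / t = snd (\<sigma> 0)" "(t - t') / t = 1 - snd (\<sigma> 0)"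
      using Cons.prems by (auto simp: t'_def field_simps)
    have "(\<integral>\<^sup>+y. \<phi> (m / t) * k (m / t + y / t') \<partial>std_exp) = \<phi> (m / t) * (\<integral>\<^sup>+y. k (m / t + y / t') \<partial>std_exp)"
      by (rule nn_integral_cmult) simp
    then show "ennreal (t' / (t' + (t - t'))) * (\<phi> (m / (t' + (t - t'))) * k (m / (t' + (t - t')))) +
       ennreal ((t - t') / (t' + (t - t'))) * (\<integral>\<^sup>+y. \<phi> (m / (t' + (t - t'))) * k (m / (t' + (t - t')) + y / t') \<partial>std_exp) =
       \<phi> (m / t) * chain_value (f # fs) t g (m / t) \<sigma>"
      unfolding chain_value.simps t'_def[symmetric] g'_def[symmetric] \<sigma>'_def[symmetric] k_def[symmetric]
      by (simp add: u distrib_left mult_ac)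
  qed
  finally show ?case .
qed

end

section \<open>The two halves of the strip\<close>

lemma corange_prod_eq_prod:
  "corange_prod fs t g \<sigma> P = (\<Prod>i<length fs. (fs ! i) (t * rec_x \<sigma> (Suc i))
     (g + rec_height \<sigma> (Suc i) / t + enn2real (low P (up_left (t * rec_x \<sigma> (Suc i))))))"
proof (induction fs arbitrary: t g \<sigma>)
  case (Cons f fs)
  show ?case
    unfolding corange_prod.simps Cons.IH length_Cons prod.lessThan_Suc_shift
    by (simp add: rec_height_shift[of \<sigma>] rec_x_shift[of \<sigma>] add_divide_distrib add_ac mult_ac)
qed simp

lemma path_value_eq_prod:
  assumes "\<forall>f\<in>set fs. case_prod f \<in> borel_measurable (borel \<Otimes>\<^sub>M borel)"
  shows "path_value fs t s = (\<integral>\<^sup>+\<sigma>. (\<Prod>i<length fs. (fs ! i) (t * rec_x \<sigma> i) (s + rec_height \<sigma> (Suc i) / t)) \<partial>exp_unif_seq)"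
  using assms
proof (induction fs arbitrary: t s)
  case Nil
  then show ?case by (simp add: exp_unif_seq.emeasure_space_1[simplified])
next
  case (Cons f fs)
  let ?p = "\<lambda>fs t s \<sigma>. \<Prod>i<length fs. (fs ! i) (t * rec_x \<sigma> i) (s + rec_height \<sigma> (Suc i) / t)"
  have meas: "?p fs t s \<in> borel_measurable exp_unif_seq"
    if fs: "\<forall>f\<in>set fs. case_prod f \<in> borel_measurable (borel \<Otimes>\<^sub>M borel)" for fs :: "(real \<Rightarrow> real \<Rightarrow> ennreal) list" and t s
  proof (rule borel_measurable_prod_ennreal)
    fix i assume "i \<in> {..<length fs}"
    then have [measurable]: "case_prod (fs ! i) \<in> borel_measurable (borel \<Otimes>\<^sub>M borel)"
      using fs by simp
    show "(\<lambda>\<sigma>. (fs ! i) (t * rec_x \<sigma> i) (s + rec_height \<sigma> (Suc i) / t)) \<in> borel_measurable exp_unif_seq"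
      by measurable
  qed
  from Cons.prems have fs: "\<forall>f\<in>set fs. case_prod f \<in> borel_measurable (borel \<Otimes>\<^sub>M borel)" by simp
  have "(\<integral>\<^sup>+\<sigma>. ?p (f # fs) t s \<sigma> \<partial>exp_unif_seq) =
     (\<integral>\<^sup>+z. \<integral>\<^sup>+\<sigma>. ?p (f # fs) t s (case_nat z \<sigma>) \<partial>exp_unif_seq \<partial>exp_unif)"
    by (rule nn_integral_exp_unif_seq[OF meas[OF Cons.prems]])
  also have "\<dots> = (\<integral>\<^sup>+z. \<integral>\<^sup>+\<sigma>. f t (s + fst z / t) * ?p fs (t * snd z) (s + fst z / t) \<sigma> \<partial>exp_unif_seq \<partial>exp_unif)"
    unfolding length_Cons prod.lessThan_Suc_shift
    by (simp add: rec_height_shift[of "case_nat _ _"] rec_x_shift[of "case_nat _ _"] add_divide_distrib add_ac mult_ac)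
  also have "\<dots> = (\<integral>\<^sup>+z. f t (s + fst z / t) * path_value fs (t * snd z) (s + fst z / t) \<partial>exp_unif)"
    unfolding Cons.IH[OF fs] by (intro nn_integral_cong nn_integral_cmult meas fs)
  finally show ?case by simp
qed

text \<open>Every subset of a null set is measurable for the completion, so nothing has to be known
  about \<open>g\<close> where it differs from \<open>f\<close>. This handles random variables
  defined by a description that is meaningful only almost surely.\<close>

lemma measurable_completion_AE:
  assumes f: "f \<in> M \<rightarrow>\<^sub>M N" and ae: "AE x in M. f x = g x" and g: "g \<in> space M \<rightarrow> space N"
  shows "g \<in> completion M \<rightarrow>\<^sub>M N"
proof (rule measurableI)
  from ae obtain Z where Z: "Z \<in> null_sets M" "{x\<in>space M. f x \<noteq> g x} \<subseteq> Z"
    by (auto elim!: AE_E simp: null_sets_def)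
  fix X assume X: "X \<in> sets N"
  have "g -` X \<inter> space (completion M) = (f -` X \<inter> space M - Z) \<union> (g -` X \<inter> space M \<inter> Z)"
    using Z by auto
  moreover have "f -` X \<inter> space M - Z \<in> sets (completion M)"
    using measurable_sets[OF f X] Z by (intro sets_completionI_sets) auto
  moreover have "g -` X \<inter> space M \<inter> Z \<in> sets (completion M)"
    using Z(1) by (rule null_sets_completion) auto
  ultimately show "g -` X \<inter> space (completion M) \<in> sets (completion M)"
    by (metis sets.Un)
qed (use g in auto)

context poisson_strip
begin

definition up_proc :: "'w \<Rightarrow> real \<Rightarrow> ennreal" where
  "up_proc \<omega> = (\<lambda>s\<in>unit_rats. low (Xi \<omega>) (up_left s))"

definition down_proc :: "'w \<Rightarrow> real \<Rightarrow> ennreal" where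
  "down_proc \<omega> = (\<lambda>s\<in>unit_rats. low (Xi \<omega>) (down_left s))"

lemma measurable_up_proc: "up_proc \<in> void_sigma (up_left 1) \<rightarrow>\<^sub>M PiM unit_rats (\<lambda>_. borel)"
  unfolding up_proc_def
  by (intro measurable_restrict measurable_void_sigma_mono[OF _ measurable_low_up])
    (auto simp: unit_rats_def up_left_def)

lemma measurable_down_proc: "down_proc \<in> void_sigma (down_left 1) \<rightarrow>\<^sub>M PiM unit_rats (\<lambda>_. borel)"
  unfolding down_proc_def
  by (intro measurable_restrict measurable_void_sigma_mono[OF _ measurable_low_down])
    (auto simp: unit_rats_def down_left_def)

lemma measurable_procs [measurable]:
  "up_proc \<in> M \<rightarrow>\<^sub>M PiM unit_rats (\<lambda>_. borel)" "down_proc \<in> M \<rightarrow>\<^sub>M PiM unit_rats (\<lambda>_. borel)"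
  by (rule measurable_void_sigma[OF measurable_up_proc] measurable_void_sigma[OF measurable_down_proc])+

lemma measurable_record_path_restrict [measurable]:
  "(\<lambda>\<sigma>. \<lambda>s\<in>unit_rats. record_path \<sigma> s) \<in> exp_unif_seq \<rightarrow>\<^sub>M PiM unit_rats (\<lambda>_. borel)"
  by (intro measurable_restrict borel_measurable_record_path)

text \<open>It suffices to compare upper tails at finitely many times. Both of them are the event
  that the same union of rectangles is avoided, by the atoms on one side and by the model records on
  the other, and both have probability \<open>exp (- area 1 0)\<close>.\<close>

lemma distr_down_proc:
  "distr M (PiM unit_rats (\<lambda>_. borel)) down_proc = distr exp_unif_seq (PiM unit_rats (\<lambda>_. borel)) (\<lambda>\<sigma>. \<lambda>s\<in>unit_rats. record_path \<sigma> s)"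
proof (rule measure_eqI_PiM_ennreal_tails)
  show "finite_measure (distr M (PiM unit_rats (\<lambda>_. borel)) down_proc)"
    by (intro finite_measure_distr) simp
  fix J and h :: "real \<Rightarrow> real"
  assume J: "finite J" "J \<subseteq> unit_rats" and h: "\<And>s. 0 \<le> h s"
  interpret corner_heights J h
    using J h by unfold_locales (auto simp: unit_rats_def)
  let ?P = "PiM unit_rats (\<lambda>_. borel) :: (real \<Rightarrow> ennreal) measure"
  let ?E = "{x \<in> space ?P. \<forall>i\<in>J. ennreal (h i) \<le> x i}"
  let ?Z = "\<Union>s\<in>J. {0..<s} \<times> {- h s<..0}"
  have E: "?E \<in> sets ?P"
  proof (rule sets.sets_Collect_finite_All[OF _ J(1)])
    fix i assume "i \<in> J"
    then have [measurable]: "(\<lambda>x. x i) \<in> borel_measurable ?P"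
      using J by (intro measurable_component_singleton) auto
    show "{x \<in> space ?P. ennreal (h i) \<le> x i} \<in> sets ?P"
      by measurable
  qed
  have Z: "region ?Z"
    unfolding region_def
  proof (intro conjI)
    show "?Z \<in> sets borel"
      using J by (intro sets.finite_UN) (auto simp: borel_prod[symmetric])
    show "bounded ?Z"
      using J by (auto intro!: bounded_Times)
    show "?Z \<subseteq> strip"
      using J_unit by (force simp: strip_def)
  qed
  have "emeasure (distr M ?P down_proc) ?E = emeasure M (void ?Z)"
  proof -
    have "down_proc -` ?E \<inter> space M = void ?Z"
    proof -
      have "(\<forall>i\<in>J. ennreal (h i) \<le> down_proc \<omega> i) \<longleftrightarrow> Xi \<omega> \<inter> ?Z = {}" for \<omega>
      proof -
        have "{0..<s} \<times> {- h s<..0} = down_left s \<inter> {p. \<bar>snd p\<bar> < h s}" for s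
          by (auto simp: down_left_def)
        moreover have "down_proc \<omega> i = low (Xi \<omega>) (down_left i)" if "i \<in> J" for i
          using that J by (auto simp: down_proc_def)
        ultimately show ?thesis
          by (auto simp: le_low_iff)
      qed
      then show ?thesis
        using measurable_space[OF measurable_procs(2)] by (auto simp: void_def)
    qed
    then show ?thesis using E by (simp add: emeasure_distr)
  qed
  also have "\<dots> = ennreal (exp (- area 1 0))"
    unfolding emeasure_eq_measure prob_void[OF Z] using emeasure_lborel_corners area_nonneg[of 1 0]
    by (simp add: measure_def)
  also have "\<dots> = emeasure exp_unif_seq {\<sigma>. \<forall>s\<in>J. ennreal (h s) \<le> record_path \<sigma> s}"
    by (rule emeasure_record_path_tails[symmetric])
  also have "{\<sigma>. \<forall>s\<in>J. ennreal (h s) \<le> record_path \<sigma> s} = (\<lambda>\<sigma>. \<lambda>s\<in>unit_rats. record_path \<sigma> s) -` ?E \<inter> space exp_unif_seq"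
    using J by (auto simp: space_PiM subset_iff)
  also have "emeasure exp_unif_seq \<dots> = emeasure (distr exp_unif_seq ?P (\<lambda>\<sigma>. \<lambda>s\<in>unit_rats. record_path \<sigma> s)) ?E"
    using E by (simp add: emeasure_distr)
  finally show "emeasure (distr M ?P down_proc) ?E = emeasure (distr exp_unif_seq ?P (\<lambda>\<sigma>. \<lambda>s\<in>unit_rats. record_path \<sigma> s)) ?E" .
qed simp_all

text \<open>Independence allows the lower half to be replaced by the model while the upper half
  remains a functional of the configuration. The halves meet only in a segment of the axis, which is
  null.\<close>

lemma nn_integral_procs:
  assumes [measurable]: "f \<in> borel_measurable (PiM unit_rats (\<lambda>_. borel) \<Otimes>\<^sub>M PiM unit_rats (\<lambda>_. borel))"
  shows "(\<integral>\<^sup>+\<omega>. f (down_proc \<omega>, up_proc \<omega>) \<partial>M) = (\<integral>\<^sup>+\<sigma>. \<integral>\<^sup>+\<omega>. f (\<lambda>s\<in>unit_rats. record_path \<sigma> s, up_proc \<omega>) \<partial>M \<partial>exp_unif_seq)"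
proof -
  have null: "down_left 1 \<inter> up_left 1 \<in> null_sets lborel"
  proof -
    have "down_left 1 \<inter> up_left 1 = {0..<1} \<times> {0}"
      by (auto simp: down_left_def up_left_def)
    moreover have "emeasure lborel ({0..<1::real} \<times> {0::real}) = 0"
      by (simp add: emeasure_lborel_Times)
    moreover have "{0..<1::real} \<times> {0::real} \<in> sets borel"
      by (simp add: borel_prod[symmetric])
    ultimately show ?thesis
      by (simp add: null_sets_def)
  qed
  have "(\<integral>\<^sup>+\<omega>. f (down_proc \<omega>, up_proc \<omega>) \<partial>M) =
     (\<integral>\<^sup>+y. \<integral>\<^sup>+\<omega>. f (y, up_proc \<omega>) \<partial>M \<partial>distr M (PiM unit_rats (\<lambda>_. borel)) down_proc)"
    by (rule nn_integral_indep[OF null measurable_down_proc measurable_up_proc]) simp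
  also have "\<dots> = (\<integral>\<^sup>+\<sigma>. \<integral>\<^sup>+\<omega>. f (\<lambda>s\<in>unit_rats. record_path \<sigma> s, up_proc \<omega>) \<partial>M \<partial>exp_unif_seq)"
    unfolding distr_down_proc by (rule nn_integral_distr) measurable
  finally show ?thesis .
qed

section \<open>Almost sure regularity of the configuration\<close>

lemma AE_no_boundary_points: "AE \<omega> in M. \<forall>p\<in>Xi \<omega>. 0 < fst p \<and> fst p < 1"
proof -
  have "AE \<omega> in M. Xi \<omega> \<inter> {c} \<times> {- real n..real n} = {}" if c: "c \<in> {0, 1}" for c :: real and n :: nat
  proof -
    \<comment> \<open>A vertical segment has area 0, so its void probability is 1. Cutting the line
      at height \<open>n\<close> is needed because regions are bounded.\<close>
    have Z: "region ({c} \<times> {- real n..real n})"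
      using c by (auto simp: region_def strip_def borel_prod[symmetric] intro!: bounded_Times)
    have "measure lborel ({c} \<times> {- real n..real n}) = 0"
      by (simp add: measure_def emeasure_lborel_Times)
    then have "prob (void ({c} \<times> {- real n..real n})) = 1"
      using prob_void[OF Z] by simp
    then have "AE \<omega> in M. \<omega> \<in> void ({c} \<times> {- real n..real n})"
      using prob_eq_1[OF void_events[OF Z]] by simp
    then show ?thesis by eventually_elim (simp add: void_def)
  qed
  then have "AE \<omega> in M. \<forall>n::nat. \<forall>c\<in>{0, 1::real}. Xi \<omega> \<inter> {c} \<times> {- real n..real n} = {}"
    unfolding AE_all_countable by (intro allI AE_finite_allI) simp_all
  then show ?thesis
    using AE_space
  proof eventually_elim
    case (elim \<omega>)
    show ?case
    proof
      fix p assume p: "p \<in> Xi \<omega>"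
      obtain n :: nat where n: "\<bar>snd p\<bar> \<le> real n" using real_arch_simple by blast
      have "fst p \<noteq> c" if "c \<in> {0, 1}" for c
      proof
        assume "fst p = c"
        then have "p \<in> Xi \<omega> \<inter> {c} \<times> {- real n..real n}" using p n by (auto simp: mem_Times_iff)
        then show False using elim that by blast
      qed
      moreover have "0 \<le> fst p \<and> fst p \<le> 1"
        using p Xi_strip[OF elim(2)] by (auto simp: strip_def)
      ultimately show "0 < fst p \<and> fst p < 1"
        by (metis insertI1 insertI2 order_le_less singletonI)
    qed
  qed
qed

text \<open>With area \<open>a\<close> the probability is \<open>1 - (1 + a) exp (- a)\<close>, and
  \<open>exp (- a) \<ge> 1 - a\<close>. The bound is quadratic, so a union bound over
  \<open>m\<close> columns of area proportional to \<open>1 / m\<close> tends to 0.\<close>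

lemma prob_two_points_le:
  assumes Z: "region Z"
  shows "prob {\<omega> \<in> space M. 2 \<le> card (Xi \<omega> \<inter> Z)} \<le> (measure lborel Z)\<^sup>2"
proof -
  let ?a = "measure lborel Z" and ?C = "\<lambda>k. {\<omega> \<in> space M. card (Xi \<omega> \<inter> Z) = k}"
  note [measurable] = count_measurable[OF Z]
  have C: "?C k \<in> events" for k
    by measurable
  have "{\<omega> \<in> space M. 2 \<le> card (Xi \<omega> \<inter> Z)} = space M - (?C 0 \<union> ?C 1)"
    by auto
  then have "prob {\<omega> \<in> space M. 2 \<le> card (Xi \<omega> \<inter> Z)} = 1 - prob (?C 0 \<union> ?C 1)"
    using prob_compl[of "?C 0 \<union> ?C 1"] sets.Un[OF C C] by (simp only:)
  also have "prob (?C 0 \<union> ?C 1) = prob (?C 0) + prob (?C 1)"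
    by (rule finite_measure_Union[OF C C]) auto
  also have "1 - (prob (?C 0) + prob (?C 1)) = 1 - (1 + ?a) * exp (- ?a)"
    using prob_count[OF Z, of 0] prob_count[OF Z, of 1] by (simp add: algebra_simps)
  also have "\<dots> \<le> 1 - (1 + ?a) * (1 - ?a)"
    using exp_ge_add_one_self[of "- ?a"] by (intro diff_left_mono mult_left_mono) auto
  also have "\<dots> = ?a\<^sup>2" by (simp add: algebra_simps power2_eq_square)
  finally show ?thesis .
qed

text \<open>Two atoms of height at most \<open>n\<close> on one vertical line share a column in
  every division of the strip into \<open>m\<close> columns. The probability that some column holds
  two atoms is at most \<open>m (2 n / m)^2 = 4 n^2 / m\<close>, which vanishes as \<open>m\<close>
  grows.\<close>

lemma AE_inj_fst: "AE \<omega> in M. inj_on fst (Xi \<omega>)"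
proof -
  define col where "col m n j = {real j / real m..<(real j + 1) / real m} \<times> {- real n..real n}" for m n j :: nat
  define E where "E m n = (\<Union>j<m. {\<omega> \<in> space M. 2 \<le> card (Xi \<omega> \<inter> col m n j)})" for m n :: nat
  have region: "region (col m n j)" if "j < m" for m n j
  proof -
    have "(real j + 1) / real m \<le> 1" "0 \<le> real j / real m" using that by simp_all
    then have "{real j / real m..<(real j + 1) / real m} \<subseteq> {0..1}"
      unfolding subset_iff atLeastLessThan_iff atLeastAtMost_iff by (meson less_imp_le order_trans)
    then have "col m n j \<subseteq> strip"
      by (auto simp: col_def strip_def)
    then show ?thesis
      unfolding region_def col_def by (auto simp: borel_prod[symmetric] intro!: bounded_Times)
  qed
  have events [measurable]: "{\<omega> \<in> space M. 2 \<le> card (Xi \<omega> \<inter> col m n j)} \<in> events" if "j < m" for m n j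
    using count_measurable[OF region[OF that]] by measurable
  have E_events [measurable]: "E m n \<in> events" for m n
    unfolding E_def by (rule sets.finite_UN) (simp_all add: events)
  have E_le: "prob (E m n) \<le> 4 * (real n)\<^sup>2 / real m" if "0 < m" for m n
  proof -
    have area: "measure lborel (col m n j) = 2 * real n / real m" for j
    proof -
      have "emeasure lborel {real j / real m..<(real j + 1) / real m} = ennreal ((real j + 1) / real m - real j / real m)"
        by (rule emeasure_lborel_Ico) (simp add: divide_right_mono)
      also have "(real j + 1) / real m - real j / real m = 1 / real m"
        by (simp add: diff_divide_distrib[symmetric])
      finally have "emeasure lborel (col m n j) = ennreal (1 / real m) * ennreal (2 * real n)"
        unfolding col_def by (subst emeasure_lborel_Times) simp_all
      also have "\<dots> = ennreal (2 * real n / real m)"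
        by (subst ennreal_mult[symmetric]) simp_all
      finally show ?thesis by (simp add: measure_def)
    qed
    have "prob (E m n) \<le> (\<Sum>j<m. prob {\<omega> \<in> space M. 2 \<le> card (Xi \<omega> \<inter> col m n j)})"
      unfolding E_def by (rule finite_measure_subadditive_finite) (auto simp: events)
    also have "\<dots> \<le> (\<Sum>j<m. (2 * real n / real m)\<^sup>2)"
    proof (rule sum_mono)
      fix j assume "j \<in> {..<m}"
      then have "j < m" by simp
      from prob_two_points_le[OF region[OF this], of n]
      show "prob {\<omega> \<in> space M. 2 \<le> card (Xi \<omega> \<inter> col m n j)} \<le> (2 * real n / real m)\<^sup>2"
        unfolding area .
    qed
    also have "\<dots> = 4 * (real n)\<^sup>2 / real m"
      using that by (simp add: power2_eq_square)
    finally show ?thesis .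
  qed
  have "AE \<omega> in M. \<exists>m>0. \<omega> \<notin> E m n" for n
  proof -
    have "prob (\<Inter>m\<in>{0<..}. E m n) \<le> 4 * (real n)\<^sup>2 / real m" if "0 < m" for m
      using that by (intro order_trans[OF finite_measure_mono E_le]) auto
    moreover have "(\<lambda>m. 4 * (real n)\<^sup>2 / real m) \<longlonglongrightarrow> 0"
      by (rule lim_const_over_n)
    ultimately have "prob (\<Inter>m\<in>{0<..}. E m n) \<le> 0"
      by (intro LIMSEQ_le_const) (auto intro!: exI[of _ 1])
    then have "prob (\<Inter>m\<in>{0<..}. E m n) = 0"
      by (simp add: measure_le_0_iff)
    moreover have "(\<Inter>m\<in>{0<..}. E m n) \<in> events"
      by (intro sets.countable_INT') auto
    ultimately have "AE \<omega> in M. \<omega> \<notin> (\<Inter>m\<in>{0<..}. E m n)"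
      by (simp add: prob_eq_0)
    then show ?thesis by eventually_elim auto
  qed
  then have "AE \<omega> in M. \<forall>n. \<exists>m>0. \<omega> \<notin> E m n"
    unfolding AE_all_countable by blast
  then show ?thesis
    using AE_no_boundary_points AE_space
  proof eventually_elim
    case (elim \<omega>)
    show ?case
    proof (rule inj_onI, rule ccontr)
      fix p q assume pq: "p \<in> Xi \<omega>" "q \<in> Xi \<omega>" "fst p = fst q" "p \<noteq> q"
      obtain n :: nat where n: "max \<bar>snd p\<bar> \<bar>snd q\<bar> \<le> real n" using real_arch_simple by blast
      obtain m where m: "0 < m" "\<omega> \<notin> E m n" using elim(1) by blast
      \<comment> \<open>Index of the column of width \<open>1 / m\<close> that contains the common
        abscissa.\<close>
      define j where "j = nat \<lfloor>fst p * real m\<rfloor>"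
      have fst_p: "0 < fst p" "fst p < 1" using elim pq by auto
      then have "real j = of_int \<lfloor>fst p * real m\<rfloor>" using m by (simp add: j_def)
      then have j: "real j \<le> fst p * real m" "fst p * real m < real j + 1"
        by linarith+
      have "fst p * real m < real m" using fst_p m by simp
      then have "j < m" using j by linarith
      have "{p, q} \<subseteq> Xi \<omega> \<inter> col m n j"
        using pq n j m by (auto simp: col_def mem_Times_iff field_simps)
      moreover have "finite (Xi \<omega> \<inter> col m n j)"
        using finite_Xi[OF elim(3)] region[OF \<open>j < m\<close>] by (auto simp: region_def)
      ultimately have "card {p, q} \<le> card (Xi \<omega> \<inter> col m n j)"
        by (intro card_mono)
      then have "\<omega> \<in> E m n"
        unfolding E_def using pq(4) \<open>j < m\<close> elim(3) by (intro UN_I[of j]) simp_all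
      with m show False by simp
    qed
  qed
qed

text \<open>Atoms near the left edge exist because the nearest heights over the columns of width
  \<open>1 / (n + 1)\<close> are almost surely finite; countably many columns suffice for all
  \<open>t\<close>.\<close>

lemma AE_good_config: "AE \<omega> in M. good_config (Xi \<omega>)"
proof -
  have "AE \<omega> in M. \<forall>n::nat. low (Xi \<omega>) (up_left (1 / real (Suc n))) \<noteq> \<top>"
    unfolding AE_all_countable
  proof
    fix n :: nat
    show "AE \<omega> in M. low (Xi \<omega>) (up_left (1 / real (Suc n))) \<noteq> \<top>"
      unfolding up_left_def using up_column[of 0 "1 / real (Suc n)"]
      by (intro AE_low_finite[of _ "1 / real (Suc n)"]) auto
  qed
  moreover have "AE \<omega> in M. \<forall>n::nat. low (Xi \<omega>) (down_left (1 / real (Suc n))) \<noteq> \<top>"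
    unfolding AE_all_countable
  proof
    fix n :: nat
    show "AE \<omega> in M. low (Xi \<omega>) (down_left (1 / real (Suc n))) \<noteq> \<top>"
      unfolding down_left_def using down_column[of 0 "1 / real (Suc n)"]
      by (intro AE_low_finite[of _ "1 / real (Suc n)"]) auto
  qed
  ultimately show ?thesis
    using AE_no_boundary_points AE_inj_fst AE_space
  proof eventually_elim
    case (elim \<omega>)
    show ?case
    proof
      fix t :: real assume t: "0 < t"
      obtain n where n: "1 / real (Suc n) < t"
        using reals_Archimedean[OF t] by (auto simp: inverse_eq_divide)
      have "Xi \<omega> \<inter> up_left (1 / real (Suc n)) \<noteq> {}" "Xi \<omega> \<inter> down_left (1 / real (Suc n)) \<noteq> {}"
        using elim(1,2) by (auto simp: low_def simp del: of_nat_Suc)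
      moreover have "up_left (1 / real (Suc n)) \<subseteq> up_left t" "down_left (1 / real (Suc n)) \<subseteq> down_left t"
        using n by (auto simp: up_left_def down_left_def simp del: of_nat_Suc)
      ultimately show "Xi \<omega> \<inter> up_left t \<noteq> {}" "Xi \<omega> \<inter> down_left t \<noteq> {}"
        by blast+
    qed (use elim finite_Xi in auto)
  qed
qed

end

section \<open>The law of the corange areas\<close>

lemma borel_measurable_corange_of_paths [measurable (raw)]:
  assumes [measurable]: "x \<in> N \<rightarrow>\<^sub>M PiM unit_rats (\<lambda>_. borel)" "y \<in> N \<rightarrow>\<^sub>M PiM unit_rats (\<lambda>_. borel)"
  shows "(\<lambda>w. corange_of_paths (x w) (y w) k) \<in> borel_measurable N"
  unfolding corange_of_paths_def by measurable

lemma corange_of_paths_cong: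
  assumes "\<And>s. s \<in> unit_rats \<Longrightarrow> x s = x' s" "\<And>s. s \<in> unit_rats \<Longrightarrow> y s = y' s"
  shows "corange_of_paths x y k = corange_of_paths x' y' k"
  unfolding corange_of_paths_def using value_left_of_cong[of x x'] value_left_of_cong[of y y'] jump_time_cong[of y y'] assms by simp

context poisson_strip
begin

text \<open>The lower half is replaced by the model, the upper half is integrated out for fixed
  records, and the records are averaged last. The initial height F(1) remains as an extra standard
  exponential, which accounts for the additional summand in
  \<open>rec_height \<sigma> (Suc (Suc i))\<close>.\<close>

lemma nn_integral_corange_of_paths:
  assumes A: "\<And>i. A i \<in> sets borel"
  shows "(\<integral>\<^sup>+\<omega>. (\<Prod>i<n. indicator (A i) (corange_of_paths (up_proc \<omega>) (down_proc \<omega>) (Suc i))) \<partial>M) =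
    (\<integral>\<^sup>+\<sigma>. (\<Prod>i<n. indicator (A i) ((1 - rec_x \<sigma> (Suc i)) * rec_height \<sigma> (Suc (Suc i)))) \<partial>exp_unif_seq)"
proof -
  note [measurable] = A
  define fs :: "(real \<Rightarrow> real \<Rightarrow> ennreal) list"
    where "fs = map (\<lambda>i t s. indicator (A i) ((1 - t) * s)) [0..<n]"
  have len: "length fs = n" and nth: "\<And>i. i < n \<Longrightarrow> fs ! i = (\<lambda>t s. indicator (A i) ((1 - t) * s))"
    by (simp_all add: fs_def)
  have fs: "\<forall>f\<in>set fs. case_prod f \<in> borel_measurable (borel \<Otimes>\<^sub>M borel)"
    by (auto simp: fs_def)
  have fs1: "\<forall>f\<in>set ((\<lambda>_ _. 1) # fs). case_prod f \<in> borel_measurable (borel \<Otimes>\<^sub>M borel)"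
    using fs by (auto simp: split_beta')
  define \<Theta> :: "(real \<Rightarrow> ennreal) \<times> (real \<Rightarrow> ennreal) \<Rightarrow> ennreal"
    where "\<Theta> p = (\<Prod>i<n. indicator (A i) (corange_of_paths (snd p) (fst p) (Suc i)))" for p
  have [measurable]: "\<Theta> \<in> borel_measurable (PiM unit_rats (\<lambda>_. borel) \<Otimes>\<^sub>M PiM unit_rats (\<lambda>_. borel))"
    unfolding \<Theta>_def by measurable
  have "(\<integral>\<^sup>+\<omega>. (\<Prod>i<n. indicator (A i) (corange_of_paths (up_proc \<omega>) (down_proc \<omega>) (Suc i))) \<partial>M) =
    (\<integral>\<^sup>+\<sigma>. \<integral>\<^sup>+\<omega>. \<Theta> (\<lambda>s\<in>unit_rats. record_path \<sigma> s, up_proc \<omega>) \<partial>M \<partial>exp_unif_seq)"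
    using nn_integral_procs[of \<Theta>] by (simp add: \<Theta>_def)
  also have "\<dots> = (\<integral>\<^sup>+\<sigma>. \<integral>\<^sup>+m. chain_value fs 1 0 m \<sigma> \<partial>std_exp \<partial>exp_unif_seq)"
  proof (rule nn_integral_cong_AE, use AE_exp_unif_seq in eventually_elim)
    fix \<sigma> :: "nat \<Rightarrow> real \<times> real"
    assume \<sigma>: "\<forall>i. 0 < fst (\<sigma> i) \<and> 0 < snd (\<sigma> i) \<and> snd (\<sigma> i) < 1"
    have T: "0 < rec_x \<sigma> k" "rec_x \<sigma> k \<le> 1" for k
      unfolding rec_x_def using \<sigma> prod_le_1[of "{..<k}" "\<lambda>i. snd (\<sigma> i)"] by (auto intro!: prod_pos simp: less_imp_le)
    have g: "0 \<le> rec_height \<sigma> k" for k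
      unfolding rec_height_def using \<sigma> T by (intro sum_nonneg divide_nonneg_nonneg less_imp_le) auto
    have corange_of_paths: "corange_of_paths (up_proc \<omega>) (\<lambda>s\<in>unit_rats. record_path \<sigma> s) (Suc i) =
        (1 - rec_x \<sigma> (Suc i)) * (rec_height \<sigma> (Suc i) + enn2real (low (Xi \<omega>) (up_left (rec_x \<sigma> (Suc i)))))" for \<omega> i
    proof -
      have "corange_of_paths (up_proc \<omega>) (\<lambda>s\<in>unit_rats. record_path \<sigma> s) (Suc i) =
          corange_of_paths (\<lambda>s. low (Xi \<omega>) (up_left s)) (record_path \<sigma>) (Suc i)"
        by (rule corange_of_paths_cong) (simp_all add: up_proc_def)
      then show ?thesis
        unfolding corange_of_paths_def record_path_reconstruction[OF \<sigma>] up_left_def value_left_of_low[OF T(2)]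
        using g[of "Suc i"] by (simp add: record_path_reconstruction[OF \<sigma>] add.commute)
    qed
    have "(\<integral>\<^sup>+\<omega>. \<Theta> (\<lambda>s\<in>unit_rats. record_path \<sigma> s, up_proc \<omega>) \<partial>M) = (\<integral>\<^sup>+\<omega>. (\<lambda>_. 1) (enn2real (low (Xi \<omega>) (up_left 1))) * corange_prod fs 1 0 \<sigma> (Xi \<omega>) \<partial>M)"
      unfolding \<Theta>_def corange_prod_eq_prod len by (intro nn_integral_cong) (simp add: nth corange_of_paths)
    also have "\<dots> = (\<integral>\<^sup>+m. 1 * chain_value fs 1 0 (m / 1) \<sigma> \<partial>std_exp)"
      by (rule nn_integral_corange_prod[OF fs]) (use \<sigma> in auto)
    finally show "(\<integral>\<^sup>+\<omega>. \<Theta> (\<lambda>s\<in>unit_rats. record_path \<sigma> s, up_proc \<omega>) \<partial>M) = (\<integral>\<^sup>+m. chain_value fs 1 0 m \<sigma> \<partial>std_exp)"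
      by simp
  qed
  also have "\<dots> = (\<integral>\<^sup>+m. \<integral>\<^sup>+\<sigma>. chain_value fs 1 0 m \<sigma> \<partial>exp_unif_seq \<partial>std_exp)"
  proof -
    interpret pair_sigma_finite std_exp exp_unif_seq ..
    have "(\<lambda>(m, \<sigma>). chain_value fs 1 0 m \<sigma>) \<in> borel_measurable (std_exp \<Otimes>\<^sub>M exp_unif_seq)"
      unfolding split_beta' by (rule borel_measurable_chain_value[OF fs]) simp_all
    then show ?thesis by (rule Fubini')
  qed
  also have "\<dots> = (\<integral>\<^sup>+m. \<integral>\<^sup>+u. path_value fs u m \<partial>unif \<partial>std_exp)"
    by (simp add: nn_integral_chain_value[OF fs])
  \<comment> \<open>The constant test function only inserts a first step: its exponential is F(1) in
    the role of E_1, and its uniform variable is the leading \<open>u\<close>.\<close>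
  also have "\<dots> = path_value ((\<lambda>_ _. 1) # fs) 1 0"
  proof -
    have "(\<lambda>z. path_value fs (snd z) (fst z)) \<in> borel_measurable (borel \<Otimes>\<^sub>M borel)"
      by (rule borel_measurable_path_value[OF fs]) simp_all
    from nn_integral_exp_unif(1)[OF this] show ?thesis by simp
  qed
  also have "\<dots> = (\<integral>\<^sup>+\<sigma>. (\<Prod>i<n. indicator (A i) ((1 - rec_x \<sigma> (Suc i)) * rec_height \<sigma> (Suc (Suc i)))) \<partial>exp_unif_seq)"
    unfolding path_value_eq_prod[OF fs1] length_Cons prod.lessThan_Suc_shift len
    by (simp add: nth)
  finally show ?thesis .
qed

end

text \<open>A cylinder over an arbitrary finite index set is written as a product over an initial
  segment, with \<open>UNIV\<close> at the absent indices, to match the form in which the test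
  integrals are computed. Indices start at 1, hence \<open>Suc i\<close>.\<close>

lemma emeasure_distr_prod_emb:
  fixes c :: "'w \<Rightarrow> nat \<Rightarrow> real"
  assumes c: "\<And>k. 1 \<le> k \<Longrightarrow> (\<lambda>\<omega>. c \<omega> k) \<in> borel_measurable M"
    and J: "finite J" "J \<subseteq> {k. 1 \<le> k}" "J \<subseteq> {..n}" and A: "\<And>i. i \<in> J \<Longrightarrow> A i \<in> sets borel"
  shows "emeasure (distr M (PiM {k. 1 \<le> k} (\<lambda>_. borel)) (\<lambda>\<omega>. \<lambda>k\<in>{k. 1 \<le> k}. c \<omega> k))
      (prod_emb {k. 1 \<le> k} (\<lambda>_. borel) J (PiE J A)) =
    (\<integral>\<^sup>+\<omega>. (\<Prod>i<n. indicator (if Suc i \<in> J then A (Suc i) else UNIV) (c \<omega> (Suc i))) \<partial>M)"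
proof -
  let ?P = "PiM {k. 1 \<le> k} (\<lambda>_. borel) :: (nat \<Rightarrow> real) measure"
  let ?X = "\<lambda>\<omega>. \<lambda>k\<in>{k. 1 \<le> k}. c \<omega> k"
  let ?E = "prod_emb {k. 1 \<le> k} (\<lambda>_. borel :: real measure) J (PiE J A)"
  have X: "?X \<in> M \<rightarrow>\<^sub>M ?P"
    using c by (intro measurable_restrict) auto
  have E: "?E \<in> sets ?P"
    using J A by (intro sets_PiM_I) auto
  have "emeasure (distr M ?P ?X) ?E = (\<integral>\<^sup>+\<omega>. indicator (?X -` ?E \<inter> space M) \<omega> \<partial>M)"
    using X E by (simp add: emeasure_distr measurable_sets)
  also have "\<dots> = (\<integral>\<^sup>+\<omega>. (\<Prod>i<n. indicator (if Suc i \<in> J then A (Suc i) else UNIV) (c \<omega> (Suc i))) \<partial>M)"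
  proof (intro nn_integral_cong)
    fix \<omega> assume \<omega>: "\<omega> \<in> space M"
    have mem: "\<omega> \<in> ?X -` ?E \<inter> space M \<longleftrightarrow> (\<forall>k\<in>J. c \<omega> k \<in> A k)"
      using \<omega> J(2) by (auto simp: prod_emb_def PiE_iff subset_iff)
    show "(indicator (?X -` ?E \<inter> space M) \<omega> :: ennreal) =
        (\<Prod>i<n. indicator (if Suc i \<in> J then A (Suc i) else UNIV) (c \<omega> (Suc i)))"
    proof (cases "\<forall>k\<in>J. c \<omega> k \<in> A k")
      case True
      then have "(\<Prod>i<n. indicator (if Suc i \<in> J then A (Suc i) else UNIV) (c \<omega> (Suc i))) = (1 :: ennreal)"
        by (intro prod.neutral) auto
      then show ?thesis using True mem by (simp add: indicator_def)
    next
      case False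
      then obtain k where k: "k \<in> J" "c \<omega> k \<notin> A k" by blast
      then obtain i where i: "k = Suc i" "i < n"
        using J(2,3) by (cases k) auto
      then have "(\<Prod>i<n. indicator (if Suc i \<in> J then A (Suc i) else UNIV) (c \<omega> (Suc i))) = (0 :: ennreal)"
        using k by (intro prod_zero) (auto intro!: bexI[of _ i])
      moreover have "\<omega> \<notin> ?X -` ?E \<inter> space M" using False mem by blast
      ultimately show ?thesis by (rule trans[OF indicator_simps(2) sym, rotated])
    qed
  qed
  finally show ?thesis .
qed

lemma distr_PiM_eqI:
  fixes c :: "'w \<Rightarrow> nat \<Rightarrow> real" and d :: "'v \<Rightarrow> nat \<Rightarrow> real"
  assumes "finite_measure M"
    and c: "\<And>k. 1 \<le> k \<Longrightarrow> (\<lambda>\<omega>. c \<omega> k) \<in> borel_measurable M"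
    and d: "\<And>k. 1 \<le> k \<Longrightarrow> (\<lambda>\<omega>. d \<omega> k) \<in> borel_measurable N"
    and eq: "\<And>n A. (\<And>i. A i \<in> sets borel) \<Longrightarrow>
      (\<integral>\<^sup>+\<omega>. (\<Prod>i<n. indicator (A i) (c \<omega> (Suc i))) \<partial>M) = (\<integral>\<^sup>+v. (\<Prod>i<n. indicator (A i) (d v (Suc i))) \<partial>N)"
  shows "distr M (PiM {k. 1 \<le> k} (\<lambda>_. borel)) (\<lambda>\<omega>. \<lambda>k\<in>{k. 1 \<le> k}. c \<omega> k) =
    distr N (PiM {k. 1 \<le> k} (\<lambda>_. borel)) (\<lambda>v. \<lambda>k\<in>{k. 1 \<le> k}. d v k)"
proof (rule measure_eqI_PiM_infinite)
  show "finite_measure (distr M (PiM {k. 1 \<le> k} (\<lambda>_. borel)) (\<lambda>\<omega>. \<lambda>k\<in>{k. 1 \<le> k}. c \<omega> k))"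
    using c by (intro finite_measure.finite_measure_distr assms(1) measurable_restrict) auto
  fix A :: "nat \<Rightarrow> real set" and J :: "nat set"
  assume J: "finite J" "J \<subseteq> {k. 1 \<le> k}" and A: "\<And>i. i \<in> J \<Longrightarrow> A i \<in> sets borel"
  obtain n where n: "J \<subseteq> {..n}" using finite_nat_iff_bounded_le J(1) by blast
  show "emeasure (distr M (PiM {k. 1 \<le> k} (\<lambda>_. borel)) (\<lambda>\<omega>. \<lambda>k\<in>{k. 1 \<le> k}. c \<omega> k)) (prod_emb {k. 1 \<le> k} (\<lambda>_. borel) J (PiE J A)) =
    emeasure (distr N (PiM {k. 1 \<le> k} (\<lambda>_. borel)) (\<lambda>v. \<lambda>k\<in>{k. 1 \<le> k}. d v k)) (prod_emb {k. 1 \<le> k} (\<lambda>_. borel) J (PiE J A))"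
    by (rule trans[OF emeasure_distr_prod_emb[OF c J n A] trans[OF eq emeasure_distr_prod_emb[OF d J n A, symmetric]]])
      (simp_all add: A)
qed simp_all

text \<open>On good configurations the areas are functionals of the two rational-time paths, and the
  remaining ones form a null set, so passing to the completion leaves the law of these functionals
  unchanged.\<close>

lemma (in poisson_strip) distr_corange_area:
  "distr (completion M) (PiM {k. 1 \<le> k} (\<lambda>_. borel)) (\<lambda>\<omega>. \<lambda>k\<in>{k. 1 \<le> k}. corange_area (Xi \<omega>) k) =
   distr exp_unif_seq (PiM {k. 1 \<le> k} (\<lambda>_. borel)) (\<lambda>\<sigma>. \<lambda>k\<in>{k. 1 \<le> k}. (1 - rec_x \<sigma> k) * rec_height \<sigma> (Suc k))"
proof -
  let ?P = "PiM {k. 1 \<le> k} (\<lambda>_. borel) :: (nat \<Rightarrow> real) measure"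
  let ?C = "\<lambda>\<omega>. \<lambda>k\<in>{k. 1 \<le> k}. corange_area (Xi \<omega>) k"
  let ?D = "\<lambda>\<omega>. \<lambda>k\<in>{k. 1 \<le> k}. corange_of_paths (up_proc \<omega>) (down_proc \<omega>) k"
  have D: "?D \<in> M \<rightarrow>\<^sub>M ?P"
    by (intro measurable_restrict) measurable
  have ae: "AE \<omega> in M. ?D \<omega> = ?C \<omega>"
    using AE_good_config
  proof eventually_elim
    case (elim \<omega>)
    then interpret good_config "Xi \<omega>" .
    have "corange_of_paths (up_proc \<omega>) (down_proc \<omega>) k = corange_area (Xi \<omega>) k" if "1 \<le> k" for k
      unfolding corange_area_eq_corange_of_paths[OF that]
      by (rule corange_of_paths_cong) (simp_all add: up_proc_def down_proc_def)
    then show ?case by auto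
  qed
  have C: "?C \<in> completion M \<rightarrow>\<^sub>M ?P"
    by (rule measurable_completion_AE[OF D ae]) (auto simp: space_PiM)
  have "distr (completion M) ?P ?C = distr (completion M) ?P ?D"
    by (rule distr_cong_AE) (use AE_completion[OF ae] C measurable_completion[OF D] in \<open>auto elim: eventually_mono\<close>)
  also have "\<dots> = distr M ?P ?D"
    by (rule distr_completion[OF D])
  also have "\<dots> = distr exp_unif_seq ?P (\<lambda>\<sigma>. \<lambda>k\<in>{k. 1 \<le> k}. (1 - rec_x \<sigma> k) * rec_height \<sigma> (Suc k))"
    by (rule distr_PiM_eqI[OF finite_measure_axioms]) (measurable, rule nn_integral_corange_of_paths)
  finally show ?thesis .
qed


text \<open>The independent family indexed by the disjoint sum is cut into the blocks
  \<open>{Inl (Suc i), Inr (Suc i)}\<close>. Independence inside a block gives the product law of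
  each pair, and independence between blocks gives the product law of the sequence.\<close>

lemma distr_exp_unif_seq:
  fixes N :: "'v measure" and E U :: "nat \<Rightarrow> 'v \<Rightarrow> real"
  assumes "prob_space N"
    and E: "\<And>j. 1 \<le> j \<Longrightarrow> distributed N lborel (E j) (exponential_density 1)"
    and U: "\<And>j. 1 \<le> j \<Longrightarrow> distributed N lborel (U j) (indicator {0..1})"
    and indep: "prob_space.indep_vars N (\<lambda>_. borel)
                  (\<lambda>i. case i of Inl j \<Rightarrow> E j | Inr j \<Rightarrow> U j)
                  ({j. 1 \<le> j} <+> {j. 1 \<le> j})"
  shows "distr N exp_unif_seq (\<lambda>v i. (E (Suc i) v, U (Suc i) v)) = exp_unif_seq"
    and "(\<lambda>v i. (E (Suc i) v, U (Suc i) v)) \<in> N \<rightarrow>\<^sub>M exp_unif_seq"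
proof -
  interpret N: prob_space N by fact
  let ?X = "\<lambda>i. case i of Inl j \<Rightarrow> E j | Inr j \<Rightarrow> U j"
  let ?Z = "\<lambda>i v. (E (Suc i) v, U (Suc i) v)"
  have [measurable]: "E (Suc i) \<in> borel_measurable N" "U (Suc i) \<in> borel_measurable N" for i
    using distributed_measurable[OF E[of "Suc i"]] distributed_measurable[OF U[of "Suc i"]] by simp_all
  have distr_E: "distr N borel (E (Suc i)) = std_exp" and distr_U: "distr N borel (U (Suc i)) = unif" for i
    using distributed_distr_eq_density[OF E[of "Suc i"]] distributed_distr_eq_density[OF U[of "Suc i"]]
    by (simp_all add: std_exp_def unif_def cong: distr_cong)
  have Z: "distr N (borel \<Otimes>\<^sub>M borel) (?Z i) = exp_unif" for i
    unfolding exp_unif_def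
  proof (rule pair_measure_eqI[symmetric])
    show "sigma_finite_measure std_exp" "sigma_finite_measure unif" ..
    fix A B assume "A \<in> sets std_exp" "B \<in> sets unif"
    then have [measurable]: "A \<in> sets borel" "B \<in> sets borel" by simp_all
    define C where "C k = (case k of Inl _ \<Rightarrow> A | Inr _ \<Rightarrow> B)" for k :: "nat + nat"
    have "N.prob (\<Inter>k\<in>{Inl (Suc i), Inr (Suc i)}. ?X k -` C k \<inter> space N) =
        (\<Prod>k\<in>{Inl (Suc i), Inr (Suc i)}. N.prob (?X k -` C k \<inter> space N))"
      by (rule N.indep_varsD[OF indep]) (auto simp: C_def)
    moreover have "(\<Inter>k\<in>{Inl (Suc i), Inr (Suc i)}. ?X k -` C k \<inter> space N) = ?Z i -` (A \<times> B) \<inter> space N"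
      by (auto simp: C_def)
    ultimately have "N.prob (?Z i -` (A \<times> B) \<inter> space N) = N.prob (E (Suc i) -` A \<inter> space N) * N.prob (U (Suc i) -` B \<inter> space N)"
      by (simp add: C_def)
    then show "emeasure std_exp A * emeasure unif B = emeasure (distr N (borel \<Otimes>\<^sub>M borel) (?Z i)) (A \<times> B)"
      unfolding distr_E[of i, symmetric] distr_U[of i, symmetric]
      by (simp add: emeasure_distr N.emeasure_eq_measure ennreal_mult')
  qed simp
  have "N.indep_vars (\<lambda>i. PiM {Inl (Suc i), Inr (Suc i)} (\<lambda>_. borel))
      (\<lambda>i v. restrict (\<lambda>k. ?X k v) {Inl (Suc i), Inr (Suc i)}) UNIV"
    by (rule N.indep_vars_restrict[OF indep]) (auto simp: disjoint_family_on_def)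
  then have "N.indep_vars (\<lambda>_. borel \<Otimes>\<^sub>M borel)
      (\<lambda>i v. (\<lambda>r. (r (Inl (Suc i)), r (Inr (Suc i)))) (restrict (\<lambda>k. ?X k v) {Inl (Suc i), Inr (Suc i)})) UNIV"
    by (rule N.indep_vars_compose2) (intro measurable_Pair measurable_component_singleton, auto)
  then have "N.indep_vars (\<lambda>_. borel \<Otimes>\<^sub>M borel) ?Z UNIV"
    by simp
  then have "distr N (PiM UNIV (\<lambda>_. borel \<Otimes>\<^sub>M borel)) (\<lambda>v. \<lambda>i\<in>UNIV. ?Z i v) = exp_unif_seq"
    by (subst (asm) N.indep_vars_iff_distr_eq_PiM') (simp_all add: Z)
  moreover have sets: "sets exp_unif_seq = sets (PiM UNIV (\<lambda>_. borel \<Otimes>\<^sub>M borel))"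
    by (intro sets_PiM_cong) simp_all
  ultimately show "distr N exp_unif_seq (\<lambda>v i. ?Z i v) = exp_unif_seq"
    by (simp add: restrict_UNIV cong: distr_cong)
  show "(\<lambda>v i. ?Z i v) \<in> N \<rightarrow>\<^sub>M exp_unif_seq"
    by (rule measurable_PiM_single') (auto simp: measurable_cong_sets[OF refl sets_exp_unif])
qed

theorem theorem7:
  fixes M :: "'w measure" and Xi :: "'w \<Rightarrow> (real \<times> real) set"
    and N :: "'v measure" and E U :: "nat \<Rightarrow> 'v \<Rightarrow> real"
  assumes PPP: "unit_poisson_strip M Xi"
    and N: "prob_space N"
    and E: "\<And>j. 1 \<le> j \<Longrightarrow> distributed N lborel (E j) (exponential_density 1)"
    and U: "\<And>j. 1 \<le> j \<Longrightarrow> distributed N lborel (U j) (indicator {0..1})"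
    and indep: "prob_space.indep_vars N (\<lambda>_. borel)
                  (\<lambda>i. case i of Inl j \<Rightarrow> E j | Inr j \<Rightarrow> U j)
                  ({j. 1 \<le> j} <+> {j. 1 \<le> j})"
  shows "distr (completion M) (Pi\<^sub>M {k. 1 \<le> k} (\<lambda>_. borel))
           (\<lambda>\<omega>. \<lambda>k\<in>{k. 1 \<le> k}. corange_area (Xi \<omega>) k)
       = distr N (Pi\<^sub>M {k. 1 \<le> k} (\<lambda>_. borel))
           (\<lambda>\<omega>. \<lambda>k\<in>{k. 1 \<le> k}.
              (\<Sum>i=1..k+1. E i \<omega> / (\<Prod>l=1..i-1. U l \<omega>)) * (1 - (\<Prod>l=1..k. U l \<omega>)))"
proof -
  interpret poisson_strip M Xi
    using PPP by (auto simp: poisson_strip_def poisson_strip_axioms_def unit_poisson_strip_def)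
  let ?P = "PiM {k. 1 \<le> k} (\<lambda>_. borel) :: (nat \<Rightarrow> real) measure"
  let ?D = "\<lambda>\<sigma>. \<lambda>k\<in>{k. 1 \<le> k}. (1 - rec_x \<sigma> k) * rec_height \<sigma> (Suc k)"
  let ?Z = "\<lambda>v i. (E (Suc i) v, U (Suc i) v)"
  note Z = distr_exp_unif_seq[OF N E U indep]
  have D: "?D \<in> exp_unif_seq \<rightarrow>\<^sub>M ?P"
    by (intro measurable_restrict borel_measurable_times borel_measurable_diff
        borel_measurable_const borel_measurable_rec_x borel_measurable_rec_height)
  \<comment> \<open>Only the count changes: \<open>\<sigma>\<close> starts at 0, the given variables
    at 1.\<close>
  have T: "rec_x (?Z v) k = (\<Prod>l=1..k. U l v)" for v k
    unfolding rec_x_def by (rule prod.reindex_bij_witness[of _ "\<lambda>l. l - 1" Suc]) auto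
  have g: "rec_height (?Z v) (Suc k) = (\<Sum>i=1..k+1. E i v / (\<Prod>l=1..i-1. U l v))" for v k
    unfolding rec_height_def T by (rule sum.reindex_bij_witness[of _ "\<lambda>i. i - 1" Suc]) auto
  have "distr exp_unif_seq ?P ?D = distr (distr N exp_unif_seq ?Z) ?P ?D"
    by (simp only: Z(1))
  also have "\<dots> = distr N ?P (\<lambda>v. ?D (?Z v))"
    by (simp only: distr_distr[OF D Z(2)] comp_def)
  finally show ?thesis
    unfolding distr_corange_area T g by (simp only: mult.commute)
qed

end
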